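(* Let $\alpha\in(0,1)$, $\theta>1$, and let $\Lambda^{mb}_{\alpha,\theta}$ be the measure on $\mathcal{Q}$ defined by $\Lambda^{mb}_{\alpha,\theta}(\mathrm{d}\bm{x}):=\tilde\nu_{\alpha}(\mathrm{d}\bm{x})+\tilde\mu_{\theta}(\mathrm{d}\bm{x})$, where $\tilde\nu_\alpha(\mathrm{d}\bm{x}):=\nu_\alpha(\mathrm{d}x_1)\otimes\delta_\infty(\mathrm{d}x_2)\otimes\delta_\infty(\mathrm{d}x_3)\otimes\cdots$ with $\nu_\alpha(\mathrm{d}\mathfrak{z}):=\frac{\alpha}{\Gamma(1-\alpha)}\frac{\mathrm{d}\mathfrak{z}}{\mathfrak{z}^{\alpha+1}}$ on $(0,\infty)$, and $\tilde\mu_\theta(\mathrm{d}\bm{x}):=\delta_0(\mathrm{d}x_1)\otimes\mu_\theta(\mathrm{d}x_2)\otimes\delta_\infty(\mathrm{d}x_3)\otimes\delta_\infty(\mathrm{d}x_4)\otimes\cdots$ with $\mu_\theta(\mathrm{d}\mathfrak{z}):=e^{\mathfrak{z}^\theta}\mathds{1}_{\{\mathfrak{z}\ge0\}}\mathrm{d}\mathfrak{z}$. Let $\gamma:=\dfrac{1}{\alpha+(1-\alpha)\theta}$. Then the branching subordinator $Y$ with characteristic couple $(0,\Lambda^{mb}_{\alpha,\theta})$ satisfies, $\mathbb{P}$-almost surely, $$0<\liminf_{t\to\infty}\frac{\underline{Y}(t)}{t^{\gamma}}\le\limsup_{t\to\infty}\frac{\underline{Y}(t)}{t^{\gamma}}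<\infty.$$
   Context: **The space $\mathcal{Q}$.** $\mathcal{Q}$ is the set of non-decreasing sequences $\bm{x}=(x_n)_{n\ge1}$ in $[0,\infty]$ with $\lim_n x_n=\infty$, identified with the point measures $\sum_{n:x_n<\infty}\delta_{x_n}$ on $[0,\infty)$ giving finite mass to each $[0,a]$; it carries the vague topology and its Borel $\sigma$-field. $\emptyset:=(\infty,\infty,\ldots)$, $(0,\emptyset):=(0,\infty,\infty,\ldots)$, $\mathcal{Q}^{\star}:=\{\bm{x}\in\mathcal{Q};\ x_2<\infty\}$. (For $\tilde\nu_\alpha$ the sequence is $(x_1,\infty,\infty,\ldots)$ with $x_1$ chosen according to $\nu_\alpha$.) **Characteristic couples.** Below $d\ge0$ and $\Lambda$ is a measure on $\mathcal{Q}$ with $\Lambda(\{(0,\emptyset)\})+\Lambda(\{\emptyset\})=0$, $\int_{\mathcal{Q}}(1\wedge x_1)\Lambda(\mathrm{d}\bm{x})<\infty$, $\Lambda(\mathcal{Q}^{\star})\in(0,\infty]$ and $\int_{\mathcal{Q}}|\sharp\{n\ge 1; x_n<a\}-1|\Lambda(\mathrm{d}\bm{x})<\infty$ for all $a>0$; the measure $\Lambda^{mb}_{\alpha,\theta}$ satisfies these conditions. **Truncation.** For $a>0$, $T_a:\mathcal{Q}\to\mathcal{Q}$ keeps $x_1$ unchanged and, for $i\ge2$, keeps $x_i$ if $x_i<a$ and replaces it by $\infty$ if $x_i\ge a$. $\Lambda^a(\mathrm{d}\bm{x}):=\mathds{1}_{\{\bm{x}\ne(0,\emptyset)\}}(T_a\Lambda)(\mathrm{d}\bm{x})$,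 with $T_a\Lambda$ the image measure. Then $\Lambda^a(\mathcal{Q}^\star)=\Lambda(\{x_2<a\})<\infty$, and one fixes $a_0(\Lambda)\ge0$ such that $\Lambda^a(\mathcal{Q}^\star)>0$ for all $a>a_0(\Lambda)$. **Truncated branching subordinator $Y^a$** ($a>a_0(\Lambda)$). At time $0$ there is one particle $\varnothing$, at position $0$. Particles never die. A particle $u$ born at time $\mathfrak{b}_u$ has, independently of the other particles, a subordinator $\xi_u$ started at $0$ with drift $d$ and Lévy measure the image of $\Lambda^a(\cdot\cap(\mathcal{Q}\setminus\mathcal{Q}^\star))$ under $\bm{x}\mapsto x_1$, and an independent Poisson point process $\mathcal{P}_u$ of points $(s,\bm{x})$ on $[\mathfrak{b}_u,\infty)\times\mathcal{Q}^\star$ with intensity $\mathrm{d}s\otimes\Lambda^a(\cdot\cap\mathcal{Q}^\star)$. For $t\ge\mathfrak{b}_u$ its position $Y^a_u(t)$ is its birth position plus $\xi_u(t-\mathfrak{b}_u)$ plus the sum of $x_1$ over points $(s,\bm{x})\in\mathcal{P}_u$ with $s\le t$. At each point $(s,\bm{x})\in\mathcal{P}_u$ (a branching), for each $i\ge2$ with $x_i<\infty$ a child of $u$ is born at time $s$ at position $Y^a_u(s-)+x_i$. $\mathcal{N}^a(t)$ is the (a.s. finite) set of particles born by time $t$; for $u\in\mathcal{N}^a(t)$ and $s<\mathfrak{b}_u$, $Y^a_u(s)$ is the position at time $s$ of the most recent ancestor of $u$ alive at time $s$. $Y^a(t):=\sum_{u\in\mathcal{N}^a(t)}\delta_{Y^a_u(t)}$.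 **Branching subordinator $Y$.** The $Y^a$ are constructed jointly so that for $a\le a'$, $Y^a$ is obtained from $Y^{a'}$ by removing, at each branching, every newborn child whose birth position is at distance $\ge a$ from the pre-branching position of its parent, together with all its descendants. The branching subordinator with characteristic couple $(d,\Lambda)$ is $Y(t):=\lim_{a\to\infty}\uparrow Y^a(t)$, with particle set $\mathcal{N}(t):=\bigcup_a\mathcal{N}^a(t)$ and positions $Y_u(t)$. The leftmost position is $\underline{Y}(t):=\min_{u\in\mathcal{N}(t)}Y_u(t)$. *)

theory Defs
  imports "HOL-Probability.Probability"
begin

section \<open>The space of sequences\<close>

text \<open>Sequences are indexed from 0: the informal \<open>x\<^sub>1, x\<^sub>2, \<dots>\<close> is \<open>x 0, x 1, \<dots>\<close>.\<close>

type_synonym qseq = "nat \<Rightarrow> ennreal"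

definition Q_space :: "qseq set" where
  "Q_space = {x. mono x \<and> x \<longlonglongrightarrow> \<infinity>}"

definition Q_empty :: qseq where
  "Q_empty = (\<lambda>n. \<infinity>)"

definition Q_zero :: qseq where
  "Q_zero = (\<lambda>n. if n = 0 then 0 else \<infinity>)"

definition Q_star :: "qseq set" where
  "Q_star = {x \<in> Q_space. x 1 < \<infinity>}"

text \<open>The integral of \<open>f\<close> against the point measure of the finite entries of \<open>x\<close>. For \<open>f\<close> of
  bounded support and \<open>x\<close> in \<open>Q_space\<close> only finitely many terms are nonzero.\<close>

definition Q_integral :: "(real \<Rightarrow> real) \<Rightarrow> qseq \<Rightarrow> real" where
  "Q_integral f x = (\<Sum>\<^sub>\<infinity>n\<in>{n. x n < \<infinity>}. f (enn2real (x n)))"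

definition vague_topology :: "qseq topology" where
  "vague_topology = topology_generated_by
     {{x \<in> Q_space. Q_integral f x \<in> U} | f U.
        continuous_on {0..} f \<and> (\<exists>K. \<forall>z\<ge>K. f z = 0) \<and> open U}"

definition Q_borel :: "qseq measure" where
  "Q_borel = sigma Q_space {U. openin vague_topology U}"

section \<open>Characteristic couples and truncation\<close>

definition characteristic_couple :: "real \<Rightarrow> qseq measure \<Rightarrow> bool" where
  "characteristic_couple d \<Lambda> \<longleftrightarrow>
     0 \<le> d \<and>
     space \<Lambda> = Q_space \<and> sets \<Lambda> = sets Q_borel \<and>
     emeasure \<Lambda> {Q_zero} + emeasure \<Lambda> {Q_empty} = 0 \<and>
     (\<integral>\<^sup>+ x. min 1 (x 0) \<partial>\<Lambda>) < \<infinity> \<and>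
     0 < emeasure \<Lambda> Q_star \<and>
     (\<forall>a>0. (\<integral>\<^sup>+ x. ennreal \<bar>real (card {n. x n < ennreal a}) - 1\<bar> \<partial>\<Lambda>) < \<infinity>)"

definition trunc :: "real \<Rightarrow> qseq \<Rightarrow> qseq" where
  "trunc a x = (\<lambda>n. if n = 0 \<or> x n < ennreal a then x n else \<infinity>)"

definition trunc_measure :: "real \<Rightarrow> qseq measure \<Rightarrow> qseq measure" where
  "trunc_measure a \<Lambda> = density (distr \<Lambda> Q_borel (trunc a)) (indicator (Q_space - {Q_zero}))"

section \<open>Subordinators and Poisson point processes\<close>

text \<open>Drift and Levy measure are read off from the Laplace exponent.\<close>

definition subordinator ::
    "'w measure \<Rightarrow> real \<Rightarrow> real measure \<Rightarrow> (real \<Rightarrow> 'w \<Rightarrow> real) \<Rightarrow> bool" where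
  "subordinator M d L \<xi> \<longleftrightarrow>
     (\<forall>t\<ge>0. \<xi> t \<in> borel_measurable M) \<and>
     (AE \<omega> in M. \<xi> 0 \<omega> = 0 \<and> mono_on {0..} (\<lambda>t. \<xi> t \<omega>) \<and>
        (\<forall>t\<ge>0. continuous (at_right t) (\<lambda>t. \<xi> t \<omega>))) \<and>
     (\<forall>\<tau> :: nat \<Rightarrow> real. 0 \<le> \<tau> 0 \<and> mono \<tau> \<longrightarrow>
        prob_space.indep_vars M (\<lambda>_. borel) (\<lambda>k \<omega>. \<xi> (\<tau> (Suc k)) \<omega> - \<xi> (\<tau> k) \<omega>) UNIV) \<and>
     (\<forall>s\<ge>0. \<forall>t\<ge>0. distr M borel (\<lambda>\<omega>. \<xi> (s + t) \<omega> - \<xi> s \<omega>) = distr M borel (\<xi> t)) \<and>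
     (\<forall>t\<ge>0. \<forall>q\<ge>0. (\<integral>\<omega>. exp (- q * \<xi> t \<omega>) \<partial>M) =
        exp (- t * (d * q + (\<integral>z. 1 - exp (- q * z) \<partial>L))))"

text \<open>The points of a process on \<open>[0,\<infinity>) \<times> E\<close> are listed as \<open>(s j, x j)\<close> in an
  arbitrary order; \<open>s j = \<infinity>\<close> means that there is no point number \<open>j\<close>.\<close>

definition point_count :: "(nat \<Rightarrow> ennreal) \<Rightarrow> (nat \<Rightarrow> 'e) \<Rightarrow> (real \<times> 'e) set \<Rightarrow> ennreal" where
  "point_count s x B =
     emeasure (count_space UNIV) {j. s j < \<infinity> \<and> (enn2real (s j), x j) \<in> B}"

definition poisson_point_process ::
    "'w measure \<Rightarrow> (real \<times> 'e) measure \<Rightarrow> (nat \<Rightarrow> 'w \<Rightarrow> ennreal) \<Rightarrow> (nat \<Rightarrow> 'w \<Rightarrow> 'e) \<Rightarrow> bool" where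
  "poisson_point_process M \<mu> s x \<longleftrightarrow>
     (\<forall>B\<in>sets \<mu>. emeasure \<mu> B < \<infinity> \<longrightarrow>
        (\<forall>k. measure M {\<omega> \<in> space M. point_count (\<lambda>j. s j \<omega>) (\<lambda>j. x j \<omega>) B = of_nat k} =
               exp (- measure \<mu> B) * measure \<mu> B ^ k / fact k)) \<and>
     (\<forall>B :: nat \<Rightarrow> (real \<times> 'e) set. range B \<subseteq> sets \<mu> \<and> disjoint_family B \<longrightarrow>
        prob_space.indep_vars M (\<lambda>_. borel)
          (\<lambda>i \<omega>. point_count (\<lambda>j. s j \<omega>) (\<lambda>j. x j \<omega>) (B i)) UNIV)"

section \<open>The particle system driven by given noise\<close>

text \<open>\<open>[]\<close> is the initial particle, and \<open>(j, i) # u\<close> is the child of \<open>u\<close> created by the entry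
  with index \<open>i \<ge> 1\<close> of the point number \<open>j\<close> of the point process of \<open>u\<close>.\<close>

type_synonym particle = "(nat \<times> nat) list"

text \<open>The noise of a particle is parametrised by its age: the point \<open>(s, x)\<close> of the process
  \<open>\<P>\<^sub>u\<close> on \<open>[\<bb>\<^sub>u,\<infinity>)\<close> is recorded with \<open>s - \<bb>\<^sub>u\<close> as its \<open>age\<close> and \<open>x\<close> as its
  \<open>mark\<close>. As for \<open>point_count\<close>, an infinite age means that the point is absent.\<close>

record noise =
  motion :: "particle \<Rightarrow> real \<Rightarrow> real"
  age :: "particle \<Rightarrow> nat \<Rightarrow> ennreal"
  mark :: "particle \<Rightarrow> nat \<Rightarrow> qseq"

text \<open>Birth time, infinite if the particle is never born.\<close>

primrec birth :: "noise \<Rightarrow> particle \<Rightarrow> ennreal" where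
  "birth z [] = 0"
| "birth z (c # u) =
     (if 1 \<le> snd c \<and> mark z u (fst c) (snd c) < \<infinity> then birth z u + age z u (fst c) else \<infinity>)"

definition particles :: "noise \<Rightarrow> real \<Rightarrow> particle set" where
  "particles z t = {u. birth z u \<le> ennreal t}"

definition displacement :: "noise \<Rightarrow> particle \<Rightarrow> real \<Rightarrow> real" where
  "displacement z u r =
     motion z u r + (\<Sum>j | age z u j \<le> ennreal r. enn2real (mark z u j 0))"

text \<open>Position at time \<open>t\<close>, following the ancestral line before the birth time.\<close>

primrec position :: "noise \<Rightarrow> particle \<Rightarrow> real \<Rightarrow> real" where
  "position z [] = (\<lambda>t. displacement z [] t)"
| "position z (c # u) =
     (let b = enn2real (birth z (c # u)) in
      (\<lambda>t. if t < b then position z u t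
           else Lim (at_left b) (position z u) + enn2real (mark z u (fst c) (snd c))
                + displacement z (c # u) (t - b)))"

section \<open>Branching subordinators\<close>

text \<open>Across particles the numbered points are independent, because the labels of the offspring
  depend on the numbering. Within one particle only the point process itself, not its numbering, is
  required to be independent of the motion: a numbering that serves all truncation levels at once
  depends on points that lower levels count as part of the motion.\<close>

definition truncated_branching_subordinator ::
    "'w measure \<Rightarrow> real \<Rightarrow> qseq measure \<Rightarrow> real \<Rightarrow> ('w \<Rightarrow> noise) \<Rightarrow> bool" where
  "truncated_branching_subordinator M d \<Lambda> a Z \<longleftrightarrow>
     (let levy = distr (density (trunc_measure a \<Lambda>) (indicator (Q_space - Q_star))) borel
                   (\<lambda>x. enn2real (x 0));
          intensity = density lborel (indicator {0..}) \<Otimes>\<^sub>M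
                   density (trunc_measure a \<Lambda>) (indicator Q_star)
      in
      (\<forall>u. subordinator M d levy (\<lambda>r \<omega>. motion (Z \<omega>) u r)) \<and>
      (\<forall>u. poisson_point_process M intensity
             (\<lambda>j \<omega>. age (Z \<omega>) u j) (\<lambda>j \<omega>. mark (Z \<omega>) u j)) \<and>
      (\<forall>u. prob_space.indep_set M
             (sets (vimage_algebra (space M) (\<lambda>\<omega>. \<lambda>r\<in>{0..}. motion (Z \<omega>) u r)
                (PiM {0..} (\<lambda>_. borel))))
             (sets (vimage_algebra (space M)
                (\<lambda>\<omega>. \<lambda>B\<in>sets intensity. point_count (age (Z \<omega>) u) (mark (Z \<omega>) u) B)
                (PiM (sets intensity) (\<lambda>_. borel))))) \<and>
      prob_space.indep_vars M
        (\<lambda>u. PiM {0..} (\<lambda>_. borel) \<Otimes>\<^sub>M PiM UNIV (\<lambda>_. borel \<Otimes>\<^sub>M Q_borel))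
        (\<lambda>u \<omega>. (\<lambda>r\<in>{0..}. motion (Z \<omega>) u r, \<lambda>j. (age (Z \<omega>) u j, mark (Z \<omega>) u j)))
        UNIV)"

text \<open>No particle on the ancestral line of \<open>u\<close>, including \<open>u\<close>, is born at distance \<open>\<ge> a\<close> from the
  pre-branching position of its parent.\<close>

primrec kept :: "real \<Rightarrow> noise \<Rightarrow> particle \<Rightarrow> bool" where
  "kept a z [] \<longleftrightarrow> True"
| "kept a z (c # u) \<longleftrightarrow> mark z u (fst c) (snd c) < ennreal a \<and> kept a z u"

definition obtained_by_removal :: "real \<Rightarrow> noise \<Rightarrow> noise \<Rightarrow> bool" where
  "obtained_by_removal a z z' \<longleftrightarrow>
     (\<forall>t\<ge>0. particles z t = {u \<in> particles z' t. kept a z' u} \<and>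
        (\<forall>u\<in>particles z t. position z u t = position z' u t))"

text \<open>\<open>Z a\<close> is the noise driving the truncated process at level \<open>a > a\<^sub>0\<close>; values at other levels
  are irrelevant.\<close>

definition branching_subordinator ::
    "'w measure \<Rightarrow> real \<Rightarrow> qseq measure \<Rightarrow> real \<Rightarrow> (real \<Rightarrow> 'w \<Rightarrow> noise) \<Rightarrow> bool" where
  "branching_subordinator M d \<Lambda> a\<^sub>0 Z \<longleftrightarrow>
     prob_space M \<and>
     characteristic_couple d \<Lambda> \<and>
     0 \<le> a\<^sub>0 \<and> (\<forall>a>a\<^sub>0. 0 < emeasure (trunc_measure a \<Lambda>) Q_star) \<and>
     (\<forall>a>a\<^sub>0. truncated_branching_subordinator M d \<Lambda> a (Z a)) \<and>
     (AE \<omega> in M. \<forall>a a'. a\<^sub>0 < a \<and> a \<le> a' \<longrightarrow> obtained_by_removal a (Z a \<omega>) (Z a' \<omega>))"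

definition all_particles :: "real \<Rightarrow> (real \<Rightarrow> noise) \<Rightarrow> real \<Rightarrow> particle set" where
  "all_particles a\<^sub>0 z t = (\<Union>a\<in>{a\<^sub>0<..}. particles (z a) t)"

text \<open>As a function of \<open>a\<close>, the position is constant once \<open>u\<close> is a particle of level \<open>a\<close>.\<close>

definition limit_position :: "(real \<Rightarrow> noise) \<Rightarrow> particle \<Rightarrow> real \<Rightarrow> real" where
  "limit_position z u t = Lim at_top (\<lambda>a. position (z a) u t)"

text \<open>The infimum is almost surely attained, the particles below any level being finite in number.\<close>

definition leftmost :: "real \<Rightarrow> (real \<Rightarrow> noise) \<Rightarrow> real \<Rightarrow> real" where
  "leftmost a\<^sub>0 z t = (INF u\<in>all_particles a\<^sub>0 z t. limit_position z u t)"

section \<open>The measure of the example\<close>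

definition nu :: "real \<Rightarrow> real measure" where
  "nu \<alpha> = density lborel
     (\<lambda>z. ennreal (\<alpha> / Gamma (1 - \<alpha>) * (1 / z powr (\<alpha> + 1))) * indicator {0<..} z)"

definition mu :: "real \<Rightarrow> real measure" where
  "mu \<theta> = density lborel (\<lambda>z. ennreal (exp (z powr \<theta>)) * indicator {0..} z)"

definition nu_tilde :: "real \<Rightarrow> qseq measure" where
  "nu_tilde \<alpha> = distr (nu \<alpha>) Q_borel (\<lambda>z n. if n = 0 then ennreal z else \<infinity>)"

definition mu_tilde :: "real \<Rightarrow> qseq measure" where
  "mu_tilde \<theta> =
     distr (mu \<theta>) Q_borel (\<lambda>z n. if n = 0 then 0 else if n = 1 then ennreal z else \<infinity>)"

definition Lambda_mb :: "real \<Rightarrow> real \<Rightarrow> qseq measure" where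
  "Lambda_mb \<alpha> \<theta> = measure_of Q_space (sets Q_borel)
     (\<lambda>A. emeasure (nu_tilde \<alpha>) A + emeasure (mu_tilde \<theta>) A)"

end

theory Submission
  imports Defs "HOL-Real_Asymp.Real_Asymp"
begin

text \<open>
  The Laplace exponent of the motions is \<open>\<psi> q = \<psi> 1 * q powr \<alpha>\<close>, and with \<open>1 / \<gamma> = \<alpha> + (1 - \<alpha>) * \<theta>\<close> the level
  \<open>N\<close> corresponds to times of order \<open>N powr (1 / \<gamma>)\<close>.

  Lower bound: a particle below \<open>N\<close> at time \<open>t\<close> belongs to the system truncated at \<open>N\<close>. For
  \<open>q = 2 * N powr (\<theta> - 1)\<close> the births contribute negligibly to the growth rate of the expected sum of
  \<open>exp (- q * Y)\<close> over the particles, which is therefore \<open>O(exp (- t * \<psi> q / 2))\<close>. At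
  \<open>t = 6 / \<psi> 1 * N powr (1 / \<gamma>)\<close> one has \<open>t * \<psi> q / 2 \<ge> 3 * N powr \<theta>\<close> whereas \<open>q * N = 2 * N powr \<theta>\<close>, so the
  probability of a particle below \<open>N\<close> is \<open>O(exp (- N))\<close>.

  Upper bound: during the first unit of time the initial particle has a Poisson number of children at
  distance less than \<open>N\<close>, with mean at least \<open>exp ((N / 2) powr \<theta>)\<close>. Splitting the time interval into
  \<open>k\<close> equal pieces shows that the motion of a child stays below \<open>N\<close> up to time \<open>\<kappa> * N powr (1 / \<gamma>)\<close> with
  probability at least \<open>(1 / 2) ^ k\<close>, where \<open>k\<close> is about \<open>(N / 2) powr \<theta> / 2\<close> if \<open>\<kappa>\<close> is small. Hence some child
  stays below, up to an event of probability \<open>exp (- N / 4)\<close>.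

  Both families of events are summable over \<open>N\<close>, and positions are non-decreasing in time.
\<close>

section \<open>The Borel sets of the space of sequences\<close>

text \<open>The exponent comes from a balance: the maximum over \<open>q\<close> of
  \<open>t * \<psi> q - q * N\<close>, the exponential cost for a motion to stay below
  \<open>N\<close> up to time \<open>t\<close>, is of order
  \<open>(t / N powr \<alpha>) powr (1 / (1 - \<alpha>))\<close>. It meets the logarithm
  \<open>N powr \<theta>\<close> of the number of births within distance \<open>N\<close> when
  \<open>t\<close> is of order \<open>N powr (\<alpha> + (1 - \<alpha>) * \<theta>)\<close>. The
  maximiser is then of order \<open>N powr (\<theta> - 1)\<close>, which is the \<open>q\<close> of
  the lower bound.

  The obstacle is the labelling. Labels of children depend on the numbering of the points, while
  within one particle only the counts of points are independent of the motion. So the expectation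
  for a single label is never evaluated: independence of different particles factorises the expected
  weight of an ancestral line, and within one particle the sum over all point numbers is taken
  first, which leaves counts of rectangles. This is why the weights see the motion only at grid
  times. In the upper bound the random set of labels is fixed by splitting over the countably many
  finite sets, each an event of the noise of the initial particle.\<close>

definition vanish_at_top :: "(real \<Rightarrow> real) \<Rightarrow> ennreal \<Rightarrow> real" where
  "vanish_at_top f e = (if e = \<infinity> then 0 else f (enn2real e))"

text \<open>Since \<open>x\<close> is non-decreasing, all entries from index \<open>N\<close> on lie
  beyond the support of \<open>f\<close>. If \<open>ennreal K < x N\<close>, the same
  \<open>N\<close> serves for all sequences near \<open>x\<close>, so that
  \<open>Q_integral f\<close> is locally one fixed finite sum.\<close>

lemma Q_integral_eq_sum:
  assumes "x \<in> Q_space" "\<forall>z\<ge>K. f z = 0" "ennreal K \<le> x N"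
  shows "Q_integral f x = (\<Sum>n<N. vanish_at_top f (x n))"
proof -
  have "f (enn2real (x n)) = 0" if "n \<ge> N" "x n < \<infinity>" for n
  proof -
    have "ennreal K \<le> x n"
      using assms(1,3) that(1) order_trans[OF assms(3), of "x n"] by (auto simp: Q_space_def mono_def)
    then have "K \<le> enn2real (x n)"
      using that(2) by (cases "x n") auto
    then show ?thesis using assms by simp
  qed
  then have "Q_integral f x = infsum (\<lambda>n. vanish_at_top f (x n)) {..<N}"
    unfolding Q_integral_def
    by (intro infsum_cong_neutral)
       (auto simp: vanish_at_top_def less_top not_less)
  then show ?thesis by simp
qed

text \<open>Bounded support gives continuity at infinity: the function is zero on the neighbourhood
  \<open>{ennreal K<..}\<close> of \<open>top\<close>, and this open set and the finite values cover
  everything.\<close>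

lemma continuous_vanish_at_top:
  assumes "continuous_on {0..} f" "\<forall>z\<ge>K. f z = 0"
  shows "continuous_on UNIV (vanish_at_top f)"
proof -
  have 1: "continuous_on {..<top} (vanish_at_top f)"
  proof -
    have "continuous_on {..<top} enn2real"
      unfolding continuous_on_def
    proof
      fix e :: ennreal assume "e \<in> {..<top}"
      then have "((\<lambda>e. e) \<longlongrightarrow> ennreal (enn2real e)) (at e within {..<top})" by simp
      then show "(enn2real \<longlongrightarrow> enn2real e) (at e within {..<top})"
        by (rule tendsto_enn2real) simp
    qed
    then have "continuous_on {..<top} (\<lambda>e. f (enn2real e))"
      by (intro continuous_on_compose2[OF assms(1)]) auto
    then show ?thesis
      by (rule continuous_on_eq) (auto simp: vanish_at_top_def)
  qed
  have 2: "continuous_on {ennreal K<..} (vanish_at_top f)"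
  proof (rule continuous_on_eq[OF continuous_on_const])
    fix e assume "e \<in> {ennreal K<..}"
    then have "e \<noteq> top \<Longrightarrow> K \<le> enn2real e"
      by (cases e) (auto simp: less_imp_le dest!: less_imp_le)
    then show "0 = vanish_at_top f e"
      using assms(2) by (auto simp: vanish_at_top_def)
  qed
  have "{..<top} \<union> {ennreal K<..} = UNIV"
    by (auto simp: not_less intro: le_less_trans[OF _ ennreal_less_top])
  then show ?thesis
    using continuous_on_open_Un[OF _ _ 1 2] by auto
qed

lemma continuous_on_Q_integral:
  assumes "continuous_on {0..} f" "\<forall>z\<ge>K. f z = 0"
  shows "continuous_on Q_space (Q_integral f)"
  unfolding continuous_on_def
proof
  fix x assume x: "x \<in> Q_space"
  then have "x \<longlonglongrightarrow> \<infinity>" by (simp add: Q_space_def)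
  then have "\<forall>\<^sub>F n in sequentially. ennreal K < x n"
    by (auto simp: order_tendsto_iff)
  then obtain N where N: "ennreal K < x N"
    by (auto simp: eventually_sequentially)
  let ?S = "\<lambda>y. \<Sum>n<N. vanish_at_top f (y n)"
  have cS: "continuous_on UNIV ?S"
    by (intro continuous_intros continuous_on_compose2[OF continuous_vanish_at_top[OF assms]])
       (auto intro: continuous_on_subset[OF continuous_on_product_coordinates])
  then have "(?S \<longlongrightarrow> ?S x) (at x within Q_space)"
    by (meson continuous_on_def continuous_on_subset subset_UNIV x)
  moreover have "\<forall>\<^sub>F y in at x within Q_space. ?S y = Q_integral f y"
  proof -
    have "open {y::qseq. ennreal K < y N}"
      by (intro open_Collect_less continuous_on_const continuous_on_product_coordinates)
    then have "\<forall>\<^sub>F y in nhds x. ennreal K < y N"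
      using N by (auto simp: eventually_nhds)
    then show ?thesis
      unfolding eventually_at_filter
      by (rule eventually_mono) (use assms in \<open>auto simp: Q_integral_eq_sum[of _ K f N] less_imp_le\<close>)
  qed
  ultimately have "(Q_integral f \<longlongrightarrow> ?S x) (at x within Q_space)"
    by (rule Lim_transform_eventually)
  then show "(Q_integral f \<longlongrightarrow> Q_integral f x) (at x within Q_space)"
    using Q_integral_eq_sum[OF x assms(2), of N] N by simp
qed

text \<open>The subbasis of the vague topology is uncountable, so measurability of \<open>trunc a\<close> is reduced to the
  second countable product topology, which induces the same Borel sets.\<close>

lemma vague_open_imp_openin:
  assumes "openin vague_topology U"
  shows "openin (top_of_set Q_space) U"
proof -
  have "generate_topology_on {{x \<in> Q_space. Q_integral f x \<in> U} | f U.
        continuous_on {0..} f \<and> (\<exists>K. \<forall>z\<ge>K. f z = 0) \<and> open U} U"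
    using assms by (simp add: vague_topology_def openin_topology_generated_by_iff)
  then show ?thesis
  proof (induction rule: generate_topology_on.induct)
    case (Basis s)
    then obtain f V K where s: "s = {x \<in> Q_space. Q_integral f x \<in> V}"
      "continuous_on {0..} f" "\<forall>z\<ge>K. f z = 0" "open V" by blast
    have "s = Q_space \<inter> Q_integral f -` V" using s by auto
    then show ?case
      using continuous_openin_preimage_gen[OF continuous_on_Q_integral[OF s(2,3)] s(4)] by simp
  qed (auto intro: openin_Union)
qed

text \<open>The condition says that at least \<open>n + 1\<close> points lie below \<open>y\<close>.
  A trapezoidal test function equal to 1 up to \<open>b = x n\<close> and to 0 from some
  \<open>c\<close> below \<open>y\<close> on has integral at least \<open>n + 1\<close> at
  \<open>x\<close>, but at most \<open>n\<close> at every sequence whose entry \<open>n\<close> is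
  at least \<open>c\<close>. The threshold \<open>n + 1/2\<close> separates the two cases.\<close>

lemma openin_vague_coordinate: "openin vague_topology {x \<in> Q_space. x n < y}"
proof (subst openin_subopen, safe)
  fix x assume x: "x \<in> Q_space" "x n < y"
  then obtain e where e: "x n < e" "e < y" using dense by blast
  moreover from e have "e < top" using less_le_trans top_greatest by blast
  ultimately obtain c where c: "x n < ennreal c" "ennreal c < y" "0 \<le> c"
    by (cases e) auto
  define b where "b = enn2real (x n)"
  have xb: "x n = ennreal b" and b0: "0 \<le> b"
    using c(1) by (auto simp: b_def intro!: ennreal_enn2real[symmetric] intro: less_trans[OF _ ennreal_less_top])
  have bc: "b < c" using c xb b0 by (simp add: ennreal_less_iff)
  define f where "f z = max 0 (min 1 ((c - z) / (c - b)))" for z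
  have f: "continuous_on {0..} f" "\<forall>z\<ge>c. f z = 0"
  proof -
    show "continuous_on {0..} f"
      using bc unfolding f_def by (intro continuous_intros; simp)
    have "(c - z) / (c - b) \<le> 0" if "z \<ge> c" for z
      using bc that by (intro divide_nonpos_pos) auto
    then have "min 1 ((c - z) / (c - b)) \<le> 0" if "z \<ge> c" for z
      using that min.coboundedI2 by blast
    then show "\<forall>z\<ge>c. f z = 0"
      unfolding f_def by (simp add: max.absorb1)
  qed
  define T where "T = {x \<in> Q_space. Q_integral f x \<in> {n + 1/2<..}}"
  have "openin vague_topology T"
    unfolding vague_topology_def T_def
  proof (rule topology_generated_by_Basis, rule CollectI, intro exI conjI)
    show "{x \<in> Q_space. Q_integral f x \<in> {real n + 1/2<..}}
        = {x \<in> Q_space. Q_integral f x \<in> {real n + 1/2<..}}" ..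
  qed (use f in auto)
  moreover have "x \<in> T"
  proof -
    have "x \<longlonglongrightarrow> \<infinity>" using x by (simp add: Q_space_def)
    then have "\<forall>\<^sub>F n in sequentially. ennreal c < x n"
      by (auto simp: order_tendsto_iff)
    then obtain N where N: "ennreal c < x N"
      by (auto simp: eventually_sequentially)
    have nN: "n < N"
    proof (rule ccontr)
      assume "\<not> n < N"
      then have "x N \<le> x n" using x by (auto simp: Q_space_def mono_def)
      then show False using N c by (meson leD less_trans)
    qed
    have "real (Suc n) = (\<Sum>i\<in>{..n}. 1)" by simp
    also have "\<dots> \<le> (\<Sum>i\<in>{..n}. vanish_at_top f (x i))"
    proof (rule sum_mono)
      fix i assume "i \<in> {..n}"
      then have "x i \<le> x n" using x(1) by (auto simp: Q_space_def mono_def)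
      then have "x i \<le> ennreal b" by (simp add: xb)
      moreover from this have "x i \<noteq> top" by (auto simp: top_unique)
      ultimately have "enn2real (x i) \<le> b"
        using b0 by (metis enn2real_leI)
      then show "1 \<le> vanish_at_top f (x i)"
        using bc \<open>x i \<noteq> top\<close> by (simp add: vanish_at_top_def f_def divide_simps)
    qed
    also have "\<dots> \<le> (\<Sum>i<N. vanish_at_top f (x i))"
      using nN by (intro sum_mono2) (auto simp: vanish_at_top_def f_def)
    also have "\<dots> = Q_integral f x"
      by (rule Q_integral_eq_sum[symmetric]) (use x f N in auto)
    finally show ?thesis using x by (simp add: T_def)
  qed
  moreover have "T \<subseteq> {x \<in> Q_space. x n < y}"
  proof
    fix x' assume x': "x' \<in> T"
    have "x' n < ennreal c"
    proof (rule ccontr)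
      assume "\<not> x' n < ennreal c"
      then have "Q_integral f x' = (\<Sum>i<n. vanish_at_top f (x' i))"
        using x' f by (intro Q_integral_eq_sum[of _ c]) (auto simp: T_def)
      also have "\<dots> \<le> (\<Sum>i<n. 1)"
        by (intro sum_mono) (auto simp: vanish_at_top_def f_def)
      finally show False using x' by (simp add: T_def)
    qed
    then show "x' \<in> {x \<in> Q_space. x n < y}" using x' c by (auto simp: T_def)
  qed
  ultimately show "\<exists>T. openin vague_topology T \<and> x \<in> T \<and> T \<subseteq> {x \<in> Q_space. x n < y}"
    by blast
qed

lemma space_Q_borel [simp]: "space Q_borel = Q_space"
  unfolding Q_borel_def by (rule space_measure_of) (use vague_open_imp_openin openin_imp_subset in blast)

text \<open>One inclusion holds because vaguely open sets are relatively open for the product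
  topology, the other because the sets \<open>x n < y\<close> are vaguely open. Measurability into
  \<open>Q_borel\<close> can then be tested coordinatewise.\<close>

lemma sets_Q_borel: "sets Q_borel = sets (restrict_space (PiM UNIV (\<lambda>_. borel)) Q_space)"
proof
  have sQ: "sets Q_borel = sigma_sets Q_space {U. openin vague_topology U}"
    unfolding Q_borel_def
    by (rule sets_measure_of) (use vague_open_imp_openin openin_imp_subset in blast)
  have "{U. openin vague_topology U} \<subseteq> sets (restrict_space (PiM UNIV (\<lambda>_. borel)) Q_space)"
  proof
    fix U assume "U \<in> {U. openin vague_topology U}"
    then obtain V where "open V" "U = Q_space \<inter> V"
      using vague_open_imp_openin by (auto simp: openin_open)
    then show "U \<in> sets (restrict_space (PiM UNIV (\<lambda>_. borel)) Q_space)"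
      by (auto simp: sets_restrict_space sets_PiM_equal_borel)
  qed
  then show "sets Q_borel \<subseteq> sets (restrict_space (PiM UNIV (\<lambda>_. borel)) Q_space)"
    unfolding sQ
    by (intro sets.sigma_sets_subset') (auto simp: sets_restrict_space sets_PiM_equal_borel)
  have "(\<lambda>x. x n) \<in> borel_measurable Q_borel" for n
  proof (rule borel_measurableI_less)
    fix y :: ennreal
    have "{x \<in> space Q_borel. x n < y} = {x \<in> Q_space. x n < y}" by simp
    then show "{x \<in> space Q_borel. x n < y} \<in> sets Q_borel"
      unfolding sQ using openin_vague_coordinate by auto
  qed
  then have "(\<lambda>x. \<lambda>n\<in>UNIV. x n) \<in> Q_borel \<rightarrow>\<^sub>M PiM UNIV (\<lambda>_. borel)"
    by (intro measurable_restrict)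
  then have m: "(\<lambda>x. x) \<in> Q_borel \<rightarrow>\<^sub>M PiM UNIV (\<lambda>_. borel)"
    by (simp add: restrict_def)
  show "sets (restrict_space (PiM UNIV (\<lambda>_. borel)) Q_space) \<subseteq> sets Q_borel"
    using measurable_sets[OF m] by (auto simp: sets_restrict_space Int_commute)
qed

lemma measurable_coordinate [measurable]: "(\<lambda>x. x n) \<in> borel_measurable Q_borel"
proof -
  have "(\<lambda>x. x n) \<in> borel_measurable (restrict_space (PiM UNIV (\<lambda>_. borel)) Q_space)"
    by (intro measurable_restrict_space1) measurable
  then show ?thesis
    using measurable_cong_sets[OF sets_Q_borel refl] by blast
qed

lemma measurable_into_Q_borel:
  assumes "\<And>n. (\<lambda>w. f w n) \<in> borel_measurable N" "\<And>w. w \<in> space N \<Longrightarrow> f w \<in> Q_space"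
  shows "f \<in> N \<rightarrow>\<^sub>M Q_borel"
proof -
  have "(\<lambda>w. \<lambda>n\<in>UNIV. f w n) \<in> N \<rightarrow>\<^sub>M PiM UNIV (\<lambda>_. borel)"
    by (intro measurable_restrict assms)
  then have "f \<in> N \<rightarrow>\<^sub>M PiM UNIV (\<lambda>_. borel)" by (simp add: restrict_def)
  then have "f \<in> N \<rightarrow>\<^sub>M restrict_space (PiM UNIV (\<lambda>_. borel)) Q_space"
    using assms(2) by (intro measurable_restrict_space2) auto
  then show ?thesis
    using measurable_cong_sets[OF refl sets_Q_borel] by blast
qed

lemma eventually_top_in_Q_space:
  assumes "mono x" "\<And>n. n \<ge> N \<Longrightarrow> x n = \<infinity>"
  shows "x \<in> Q_space"
proof -
  have "x \<longlonglongrightarrow> \<infinity>"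
    by (rule tendsto_eventually) (use assms(2) in \<open>auto simp: eventually_sequentially\<close>)
  then show ?thesis using assms by (simp add: Q_space_def)
qed

text \<open>The entries replaced by infinity form a final segment: the exempt entry 0 is the
  smallest one.\<close>

lemma trunc_in_Q_space:
  assumes "x \<in> Q_space"
  shows "trunc a x \<in> Q_space"
proof -
  have m: "mono x" and lim: "x \<longlonglongrightarrow> \<infinity>" using assms by (auto simp: Q_space_def)
  have le: "x n \<le> trunc a x n" for n by (simp add: trunc_def)
  have "trunc a x \<longlonglongrightarrow> \<infinity>"
  proof (rule tendsto_sandwich[OF _ _ lim tendsto_const])
    show "\<forall>\<^sub>F n in sequentially. x n \<le> trunc a x n" using le by simp
    show "\<forall>\<^sub>F n in sequentially. trunc a x n \<le> \<infinity>" by simp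
  qed
  moreover have "mono (trunc a x)"
  proof (rule monoI)
    fix i j :: nat assume ij: "i \<le> j"
    then have "x i \<le> x j" "x 0 \<le> x i" using m by (auto simp: mono_def)
    then show "trunc a x i \<le> trunc a x j"
      using ij by (auto simp: trunc_def)
  qed
  ultimately show ?thesis by (simp add: Q_space_def)
qed

lemma measurable_trunc [measurable]: "trunc a \<in> Q_borel \<rightarrow>\<^sub>M Q_borel"
proof (rule measurable_into_Q_borel)
  show "(\<lambda>w. trunc a w n) \<in> borel_measurable Q_borel" for n
    unfolding trunc_def by measurable
qed (simp add: trunc_in_Q_space)

lemma sets_Q_star [measurable]: "Q_star \<in> sets Q_borel"
proof -
  have "{x \<in> space Q_borel. x 1 < \<infinity>} \<in> sets Q_borel" by measurable
  then show ?thesis by (simp add: Q_star_def)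
qed

lemma sets_Q_space [measurable]: "Q_space \<in> sets Q_borel"
  using sets.top[of Q_borel] by simp

lemma Q_zero_in_Q_space: "Q_zero \<in> Q_space"
  by (rule eventually_top_in_Q_space[of _ 1]) (auto simp: Q_zero_def mono_def)

lemma sets_Q_zero [measurable]: "{Q_zero} \<in> sets Q_borel"
proof -
  have eq: "{Q_zero} = {x \<in> space Q_borel. \<forall>n. x n = Q_zero n}"
    using Q_zero_in_Q_space by auto
  show ?thesis unfolding eq by measurable
qed

section \<open>The measures of the example\<close>

text \<open>\<open>nu_tilde\<close> and \<open>mu_tilde\<close> are image measures under
  \<open>motion_mark\<close> and \<open>birth_mark\<close>. A motion mark displaces the particle and
  creates no child; a birth mark leaves the particle in place and creates one child at distance
  \<open>z\<close>.\<close>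

definition motion_mark :: "real \<Rightarrow> qseq" where
  "motion_mark z = (\<lambda>n. if n = 0 then ennreal z else \<infinity>)"

definition birth_mark :: "real \<Rightarrow> qseq" where
  "birth_mark z = (\<lambda>n. if n = 0 then 0 else if n = 1 then ennreal z else \<infinity>)"

lemma motion_mark_in_Q_space: "motion_mark z \<in> Q_space"
  by (rule eventually_top_in_Q_space[of _ 1]) (auto simp: motion_mark_def mono_def)

lemma birth_mark_in_Q_space: "birth_mark z \<in> Q_space"
  by (rule eventually_top_in_Q_space[of _ 2]) (auto simp: birth_mark_def mono_def)

lemma measurable_motion_mark [measurable]: "motion_mark \<in> borel \<rightarrow>\<^sub>M Q_borel"
proof (rule measurable_into_Q_borel)
  show "(\<lambda>w. motion_mark w n) \<in> borel_measurable borel" for n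
    unfolding motion_mark_def by measurable
qed (rule motion_mark_in_Q_space)

lemma measurable_birth_mark [measurable]: "birth_mark \<in> borel \<rightarrow>\<^sub>M Q_borel"
proof (rule measurable_into_Q_borel)
  show "(\<lambda>w. birth_mark w n) \<in> borel_measurable borel" for n
    unfolding birth_mark_def by measurable
qed (rule birth_mark_in_Q_space)

lemma motion_mark_notin_Q_star: "motion_mark z \<notin> Q_star"
  by (simp add: Q_star_def motion_mark_def)

lemma birth_mark_in_Q_star: "birth_mark z \<in> Q_star"
  by (simp add: Q_star_def birth_mark_def birth_mark_in_Q_space[unfolded birth_mark_def])

lemma motion_mark_eq_Q_zero: "motion_mark z = Q_zero \<longleftrightarrow> z \<le> 0"
  by (auto simp: motion_mark_def Q_zero_def fun_eq_iff ennreal_eq_0_iff)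

lemma birth_mark_neq_Q_zero: "birth_mark z \<noteq> Q_zero"
proof
  assume "birth_mark z = Q_zero"
  then have "birth_mark z 1 = Q_zero 1" by simp
  then show False by (simp add: birth_mark_def Q_zero_def)
qed

lemma trunc_motion_mark: "trunc a (motion_mark z) = motion_mark z"
  by (auto simp: trunc_def motion_mark_def)

lemma trunc_birth_mark:
  "0 < a \<Longrightarrow> trunc a (birth_mark z) = (if z < a then birth_mark z else Q_zero)"
  by (auto simp: trunc_def birth_mark_def Q_zero_def fun_eq_iff ennreal_less_iff ennreal_lessI not_less
      dest: ennreal_leI)

lemma sets_nu [simp, measurable_cong]: "sets (nu \<alpha>) = sets borel"
  by (simp add: nu_def)

lemma sets_mu [simp, measurable_cong]: "sets (mu \<theta>) = sets borel"
  by (simp add: mu_def)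

lemma space_nu [simp]: "space (nu \<alpha>) = UNIV"
  by (simp add: nu_def)

lemma space_mu [simp]: "space (mu \<theta>) = UNIV"
  by (simp add: mu_def)

lemma space_Lambda_mb [simp]: "space (Lambda_mb \<alpha> \<theta>) = Q_space"
  unfolding Lambda_mb_def using sets.space_closed[of Q_borel]
  by (simp add: space_measure_of_conv)

lemma sets_Lambda_mb [simp, measurable_cong]: "sets (Lambda_mb \<alpha> \<theta>) = sets Q_borel"
  unfolding Lambda_mb_def using sets.space_closed[of Q_borel] sets.sigma_sets_eq[of Q_borel]
  by simp

lemma emeasure_Lambda_mb:
  assumes [measurable]: "A \<in> sets Q_borel"
  shows "emeasure (Lambda_mb \<alpha> \<theta>) A =
    emeasure (nu \<alpha>) (motion_mark -` A) + emeasure (mu \<theta>) (birth_mark -` A)"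
proof -
  have "emeasure (Lambda_mb \<alpha> \<theta>) A = emeasure (nu_tilde \<alpha>) A + emeasure (mu_tilde \<theta>) A"
  proof (rule emeasure_measure_of[OF Lambda_mb_def])
    show "sets Q_borel \<subseteq> Pow Q_space" using sets.space_closed[of Q_borel] by simp
    show "positive (sets (Lambda_mb \<alpha> \<theta>)) (\<lambda>A. emeasure (nu_tilde \<alpha>) A + emeasure (mu_tilde \<theta>) A)"
      by (simp add: positive_def)
    show "countably_additive (sets (Lambda_mb \<alpha> \<theta>))
        (\<lambda>A. emeasure (nu_tilde \<alpha>) A + emeasure (mu_tilde \<theta>) A)"
      unfolding countably_additive_def
    proof safe
      fix F :: "nat \<Rightarrow> qseq set"
      assume "range F \<subseteq> sets (Lambda_mb \<alpha> \<theta>)" and d: "disjoint_family F"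
      then have F: "range F \<subseteq> sets (nu_tilde \<alpha>)" "range F \<subseteq> sets (mu_tilde \<theta>)"
        by (auto simp: nu_tilde_def mu_tilde_def)
      show "(\<Sum>i. emeasure (nu_tilde \<alpha>) (F i) + emeasure (mu_tilde \<theta>) (F i)) =
        emeasure (nu_tilde \<alpha>) (\<Union> (range F)) + emeasure (mu_tilde \<theta>) (\<Union> (range F))"
        using suminf_emeasure[OF F(1) d] suminf_emeasure[OF F(2) d]
        by (simp add: suminf_add[OF summableI summableI, symmetric])
    qed
    show "A \<in> sets (Lambda_mb \<alpha> \<theta>)" using assms by simp
  qed
  also have "nu_tilde \<alpha> = distr (nu \<alpha>) Q_borel motion_mark"
    by (simp add: nu_tilde_def motion_mark_def[abs_def])
  also have "mu_tilde \<theta> = distr (mu \<theta>) Q_borel birth_mark"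
    by (simp add: mu_tilde_def birth_mark_def[abs_def])
  also have "emeasure (distr (nu \<alpha>) Q_borel motion_mark) A = emeasure (nu \<alpha>) (motion_mark -` A)"
    by (subst emeasure_distr) auto
  also have "emeasure (distr (mu \<theta>) Q_borel birth_mark) A = emeasure (mu \<theta>) (birth_mark -` A)"
    by (subst emeasure_distr) auto
  finally show ?thesis .
qed

lemma sets_trunc_measure [simp, measurable_cong]: "sets (trunc_measure a \<Lambda>) = sets Q_borel"
  by (simp add: trunc_measure_def)

lemma space_trunc_measure [simp]: "space (trunc_measure a \<Lambda>) = Q_space"
  by (simp add: trunc_measure_def)

lemma AE_nu_pos: "AE z in nu \<alpha>. 0 < z"
  unfolding nu_def by (subst AE_density) (auto intro!: AE_I2 simp: indicator_def split: if_splits)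

lemma AE_mu_nonneg: "AE z in mu \<theta>. 0 \<le> z"
  unfolding mu_def by (subst AE_density) (auto intro!: AE_I2 simp: indicator_def split: if_splits)

text \<open>The only finite entry of a motion mark is exempt from truncation, whereas a birth mark
  at distance at least \<open>a\<close> becomes \<open>Q_zero\<close> and is removed by the density.
  So truncation leaves \<open>nu \<alpha>\<close> intact and restricts \<open>mu \<theta>\<close> to
  distances below \<open>a\<close>.\<close>

lemma emeasure_trunc_Lambda_mb:
  assumes a: "0 < a" and A[measurable]: "A \<in> sets Q_borel"
  shows "emeasure (trunc_measure a (Lambda_mb \<alpha> \<theta>)) A =
    emeasure (nu \<alpha>) (motion_mark -` A) + emeasure (mu \<theta>) {z. z < a \<and> birth_mark z \<in> A}"
proof -
  let ?\<Lambda> = "Lambda_mb \<alpha> \<theta>"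
  let ?B = "A - {Q_zero}"
  have [measurable]: "trunc a \<in> ?\<Lambda> \<rightarrow>\<^sub>M Q_borel"
    by (simp add: measurable_cong_sets[OF sets_Lambda_mb refl])
  have "emeasure (trunc_measure a ?\<Lambda>) A =
      (\<integral>\<^sup>+ x. indicator (Q_space - {Q_zero}) x * indicator A x \<partial>distr ?\<Lambda> Q_borel (trunc a))"
    unfolding trunc_measure_def by (subst emeasure_density) auto
  also have "\<dots> = (\<integral>\<^sup>+ x. indicator ?B x \<partial>distr ?\<Lambda> Q_borel (trunc a))"
    by (intro nn_integral_cong) (auto simp: indicator_def)
  also have "\<dots> = emeasure (distr ?\<Lambda> Q_borel (trunc a)) ?B"
    by simp
  also have "\<dots> = emeasure ?\<Lambda> (trunc a -` ?B \<inter> Q_space)"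
    by (subst emeasure_distr) auto
  also have "\<dots> = emeasure (nu \<alpha>) (motion_mark -` (trunc a -` ?B \<inter> Q_space))
      + emeasure (mu \<theta>) (birth_mark -` (trunc a -` ?B \<inter> Q_space))"
  proof (rule emeasure_Lambda_mb)
    have "trunc a -` ?B \<inter> space Q_borel \<in> sets Q_borel" by measurable
    then show "trunc a -` ?B \<inter> Q_space \<in> sets Q_borel" by simp
  qed
  \<comment> \<open>The two sets may differ at \<open>z \<le> 0\<close>, where
    \<open>motion_mark z\<close> is \<open>Q_zero\<close>; \<open>nu \<alpha>\<close> does not
    charge these \<open>z\<close>.\<close>
  also have "emeasure (nu \<alpha>) (motion_mark -` (trunc a -` ?B \<inter> Q_space))
      = emeasure (nu \<alpha>) (motion_mark -` A)"
  proof (rule emeasure_eq_AE)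
    show "AE z in nu \<alpha>. (z \<in> motion_mark -` (trunc a -` ?B \<inter> Q_space)) = (z \<in> motion_mark -` A)"
      using AE_nu_pos
      by eventually_elim (auto simp: trunc_motion_mark motion_mark_in_Q_space motion_mark_eq_Q_zero)
    have "motion_mark -` A \<inter> space borel \<in> sets borel" by measurable
    then show "motion_mark -` A \<in> sets (nu \<alpha>)" by simp
    have "motion_mark -` (trunc a -` ?B \<inter> Q_space) = motion_mark -` ?B \<inter> space borel"
      by (simp add: set_eq_iff trunc_motion_mark motion_mark_in_Q_space)
    also have "\<dots> \<in> sets borel" by measurable
    finally show "motion_mark -` (trunc a -` ?B \<inter> Q_space) \<in> sets (nu \<alpha>)" by simp
  qed
  also have "birth_mark -` (trunc a -` ?B \<inter> Q_space) = {z. z < a \<and> birth_mark z \<in> A}"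
    using a by (auto simp: trunc_birth_mark birth_mark_in_Q_space birth_mark_neq_Q_zero split: if_splits)
  finally show ?thesis .
qed

definition birth_measure :: "real \<Rightarrow> real \<Rightarrow> real \<Rightarrow> qseq measure" where
  "birth_measure \<alpha> \<theta> a = density (trunc_measure a (Lambda_mb \<alpha> \<theta>)) (indicator Q_star)"

lemma sets_birth_measure [simp, measurable_cong]: "sets (birth_measure \<alpha> \<theta> a) = sets Q_borel"
  by (simp add: birth_measure_def)

lemma emeasure_birth_measure:
  assumes a: "0 < a" and A[measurable]: "A \<in> sets Q_borel"
  shows "emeasure (birth_measure \<alpha> \<theta> a) A = emeasure (mu \<theta>) {z. z < a \<and> birth_mark z \<in> A}"
proof -
  have "emeasure (birth_measure \<alpha> \<theta> a) A = emeasure (trunc_measure a (Lambda_mb \<alpha> \<theta>)) (Q_star \<inter> A)"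
    unfolding birth_measure_def
    by (subst emeasure_density) (auto simp: indicator_inter_arith[symmetric])
  also have "\<dots> = emeasure (nu \<alpha>) (motion_mark -` (Q_star \<inter> A))
      + emeasure (mu \<theta>) {z. z < a \<and> birth_mark z \<in> Q_star \<inter> A}"
    by (rule emeasure_trunc_Lambda_mb[OF a]) simp
  also have "motion_mark -` (Q_star \<inter> A) = {}"
    using motion_mark_notin_Q_star by auto
  finally show ?thesis by (simp add: birth_mark_in_Q_star)
qed

text \<open>Motion marks lie outside \<open>Q_star\<close> and birth marks inside, so the Levy
  measure does not depend on \<open>a\<close> and the motions have the same law at all
  levels.\<close>

lemma levy_measure_Lambda_mb:
  assumes a: "0 < a"
  shows "distr (density (trunc_measure a (Lambda_mb \<alpha> \<theta>)) (indicator (Q_space - Q_star))) borel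
    (\<lambda>x. enn2real (x 0)) = nu \<alpha>" (is "distr ?D borel ?f = _")
proof (rule measure_eqI)
  fix A assume "A \<in> sets (distr ?D borel ?f)"
  then have A[measurable]: "A \<in> sets borel" by simp
  let ?B = "{x \<in> Q_space. x \<notin> Q_star \<and> enn2real (x 0) \<in> A}"
  have "{x \<in> space Q_borel. x \<notin> Q_star \<and> enn2real (x 0) \<in> A} \<in> sets Q_borel"
    by measurable
  then have B[measurable]: "?B \<in> sets Q_borel" by simp
  have "emeasure (distr ?D borel ?f) A = emeasure ?D (?f -` A \<inter> space Q_borel)"
    by (subst emeasure_distr) auto
  also have "\<dots> = (\<integral>\<^sup>+ x. indicator (Q_space - Q_star) x * indicator (?f -` A \<inter> space Q_borel) x
      \<partial>trunc_measure a (Lambda_mb \<alpha> \<theta>))"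
    by (subst emeasure_density) auto
  also have "\<dots> = (\<integral>\<^sup>+ x. indicator ?B x \<partial>trunc_measure a (Lambda_mb \<alpha> \<theta>))"
    by (intro nn_integral_cong) (auto simp: indicator_def)
  also have "\<dots> = emeasure (trunc_measure a (Lambda_mb \<alpha> \<theta>)) ?B"
    by simp
  also have "\<dots> = emeasure (nu \<alpha>) (motion_mark -` ?B) + emeasure (mu \<theta>) {z. z < a \<and> birth_mark z \<in> ?B}"
    by (rule emeasure_trunc_Lambda_mb[OF a B])
  also have "{z. z < a \<and> birth_mark z \<in> ?B} = {}"
    using birth_mark_in_Q_star by auto
  also have "motion_mark -` ?B = {z. max 0 z \<in> A}"
  proof -
    have "enn2real (motion_mark z 0) = max 0 z" for z
      by (cases "0 \<le> z") (auto simp: motion_mark_def ennreal_neg)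
    then show ?thesis
      using motion_mark_in_Q_space motion_mark_notin_Q_star by auto
  qed
  also have "emeasure (nu \<alpha>) {z. max 0 z \<in> A} = emeasure (nu \<alpha>) A"
  proof (rule emeasure_eq_AE)
    show "AE z in nu \<alpha>. (z \<in> {z. max 0 z \<in> A}) = (z \<in> A)"
      using AE_nu_pos by eventually_elim simp
    have "{z \<in> space borel. max 0 z \<in> A} \<in> sets (borel :: real measure)" by measurable
    then show "{z. max 0 z \<in> A} \<in> sets (nu \<alpha>)" by simp
  qed simp
  finally show "emeasure (distr ?D borel ?f) A = emeasure (nu \<alpha>) A" by simp
qed simp

section \<open>Mass of the births at given distances\<close>

lemma emeasure_mu:
  "A \<in> sets borel \<Longrightarrow>
    emeasure (mu \<theta>) A = (\<integral>\<^sup>+z. ennreal (exp (z powr \<theta>)) * indicator ({0..} \<inter> A) z \<partial>lborel)"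
  unfolding mu_def
  by (subst emeasure_density) (auto intro!: nn_integral_cong simp: indicator_def)

text \<open>The last unit interval below \<open>a\<close> alone carries this mass.\<close>

lemma emeasure_mu_lessThan_ge:
  assumes "1 \<le> a" "0 \<le> \<theta>"
  shows "ennreal (exp ((a - 1) powr \<theta>)) \<le> emeasure (mu \<theta>) {z. z < a}"
proof -
  have "ennreal (exp ((a - 1) powr \<theta>))
      = (\<integral>\<^sup>+z. ennreal (exp ((a - 1) powr \<theta>)) * indicator {a - 1<..<a} z \<partial>lborel)"
    by (simp add: nn_integral_cmult)
  also have "\<dots> \<le> (\<integral>\<^sup>+z. ennreal (exp (z powr \<theta>)) * indicator ({0..} \<inter> {z. z < a}) z \<partial>lborel)"
    using assms by (intro nn_integral_mono) (auto simp: indicator_def intro!: ennreal_leI powr_mono2)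
  also have "\<dots> = emeasure (mu \<theta>) {z. z < a}"
    by (simp add: emeasure_mu)
  finally show ?thesis .
qed

lemma emeasure_mu_le:
  assumes "A \<in> sets borel" "A \<subseteq> {b..c}" "b \<le> c" "\<And>z. z \<in> A \<Longrightarrow> 0 \<le> z \<Longrightarrow> z powr \<theta> \<le> k"
  shows "emeasure (mu \<theta>) A \<le> ennreal (exp k * (c - b))"
proof -
  have "emeasure (mu \<theta>) A \<le> (\<integral>\<^sup>+z. ennreal (exp k) * indicator {b..c} z \<partial>lborel)"
    unfolding emeasure_mu[OF assms(1)] using assms(2,4)
    by (intro nn_integral_mono) (auto simp: indicator_def intro!: ennreal_leI)
  also have "\<dots> = ennreal (exp k * (c - b))"
    using assms(3) by (simp add: nn_integral_cmult ennreal_mult)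
  finally show ?thesis .
qed

lemma emeasure_mu_lessThan_finite:
  assumes "0 \<le> a" "0 \<le> \<theta>"
  shows "emeasure (mu \<theta>) {z. z < a} < \<infinity>"
proof -
  have "emeasure (mu \<theta>) {z. z < a} = emeasure (mu \<theta>) {z. 0 \<le> z \<and> z < a}"
    using AE_mu_nonneg[of \<theta>] by (intro emeasure_eq_AE) auto
  also have "\<dots> \<le> ennreal (exp (a powr \<theta>) * (a - 0))"
    using assms by (intro emeasure_mu_le) (auto intro!: powr_mono2)
  finally show ?thesis by (rule le_less_trans) simp
qed

lemma finite_birth_measure:
  assumes "0 < a" "0 \<le> \<theta>"
  shows "finite_measure (birth_measure \<alpha> \<theta> a)"
proof
  have "emeasure (birth_measure \<alpha> \<theta> a) Q_space = emeasure (mu \<theta>) {z. z < a}"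
    using assms emeasure_birth_measure[of a Q_space] by (simp add: birth_mark_in_Q_space)
  then show "emeasure (birth_measure \<alpha> \<theta> a) (space (birth_measure \<alpha> \<theta> a)) \<noteq> \<infinity>"
    using emeasure_mu_lessThan_finite[of a \<theta>] assms by (simp add: birth_measure_def)
qed

definition intensity :: "real \<Rightarrow> real \<Rightarrow> real \<Rightarrow> (real \<times> qseq) measure" where
  "intensity \<alpha> \<theta> a = density lborel (indicator {0..}) \<Otimes>\<^sub>M birth_measure \<alpha> \<theta> a"

lemma sets_intensity [simp, measurable_cong]: "sets (intensity \<alpha> \<theta> a) = sets (borel \<Otimes>\<^sub>M Q_borel)"
  unfolding intensity_def by (intro sets_pair_measure_cong) simp_all

lemma emeasure_intensity_Times:
  assumes "0 < a" "0 \<le> \<theta>" "I \<in> sets borel" "A \<in> sets Q_borel"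
  shows "emeasure (intensity \<alpha> \<theta> a) (I \<times> A) =
    emeasure lborel ({0..} \<inter> I) * emeasure (mu \<theta>) {z. z < a \<and> birth_mark z \<in> A}"
proof -
  interpret finite_measure "birth_measure \<alpha> \<theta> a" by (rule finite_birth_measure) fact+
  have "emeasure (density lborel (indicator {0..})) I = emeasure lborel ({0..} \<inter> I)"
    using assms(3) by (subst emeasure_density) (auto simp: indicator_inter_arith[symmetric])
  then show ?thesis
    unfolding intensity_def using assms
    by (subst emeasure_pair_measure_Times) (auto simp: emeasure_birth_measure)
qed

section \<open>The Laplace exponent of the motions\<close>

definition laplace_exponent :: "real \<Rightarrow> real \<Rightarrow> real" where
  "laplace_exponent \<alpha> q = (\<integral>z. 1 - exp (- q * z) \<partial>nu \<alpha>)"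

lemma laplace_exponent_eq_enn2real:
  assumes "0 \<le> q"
  shows "laplace_exponent \<alpha> q = enn2real (\<integral>\<^sup>+z. ennreal (1 - exp (- q * z)) \<partial>nu \<alpha>)"
  unfolding laplace_exponent_def
proof (rule integral_eq_nn_integral)
  show "AE z in nu \<alpha>. 0 \<le> 1 - exp (- q * z)"
    using AE_nu_pos by eventually_elim (use assms in auto)
qed simp

text \<open>Substitute \<open>z / q\<close> for \<open>z\<close>: the density is homogeneous of
  degree \<open>- (\<alpha> + 1)\<close>, and the Jacobian takes back one power of \<open>q\<close>.
  With nonnegative integrals no finiteness has to be known at this stage.\<close>

lemma nn_laplace_exponent_scaling:
  assumes "0 < \<alpha>" "\<alpha> < 1" "0 < q"
  shows "(\<integral>\<^sup>+z. ennreal (1 - exp (- q * z)) \<partial>nu \<alpha>) =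
    ennreal (q powr \<alpha>) * (\<integral>\<^sup>+z. ennreal (1 - exp (- 1 * z)) \<partial>nu \<alpha>)"
proof -
  define C where "C = \<alpha> / Gamma (1 - \<alpha>)"
  have C: "0 \<le> C" using assms Gamma_real_pos[of "1 - \<alpha>"] by (simp add: C_def)
  define F where "F q z = ennreal (C * (1 / z powr (\<alpha> + 1))) * indicator {0<..} z *
    ennreal (1 - exp (- q * z))" for q z
  have F: "(\<integral>\<^sup>+z. ennreal (1 - exp (- q * z)) \<partial>nu \<alpha>) = (\<integral>\<^sup>+z. F q z \<partial>lborel)" for q
    unfolding nu_def F_def C_def by (subst nn_integral_density) auto
  have [measurable]: "F q \<in> borel_measurable borel" for q
    unfolding F_def by measurable
  have "(\<integral>\<^sup>+z. F q z \<partial>lborel) = ennreal \<bar>1 / q\<bar> * (\<integral>\<^sup>+z. F q (0 + (1 / q) * z) \<partial>lborel)"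
    using assms by (intro nn_integral_real_affine) auto
  also have "(\<integral>\<^sup>+z. F q (0 + (1 / q) * z) \<partial>lborel) = (\<integral>\<^sup>+z. ennreal (q powr (\<alpha> + 1)) * F 1 z \<partial>lborel)"
  proof (intro nn_integral_cong)
    fix z :: real
    show "F q (0 + (1 / q) * z) = ennreal (q powr (\<alpha> + 1)) * F 1 z"
    proof (cases "0 < z")
      case True
      have "C * (1 / (z / q) powr (\<alpha> + 1)) = q powr (\<alpha> + 1) * (C * (1 / z powr (\<alpha> + 1)))"
        using True assms by (simp add: powr_divide)
      then have "ennreal (C * (1 / (z / q) powr (\<alpha> + 1)))
          = ennreal (q powr (\<alpha> + 1)) * ennreal (C * (1 / z powr (\<alpha> + 1)))"
        by (simp add: ennreal_mult[symmetric] C)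
      then show ?thesis
        using True assms by (simp add: F_def mult.assoc)
    qed (use assms in \<open>auto simp: F_def zero_less_divide_iff\<close>)
  qed
  also have "\<dots> = ennreal (q powr (\<alpha> + 1)) * (\<integral>\<^sup>+z. F 1 z \<partial>lborel)"
    by (rule nn_integral_cmult) measurable
  also have "ennreal \<bar>1 / q\<bar> * (ennreal (q powr (\<alpha> + 1)) * (\<integral>\<^sup>+z. F 1 z \<partial>lborel))
      = ennreal (q powr \<alpha>) * (\<integral>\<^sup>+z. F 1 z \<partial>lborel)"
  proof -
    have "ennreal \<bar>1 / q\<bar> * ennreal (q powr (\<alpha> + 1)) = ennreal (q powr \<alpha>)"
      using assms by (simp add: ennreal_mult[symmetric] powr_add)
    then show ?thesis by (simp add: mult.assoc[symmetric])
  qed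
  finally show ?thesis unfolding F .
qed

lemma laplace_exponent_scaling:
  assumes "0 < \<alpha>" "\<alpha> < 1" "0 < q"
  shows "laplace_exponent \<alpha> q = laplace_exponent \<alpha> 1 * q powr \<alpha>"
  using assms nn_laplace_exponent_scaling[OF assms]
  by (simp add: laplace_exponent_eq_enn2real enn2real_mult)

text \<open>An infinite integral would be turned into 0 by \<open>enn2real\<close>, so finiteness
  comes first; it follows from \<open>1 - exp (- z) \<le> min 1 z\<close> and the integrability
  condition on characteristic couples. Positivity holds because \<open>nu \<alpha>\<close> has a
  positive density on the unit interval.\<close>

lemma laplace_exponent_pos:
  assumes "0 < \<alpha>" "\<alpha> < 1"
    and fin: "(\<integral>\<^sup>+x. min 1 (x 0) \<partial>Lambda_mb \<alpha> \<theta>) < \<infinity>"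
  shows "0 < laplace_exponent \<alpha> 1"
proof -
  let ?I = "\<integral>\<^sup>+z. ennreal (1 - exp (- 1 * z)) \<partial>nu \<alpha>"
  have "?I \<le> (\<integral>\<^sup>+z. min 1 (motion_mark z 0) \<partial>nu \<alpha>)"
  proof (intro nn_integral_mono)
    fix z :: real
    have "1 - exp (- 1 * z) \<le> z" using exp_ge_add_one_self[of "-z"] by simp
    then show "ennreal (1 - exp (- 1 * z)) \<le> min 1 (motion_mark z 0)"
      by (auto simp: motion_mark_def ennreal_leI)
  qed
  also have "\<dots> = (\<integral>\<^sup>+x. min 1 (x 0) \<partial>distr (nu \<alpha>) Q_borel motion_mark)"
    by (subst nn_integral_distr) auto
  also have "\<dots> \<le> (\<integral>\<^sup>+x. min 1 (x 0) \<partial>Lambda_mb \<alpha> \<theta>)"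
    by (intro nn_integral_mono_measure)
       (auto simp: le_measure emeasure_Lambda_mb emeasure_distr)
  finally have fin': "?I < top" using fin by simp
  have "?I \<noteq> 0"
  proof
    assume "?I = 0"
    then have "AE z in nu \<alpha>. ennreal (1 - exp (- 1 * z)) = 0"
      by (subst (asm) nn_integral_0_iff_AE) auto
    then have "AE z in nu \<alpha>. False"
      using AE_nu_pos by eventually_elim (simp add: ennreal_eq_0_iff)
    then have "AE z in lborel. z \<notin> {0<..<1::real}"
      unfolding nu_def
      using assms Gamma_real_pos[of "1 - \<alpha>"] not_le[of "Gamma (1 - \<alpha>)" 0]
      by (subst (asm) AE_density) (auto simp: indicator_def ennreal_eq_0_iff divide_le_0_iff
          mult_le_0_iff elim!: eventually_mono)
    then have "emeasure lborel {0<..<1::real} = 0"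
      by (subst (asm) AE_iff_measurable[OF _ refl]) (auto simp: greaterThanLessThan_def Int_def)
    then show False by simp
  qed
  then show ?thesis
    using fin' by (simp add: laplace_exponent_eq_enn2real enn2real_positive_iff zero_less_iff_neq_zero)
qed

section \<open>Paths of the particle system\<close>

text \<open>The almost sure properties from which all statements about paths follow
  deterministically. A point that is present has positive age, does not move its parent and creates
  at most one child, so birth times increase strictly along ancestral lines.\<close>

definition good_noise :: "noise \<Rightarrow> bool" where
  "good_noise z \<longleftrightarrow> (\<forall>u. motion z u 0 = 0 \<and> mono_on {0..} (motion z u) \<and>
     (\<forall>j. age z u j < \<infinity> \<longrightarrow> 0 < age z u j \<and> mark z u j 0 = 0 \<and> (\<forall>i\<ge>2. mark z u j i = \<infinity>)))"

lemma good_noiseD: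
  assumes "good_noise z"
  shows "motion z u 0 = 0"
    and "\<And>s t. 0 \<le> s \<Longrightarrow> s \<le> t \<Longrightarrow> motion z u s \<le> motion z u t"
    and "\<And>t. 0 \<le> t \<Longrightarrow> 0 \<le> motion z u t"
    and "age z u j < \<infinity> \<Longrightarrow> 0 < age z u j"
    and "age z u j < \<infinity> \<Longrightarrow> mark z u j 0 = 0"
    and "age z u j < \<infinity> \<Longrightarrow> 2 \<le> i \<Longrightarrow> mark z u j i = \<infinity>"
proof -
  show *: "motion z u 0 = 0" "\<And>s t. 0 \<le> s \<Longrightarrow> s \<le> t \<Longrightarrow> motion z u s \<le> motion z u t"
    using assms by (auto simp: good_noise_def monotone_on_def)
  show "\<And>t. 0 \<le> t \<Longrightarrow> 0 \<le> motion z u t" using * by force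
qed (use assms in \<open>auto simp: good_noise_def\<close>)

lemma displacement_good_noise: "good_noise z \<Longrightarrow> displacement z u r = motion z u r"
  unfolding displacement_def
  by (subst sum.neutral) (auto dest!: good_noiseD(5) intro: le_less_trans)

text \<open>The position at birth. The left limit excludes a jump that the parent may make at the
  birth time.\<close>

primrec start :: "noise \<Rightarrow> particle \<Rightarrow> real" where
  "start z [] = 0"
| "start z (c # u) = Lim (at_left (enn2real (birth z (c # u)))) (position z u)
     + enn2real (mark z u (fst c) (snd c))"

lemma birth_Cons_finite:
  assumes "good_noise z" "birth z (c # u) < \<infinity>"
  shows "birth z u < \<infinity>" "age z u (fst c) < \<infinity>" "snd c = 1" "mark z u (fst c) 1 < \<infinity>"
    and "0 < enn2real (age z u (fst c))"
    and "enn2real (birth z (c # u)) = enn2real (birth z u) + enn2real (age z u (fst c))"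
proof -
  have *: "1 \<le> snd c" "mark z u (fst c) (snd c) < \<infinity>" "birth z u + age z u (fst c) < \<infinity>"
    using assms(2) by (auto split: if_splits)
  then show 1: "birth z u < \<infinity>" "age z u (fst c) < \<infinity>"
    by (auto simp: less_top)
  \<comment> \<open>Entries from index 2 on are infinite for every present point, so a child that is
    born carries index 1.\<close>
  have "\<not> 2 \<le> snd c"
    using good_noiseD(6)[OF assms(1) 1(2), of "snd c"] *(2) by auto
  with *(1) show "snd c = 1" by simp
  with * show "mark z u (fst c) 1 < \<infinity>" by simp
  show "0 < enn2real (age z u (fst c))"
    using good_noiseD(4)[OF assms(1) 1(2)] 1 by (simp add: enn2real_positive_iff)
  show "enn2real (birth z (c # u)) = enn2real (birth z u) + enn2real (age z u (fst c))"
    using * 1 by (auto simp: enn2real_plus)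
qed

lemma position_after_birth:
  assumes "good_noise z" "enn2real (birth z u) \<le> t"
  shows "position z u t = start z u + motion z u (t - enn2real (birth z u))"
  using assms by (cases u) (auto simp: Let_def displacement_good_noise)

lemma position_before_birth:
  "t < enn2real (birth z (c # u)) \<Longrightarrow> position z (c # u) t = position z u t"
  by (simp add: Let_def)

text \<open>\<open>Lim\<close> says nothing unless the limit exists. For the monotone paths at hand
  the left limits inside \<open>position\<close> are suprema, which yields the two comparisons
  below.\<close>

lemma Lim_at_left_mono_on:
  fixes f :: "real \<Rightarrow> real"
  assumes "mono_on {0..} f" "0 < b"
  shows "Lim (at_left b) f = Sup (f ` {0..<b})"
proof -
  have I: "{..<b} \<inter> {0..} = {0..<b}" by auto
  have "(f \<longlongrightarrow> Sup (f ` ({..<b} \<inter> {0..}))) (at b within {..<b} \<inter> {0..})"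
    by (rule Lim_left_bound[where K="f b"])
       (use assms in \<open>auto simp: monotone_on_def\<close>)
  moreover have "at b within {..<b} \<inter> {0..} = at_left b"
    by (rule at_within_nhd[of _ "{0<..}"]) (use assms in auto)
  ultimately show ?thesis
    unfolding I by (intro tendsto_Lim) auto
qed

lemma Lim_at_left_ge:
  fixes f :: "real \<Rightarrow> real"
  assumes "mono_on {0..} f" "0 \<le> s" "s < b"
  shows "f s \<le> Lim (at_left b) f"
proof -
  have "Lim (at_left b) f = Sup (f ` {0..<b})"
    using assms by (intro Lim_at_left_mono_on) auto
  moreover have "f s \<le> Sup (f ` {0..<b})"
    by (rule cSUP_upper) (use assms in \<open>auto simp: monotone_on_def intro!: bdd_aboveI2[of _ _ "f b"]\<close>)
  ultimately show ?thesis by simp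
qed

lemma Lim_at_left_le:
  fixes f :: "real \<Rightarrow> real"
  assumes "mono_on {0..} f" "0 < b"
  shows "Lim (at_left b) f \<le> f b"
  unfolding Lim_at_left_mono_on[OF assms]
  by (rule cSUP_least) (use assms in \<open>auto simp: monotone_on_def\<close>)

text \<open>Both properties go through one induction along the ancestral line: the left limit at the
  birth of a child can be compared with the path of the parent only if that path is known to be
  monotone, and the child starts at a nonnegative position because the parent is there.\<close>

lemma position_mono_nonneg:
  assumes good: "good_noise z" and "birth z u < \<infinity>"
  shows "mono_on {0..} (position z u) \<and> (\<forall>t\<ge>0. 0 \<le> position z u t)"
  using assms(2)
proof (induction u)
  case Nil
  have "position z [] = motion z []"
    by (auto simp: fun_eq_iff displacement_good_noise[OF good])
  then show ?case
    using good_noiseD(2)[OF good, of _ _ "[]"] good_noiseD(3)[OF good, of _ "[]"] by (auto simp: monotone_on_def)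
next
  case (Cons c u)
  note b = birth_Cons_finite[OF good Cons.prems]
  let ?b = "enn2real (birth z (c # u))"
  have IH: "mono_on {0..} (position z u)" "\<And>t. 0 \<le> t \<Longrightarrow> 0 \<le> position z u t"
    using Cons.IH b(1) by auto
  have b0: "0 < ?b"
    unfolding b(6) using b(5) by (intro add_nonneg_pos) auto
  have before: "position z (c # u) s = position z u s" if "s < ?b" for s
    using that by (rule position_before_birth)
  have after: "position z (c # u) t = start z (c # u) + motion z (c # u) (t - ?b)" if "?b \<le> t" for t
    using position_after_birth[OF good that] .
  have start: "position z u s \<le> start z (c # u)" if "0 \<le> s" "s < ?b" for s
    using Lim_at_left_ge[OF IH(1) that] unfolding start.simps by (simp add: add_increasing2)
  have "position z (c # u) s \<le> position z (c # u) t" if "0 \<le> s" "s \<le> t" for s t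
  proof (cases "t < ?b")
    case True
    have "position z (c # u) s = position z u s"
      by (rule before) (use True that in linarith)
    moreover have "position z u s \<le> position z u t"
      using IH(1) that by (auto simp: monotone_on_def)
    ultimately show ?thesis using before[OF True] by linarith
  next
    case False
    show ?thesis
    proof (cases "s < ?b")
      case True
      have "position z (c # u) s \<le> start z (c # u)" using start[OF that(1) True] before[OF True] by simp
      also have "\<dots> \<le> position z (c # u) t" using False after[of t] good_noiseD(3)[OF good] by simp
      finally show ?thesis .
    next
      case s: False
      then show ?thesis using False that after[of s] after[of t] good_noiseD(2)[OF good] by simp
    qed
  qed
  moreover have "0 \<le> position z (c # u) t" if "0 \<le> t" for t
  proof (cases "t < ?b")
    case True
    then show ?thesis using IH(2) that before by simp
  next
    case False
    then show ?thesis
      using after[of t] good_noiseD(3)[OF good, of "t - ?b" "c # u"] start[of 0] IH(2)[of 0] b0 by simp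
  qed
  ultimately show ?case by (auto simp: monotone_on_def)
qed

lemma position_mono:
  "good_noise z \<Longrightarrow> birth z u < \<infinity> \<Longrightarrow> 0 \<le> s \<Longrightarrow> s \<le> t \<Longrightarrow> position z u s \<le> position z u t"
  using position_mono_nonneg[of z u] by (auto simp: monotone_on_def)

lemma position_nonneg:
  "good_noise z \<Longrightarrow> birth z u < \<infinity> \<Longrightarrow> 0 \<le> t \<Longrightarrow> 0 \<le> position z u t"
  using position_mono_nonneg[of z u] by auto

lemma position_parent_le_start:
  assumes "good_noise z" "birth z (c # u) < \<infinity>" "0 \<le> s" "s < enn2real (birth z (c # u))"
  shows "position z u s + enn2real (mark z u (fst c) (snd c)) \<le> start z (c # u)"
proof -
  have "mono_on {0..} (position z u)"
    using position_mono_nonneg assms(1) birth_Cons_finite(1)[OF assms(1,2)] by blast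
  from Lim_at_left_ge[OF this assms(3,4)] show ?thesis unfolding start.simps by simp
qed

lemma less_enn2real: "\<not> B \<le> ennreal s \<Longrightarrow> B < \<infinity> \<Longrightarrow> 0 \<le> s \<Longrightarrow> s < enn2real B"
  by (cases B) (auto simp: ennreal_less_iff not_le)

text \<open>Before its birth the position of a particle is that of its parent, so labels not yet
  born at \<open>s\<close> can be stripped one by one. Together with monotonicity this carries a
  lower bound at time \<open>s\<close> to all later times.\<close>

lemma ancestor_at_time:
  assumes "birth z u < \<infinity>" "0 \<le> s"
  shows "\<exists>v\<in>particles z s. birth z v < \<infinity> \<and> position z v s = position z u s"
  using assms(1)
proof (induction u)
  case Nil
  then show ?case by (intro bexI[of _ "[]"]) (auto simp: particles_def)
next
  case (Cons c u)
  then have "birth z u < \<infinity>" by (auto simp: less_top split: if_splits)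
  then obtain v where v: "v \<in> particles z s" "birth z v < \<infinity>" "position z v s = position z u s"
    using Cons.IH by auto
  show ?case
  proof (cases "birth z (c # u) \<le> ennreal s")
    case True
    then show ?thesis using Cons.prems by (intro bexI[of _ "c # u"]) (auto simp: particles_def)
  next
    case False
    then have "s < enn2real (birth z (c # u))"
      using Cons.prems \<open>0 \<le> s\<close> by (rule less_enn2real)
    then show ?thesis using v position_before_birth by (metis (full_types))
  qed
qed

text \<open>Positions are nonnegative and non-decreasing, so the starting point dominates every
  birth distance on the ancestral line. Particles starting below \<open>N\<close> therefore survive
  truncation at \<open>N\<close>.\<close>

lemma kept_if_start_less:
  assumes good: "good_noise z" and "birth z u < \<infinity>" "start z u < N"
  shows "kept N z u"
  using assms(2,3)
proof (induction u)
  case (Cons c u)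
  note b = birth_Cons_finite[OF good Cons.prems(1)]
  have "position z u (enn2real (birth z u)) + enn2real (mark z u (fst c) (snd c)) \<le> start z (c # u)"
    using b(5,6) by (intro position_parent_le_start good Cons.prems) auto
  moreover have "position z u (enn2real (birth z u)) = start z u"
    using position_after_birth[OF good order_refl] good_noiseD(1)[OF good] by simp
  moreover have "0 \<le> position z u (enn2real (birth z u))"
    using position_nonneg[OF good b(1)] by simp
  ultimately have s: "start z u < N" "enn2real (mark z u (fst c) (snd c)) < N"
    using Cons.prems(2) enn2real_nonneg[of "mark z u (fst c) (snd c)"] by linarith+
  have "mark z u (fst c) (snd c) < ennreal N"
    using s(2) b(3,4) by (cases "mark z u (fst c) (snd c)") (auto simp: ennreal_less_iff)
  then show ?case using Cons.IH[OF b(1) s(1)] by simp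
qed simp

lemma kept_if_position_less:
  assumes good: "good_noise z" and "birth z u < \<infinity>" "enn2real (birth z u) \<le> t" "position z u t < N"
  shows "kept N z u"
proof (rule kept_if_start_less[OF good assms(2)])
  show "start z u < N"
    using position_after_birth[OF good assms(3)] good_noiseD(3)[OF good, of "t - enn2real (birth z u)" u]
      assms(3,4) by simp
qed

text \<open>Discretised version of \<open>exp (lam * s - q * (displacement before s) - q * (distance))\<close> for the birth of
  a child at age \<open>s\<close>: ages are cut into cells of length \<open>\<delta>\<close> and distances into cells of length \<open>1 / q\<close>,
  so that expectations only involve the numbers of points in rectangles and the motion at grid times.
  The cells of ages are open on the left, hence the motion just before \<open>s\<close> is at least its value at
  the left end point.\<close>

definition edge_weight ::
    "real \<Rightarrow> real \<Rightarrow> real \<Rightarrow> nat \<times> nat \<Rightarrow> (real \<Rightarrow> real) \<times> (nat \<Rightarrow> ennreal \<times> qseq) \<Rightarrow> ennreal" where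
  "edge_weight q lam \<delta> c w = (if snd c = 1 then
     (\<Sum>k. \<Sum>l. if fst (snd w (fst c)) \<in> {ennreal (real k * \<delta>)<..ennreal ((real k + 1) * \<delta>)} \<and>
        snd (snd w (fst c)) 1 \<in> {ennreal (real l / q)..<ennreal ((real l + 1) / q)}
      then ennreal (exp (lam * ((real k + 1) * \<delta>) - real l - q * fst w (real k * \<delta>))) else 0) else 0)"

text \<open>The contribution of the last particle after its birth. Summing over all grid cells
  bounds \<open>exp (lam * r - q * motion r)\<close> for every age \<open>r\<close> at once, so the
  weight does not depend on the time of observation.\<close>

definition end_weight ::
    "real \<Rightarrow> real \<Rightarrow> real \<Rightarrow> (real \<Rightarrow> real) \<times> (nat \<Rightarrow> ennreal \<times> qseq) \<Rightarrow> ennreal" where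
  "end_weight q lam \<delta> w = (\<Sum>k. ennreal (exp (lam * ((real k + 1) * \<delta>) - q * fst w (real k * \<delta>))))"

text \<open>The random element whose independence over the particles is required in
  \<open>truncated_branching_subordinator\<close>.\<close>

definition particle_noise :: "noise \<Rightarrow> particle \<Rightarrow> (real \<Rightarrow> real) \<times> (nat \<Rightarrow> ennreal \<times> qseq)" where
  "particle_noise z u = (\<lambda>r\<in>{0..}. motion z u r, \<lambda>j. (age z u j, mark z u j))"

primrec path_weight :: "real \<Rightarrow> real \<Rightarrow> real \<Rightarrow> noise \<Rightarrow> particle \<Rightarrow> ennreal" where
  "path_weight q lam \<delta> z [] = 1"
| "path_weight q lam \<delta> z (c # u) =
     path_weight q lam \<delta> z u * edge_weight q lam \<delta> c (particle_noise z u)"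

lemma suminf_ge_term: "f k \<le> (\<Sum>k. f k :: ennreal)"
  using sum_le_suminf[of f "{k}"] by simp

lemma edge_weight_ge:
  assumes q: "0 < q" and lam: "0 \<le> lam" and d: "0 < \<delta>"
    and good: "good_noise z" and fin: "birth z (c # u) < \<infinity>"
  shows "\<exists>k::nat. real k * \<delta> < enn2real (age z u (fst c)) \<and>
    ennreal (exp (lam * enn2real (age z u (fst c)) - q * enn2real (mark z u (fst c) 1)
      - q * motion z u (real k * \<delta>))) \<le> edge_weight q lam \<delta> c (particle_noise z u)"
proof -
  note b = birth_Cons_finite[OF good fin]
  define s where "s = enn2real (age z u (fst c))"
  define m where "m = enn2real (mark z u (fst c) 1)"
  have s: "age z u (fst c) = ennreal s" "0 < s" using b by (auto simp: s_def)
  have m: "mark z u (fst c) 1 = ennreal m" "0 \<le> m" using b by (auto simp: m_def)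
  \<comment> \<open>Cells of ages are open on the left, hence the ceiling minus one; cells of
    distances are closed on the left, hence the floor.\<close>
  define k where "k = nat (\<lceil>s / \<delta>\<rceil> - 1)"
  define l where "l = nat \<lfloor>m * q\<rfloor>"
  have rk: "real k = of_int \<lceil>s / \<delta>\<rceil> - 1"
    using s d by (simp add: k_def of_nat_nat)
  have "real k < s / \<delta>" "s / \<delta> \<le> real k + 1" unfolding rk by linarith+
  then have k: "real k * \<delta> < s" "s \<le> (real k + 1) * \<delta>" using d by (auto simp: field_simps)
  have rl: "real l = of_int \<lfloor>m * q\<rfloor>" using m q by (simp add: l_def)
  have "real l \<le> m * q" "m * q < real l + 1" unfolding rl by linarith+
  then have l: "real l / q \<le> m" "m < (real l + 1) / q" "real l \<le> q * m" using q by (auto simp: field_simps)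
  let ?t = "\<lambda>k l. if age z u (fst c) \<in> {ennreal (real k * \<delta>)<..ennreal ((real k + 1) * \<delta>)} \<and>
        mark z u (fst c) 1 \<in> {ennreal (real l / q)..<ennreal ((real l + 1) / q)}
      then ennreal (exp (lam * ((real k + 1) * \<delta>) - real l - q * motion z u (real k * \<delta>))) else 0"
  have ew: "edge_weight q lam \<delta> c (particle_noise z u) = (\<Sum>k. \<Sum>l. ?t k l)"
    unfolding edge_weight_def particle_noise_def using b(3) d
    by (simp only: fst_conv snd_conv restrict_def if_True) (simp cong: if_cong)
  have "ennreal (exp (lam * s - q * m - q * motion z u (real k * \<delta>)))
      \<le> ennreal (exp (lam * ((real k + 1) * \<delta>) - real l - q * motion z u (real k * \<delta>)))"
    using l mult_left_mono[OF k(2) lam] by (intro ennreal_leI) simp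
  also have "\<dots> = ?t k l"
    using s m k l d by (auto simp: ennreal_less_iff ennreal_le_iff)
  also have "\<dots> \<le> (\<Sum>l. ?t k l)" by (rule suminf_ge_term)
  also have "\<dots> \<le> (\<Sum>k. \<Sum>l. ?t k l)" by (rule suminf_ge_term)
  finally show ?thesis unfolding ew using k by (auto simp: s_def m_def)
qed

text \<open>The exponents add up along the line: a child starts at least at the starting point of
  its parent plus the motion at the grid time preceding the birth plus the birth distance.\<close>

lemma path_weight_ge:
  assumes q: "0 < q" and lam: "0 \<le> lam" and d: "0 < \<delta>" and good: "good_noise z"
    and fin: "birth z u < \<infinity>"
  shows "ennreal (exp (lam * enn2real (birth z u) - q * start z u)) \<le> path_weight q lam \<delta> z u"
  using fin
proof (induction u)
  case (Cons c u)
  note b = birth_Cons_finite[OF good Cons.prems(1)]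
  let ?b = "enn2real (birth z u)" and ?s = "enn2real (age z u (fst c))"
  let ?m = "enn2real (mark z u (fst c) 1)"
  obtain k :: nat where k: "real k * \<delta> < ?s"
    "ennreal (exp (lam * ?s - q * ?m - q * motion z u (real k * \<delta>))) \<le> edge_weight q lam \<delta> c (particle_noise z u)"
    using edge_weight_ge[OF q lam d good Cons.prems] by auto
  \<comment> \<open>The grid time is strictly before the birth, so the left limit of the parent at
    the birth is at least its value there.\<close>
  have "position z u (?b + real k * \<delta>) + ?m \<le> start z (c # u)"
    using position_parent_le_start[OF good Cons.prems, of "?b + real k * \<delta>"] k(1) d b(3,6) by simp
  moreover have "position z u (?b + real k * \<delta>) = start z u + motion z u (real k * \<delta>)"
    using position_after_birth[OF good, of u "?b + real k * \<delta>"] d by simp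
  ultimately have "start z u + motion z u (real k * \<delta>) + ?m \<le> start z (c # u)" by simp
  then have "q * (start z u + motion z u (real k * \<delta>) + ?m) \<le> q * start z (c # u)"
    using q by simp
  then have "exp (lam * enn2real (birth z (c # u)) - q * start z (c # u))
      \<le> exp (lam * ?b - q * start z u) * exp (lam * ?s - q * ?m - q * motion z u (real k * \<delta>))"
    unfolding exp_add[symmetric] b(6) by (simp add: algebra_simps)
  then have "ennreal (exp (lam * enn2real (birth z (c # u)) - q * start z (c # u)))
      \<le> ennreal (exp (lam * ?b - q * start z u))
        * ennreal (exp (lam * ?s - q * ?m - q * motion z u (real k * \<delta>)))"
    by (simp add: ennreal_mult[symmetric])
  also have "\<dots> \<le> path_weight q lam \<delta> z u * edge_weight q lam \<delta> c (particle_noise z u)"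
    by (intro mult_mono Cons.IH b k) auto
  finally show ?case by simp
qed simp

text \<open>The bound does not depend on \<open>t\<close> and is a product of functions of the
  noises of the distinct particles on the ancestral line, so its expectation factorises.\<close>

lemma weight_ge:
  assumes q: "0 < q" and lam: "0 \<le> lam" and d: "0 < \<delta>" and good: "good_noise z"
    and fin: "birth z u < \<infinity>" and t: "enn2real (birth z u) \<le> t"
  shows "ennreal (exp (lam * t - q * position z u t))
    \<le> path_weight q lam \<delta> z u * end_weight q lam \<delta> (particle_noise z u)"
proof -
  let ?b = "enn2real (birth z u)"
  define r where "r = t - ?b"
  have r: "0 \<le> r" using t by (simp add: r_def)
  define k where "k = nat \<lfloor>r / \<delta>\<rfloor>"
  have rk: "real k = of_int \<lfloor>r / \<delta>\<rfloor>" using r d by (simp add: k_def)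
  have "real k \<le> r / \<delta>" "r / \<delta> < real k + 1" unfolding rk by linarith+
  then have k: "real k * \<delta> \<le> r" "r \<le> (real k + 1) * \<delta>" using d by (auto simp: field_simps)
  have "motion z u (real k * \<delta>) \<le> motion z u r"
    using good_noiseD(2)[OF good] k d by simp
  then have "q * (start z u + motion z u (real k * \<delta>)) \<le> q * position z u t"
    using position_after_birth[OF good t] q by (simp add: r_def)
  moreover have "lam * t \<le> lam * ?b + lam * ((real k + 1) * \<delta>)"
    using k lam by (simp add: r_def distrib_left[symmetric] mult_left_mono)
  ultimately have "exp (lam * t - q * position z u t)
      \<le> exp (lam * ?b - q * start z u) * exp (lam * ((real k + 1) * \<delta>) - q * motion z u (real k * \<delta>))"
    unfolding exp_add[symmetric] by (simp add: algebra_simps)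
  then have "ennreal (exp (lam * t - q * position z u t))
      \<le> ennreal (exp (lam * ?b - q * start z u))
        * ennreal (exp (lam * ((real k + 1) * \<delta>) - q * motion z u (real k * \<delta>)))"
    by (simp add: ennreal_mult[symmetric])
  also have "\<dots> \<le> path_weight q lam \<delta> z u * end_weight q lam \<delta> (particle_noise z u)"
  proof (intro mult_mono path_weight_ge q lam d good fin)
    have "ennreal (exp (lam * ((real k + 1) * \<delta>) - q * motion z u (real k * \<delta>)))
      = ennreal (exp (lam * ((real k + 1) * \<delta>) - q * fst (particle_noise z u) (real k * \<delta>)))"
      using d by (simp add: particle_noise_def)
    also have "\<dots> \<le> end_weight q lam \<delta> (particle_noise z u)"
      unfolding end_weight_def by (rule suminf_ge_term)
    finally show "ennreal (exp (lam * ((real k + 1) * \<delta>) - q * motion z u (real k * \<delta>)))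
      \<le> end_weight q lam \<delta> (particle_noise z u)" .
  qed auto
  finally show ?thesis .
qed

section \<open>The truncated system\<close>

definition noise_space :: "((real \<Rightarrow> real) \<times> (nat \<Rightarrow> ennreal \<times> qseq)) measure" where
  "noise_space = PiM {0..} (\<lambda>_. borel) \<Otimes>\<^sub>M PiM UNIV (\<lambda>_. borel \<Otimes>\<^sub>M Q_borel)"

lemma measurable_noise_motion [measurable (raw)]:
  "0 \<le> r \<Longrightarrow> (\<lambda>w. fst w r) \<in> borel_measurable noise_space"
  unfolding noise_space_def
  by (rule measurable_compose[OF measurable_fst measurable_component_singleton]) simp

lemma measurable_noise_points: "(\<lambda>w. snd w j) \<in> noise_space \<rightarrow>\<^sub>M borel \<Otimes>\<^sub>M Q_borel"
  unfolding noise_space_def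
  by (rule measurable_compose[OF measurable_snd measurable_component_singleton]) simp

lemma measurable_noise_age [measurable]: "(\<lambda>w. fst (snd w j)) \<in> borel_measurable noise_space"
  by (rule measurable_compose[OF measurable_noise_points measurable_fst])

lemma measurable_noise_mark [measurable]: "(\<lambda>w. snd (snd w j)) \<in> noise_space \<rightarrow>\<^sub>M Q_borel"
  by (rule measurable_compose[OF measurable_noise_points measurable_snd])

lemma measurable_noise_mark_coordinate [measurable]:
  "(\<lambda>w. snd (snd w j) i) \<in> borel_measurable noise_space"
  by (rule measurable_compose[OF measurable_noise_mark measurable_coordinate])

lemma measurable_edge_weight [measurable]:
  assumes "0 \<le> \<delta>"
  shows "edge_weight q lam \<delta> c \<in> borel_measurable noise_space"
proof -
  have [measurable]: "(\<lambda>w. fst w (real k * \<delta>)) \<in> borel_measurable noise_space" for k :: nat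
    using assms by (intro measurable_noise_motion) simp
  show ?thesis unfolding edge_weight_def by measurable
qed

lemma measurable_end_weight [measurable]:
  assumes "0 \<le> \<delta>"
  shows "end_weight q lam \<delta> \<in> borel_measurable noise_space"
proof -
  have [measurable]: "(\<lambda>w. fst w (real k * \<delta>)) \<in> borel_measurable noise_space" for k :: nat
    using assms by (intro measurable_noise_motion) simp
  show ?thesis unfolding end_weight_def by measurable
qed

section \<open>Counts of points and Poisson laws\<close>

lemma point_count_eq_suminf:
  "point_count s x B = (\<Sum>j. indicator {j. s j < \<infinity> \<and> (enn2real (s j), x j) \<in> B} j)"
  unfolding point_count_def by (simp flip: nn_integral_count_space_nat)

lemma suminf_swap_ennreal:
  fixes f :: "nat \<Rightarrow> nat \<Rightarrow> ennreal"
  shows "(\<Sum>i. \<Sum>j. f i j) = (\<Sum>j. \<Sum>i. f i j)"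
proof -
  have "(\<Sum>i. \<Sum>j. f i j) = (\<integral>\<^sup>+i. (\<Sum>j. f i j) \<partial>count_space UNIV)"
    by (simp add: nn_integral_count_space_nat)
  also have "\<dots> = (\<Sum>j. \<integral>\<^sup>+i. f i j \<partial>count_space UNIV)"
    by (rule nn_integral_suminf) simp
  finally show ?thesis by (simp add: nn_integral_count_space_nat)
qed

lemma poisson_mean_sums:
  fixes m :: real
  shows "(\<lambda>k. real k * (exp (- m) * m ^ k / fact k)) sums m"
proof -
  have "(\<lambda>k. m ^ k / fact k) sums exp m"
    using exp_converges[of m] by (simp add: divide_inverse mult.commute)
  then have "(\<lambda>k. (m * exp (- m)) * (m ^ k / fact k)) sums ((m * exp (- m)) * exp m)"
    by (rule sums_mult)
  moreover have "(m * exp (- m)) * (m ^ k / fact k) = real (Suc k) * (exp (- m) * m ^ Suc k / fact (Suc k))" for k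
    by (simp add: fact_Suc field_simps del: of_nat_Suc)
  moreover have "(m * exp (- m)) * exp m = m" by (simp add: exp_minus)
  ultimately have "(\<lambda>k. real (Suc k) * (exp (- m) * m ^ Suc k / fact (Suc k))) sums m" by (simp only:)
  then show ?thesis by (subst (asm) sums_Suc_iff) simp
qed

lemma poisson_gf_sums:
  fixes m r :: real
  shows "(\<lambda>k. (exp (- m) * m ^ k / fact k) * r ^ k) sums exp (- m * (1 - r))"
proof -
  have "(\<lambda>k. (m * r) ^ k / fact k) sums exp (m * r)"
    using exp_converges[of "m * r"] by (simp add: divide_inverse mult.commute)
  then have "(\<lambda>k. exp (- m) * ((m * r) ^ k / fact k)) sums (exp (- m) * exp (m * r))"
    by (rule sums_mult)
  then show ?thesis
    by (simp add: power_mult_distrib exp_add[symmetric] algebra_simps)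
qed

context prob_space
begin

text \<open>The count is an extended number and could be infinite; the Poisson weights, however,
  already sum to 1.\<close>

lemma poisson_AE_of_nat:
  assumes [measurable]: "N \<in> borel_measurable M"
    and p: "\<And>k. prob {\<omega> \<in> space M. N \<omega> = of_nat k} = exp (- m) * m ^ k / fact k"
  shows "AE \<omega> in M. \<exists>k. N \<omega> = (of_nat k :: ennreal)"
proof -
  let ?A = "\<lambda>k. {\<omega> \<in> space M. N \<omega> = of_nat k}"
  have "(\<lambda>k. prob (?A k)) sums prob (\<Union>k. ?A k)"
    by (rule finite_measure_UNION) (auto simp: disjoint_family_on_def)
  moreover have "(\<lambda>k. prob (?A k)) sums 1"
    using poisson_gf_sums[of m 1] by (simp add: p)
  ultimately have "prob (\<Union>k. ?A k) = 1" by (rule sums_unique2)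
  then have "AE \<omega> in M. \<omega> \<in> (\<Union>k. ?A k)" by (subst (asm) prob_eq_1) auto
  then show ?thesis by eventually_elim auto
qed

lemma poisson_mean:
  assumes [measurable]: "N \<in> borel_measurable M" and "0 \<le> m"
    and p: "\<And>k. prob {\<omega> \<in> space M. N \<omega> = of_nat k} = exp (- m) * m ^ k / fact k"
  shows "(\<integral>\<^sup>+\<omega>. N \<omega> \<partial>M) = ennreal m"
proof -
  let ?A = "\<lambda>k. {\<omega> \<in> space M. N \<omega> = of_nat k}"
  have "(\<integral>\<^sup>+\<omega>. N \<omega> \<partial>M) = (\<integral>\<^sup>+\<omega>. (\<Sum>k. of_nat k * indicator (?A k) \<omega>) \<partial>M)"
  proof (rule nn_integral_cong_AE)
    show "AE \<omega> in M. N \<omega> = (\<Sum>k. of_nat k * indicator (?A k) \<omega>)"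
      using poisson_AE_of_nat[OF assms(1) p] AE_space
    proof eventually_elim
      case (elim \<omega>)
      then obtain n where n: "N \<omega> = of_nat n" by auto
      have "(\<Sum>k. of_nat k * indicator (?A k) \<omega> :: ennreal) = (\<Sum>k\<in>{n}. of_nat k * indicator (?A k) \<omega>)"
        by (rule suminf_finite) (auto simp: indicator_def n)
      then show ?case using elim n by (simp add: indicator_def)
    qed
  qed
  also have "\<dots> = (\<Sum>k. ennreal (real k * (exp (- m) * m ^ k / fact k)))"
  proof -
    have "of_nat k * emeasure M (?A k) = of_nat k * ennreal (exp (- m) * m ^ k / fact k)" for k
      by (simp only: emeasure_eq_measure p)
    also have "of_nat k * ennreal (exp (- m) * m ^ k / fact k) = ennreal (real k * (exp (- m) * m ^ k / fact k))" for k
      using \<open>0 \<le> m\<close> by (subst ennreal_mult) (auto simp: ennreal_of_nat_eq_real_of_nat)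
    finally show ?thesis
      by (subst nn_integral_suminf) (auto simp: nn_integral_cmult)
  qed
  also have "\<dots> = ennreal m"
    using poisson_mean_sums[of m] \<open>0 \<le> m\<close>
    by (subst suminf_ennreal2) (auto simp: sums_iff)
  finally show ?thesis .
qed

lemma indep_var_nn_integral_mult:
  fixes X Y :: "'a \<Rightarrow> ennreal"
  assumes "indep_var borel X borel Y"
  shows "(\<integral>\<^sup>+\<omega>. X \<omega> * Y \<omega> \<partial>M) = (\<integral>\<^sup>+\<omega>. X \<omega> \<partial>M) * (\<integral>\<^sup>+\<omega>. Y \<omega> \<partial>M)"
proof -
  have "case_bool borel borel = (\<lambda>_::bool. borel :: ennreal measure)"
    by (auto split: bool.split)
  with assms have "indep_vars (\<lambda>_. borel) (case_bool X Y) UNIV"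
    by (simp add: indep_var_def)
  from indep_vars_nn_integral[OF _ this] show ?thesis
    by (simp add: UNIV_bool mult.commute)
qed

end

section \<open>The noise at a fixed truncation level\<close>

locale truncated_noise = prob_space M for M :: "'w measure" +
  fixes \<alpha> \<theta> a :: real and Z :: "'w \<Rightarrow> noise"
  assumes alpha: "0 < \<alpha>" "\<alpha> < 1" and theta: "1 < \<theta>" and a_pos: "0 < a"
    and integrable_jumps: "(\<integral>\<^sup>+x. min 1 (x 0) \<partial>Lambda_mb \<alpha> \<theta>) < \<infinity>"
    and truncated: "truncated_branching_subordinator M 0 (Lambda_mb \<alpha> \<theta>) a Z"
begin

abbreviation "\<psi> \<equiv> laplace_exponent \<alpha>"
abbreviation "\<mu> \<equiv> intensity \<alpha> \<theta> a"
abbreviation "npoints u B \<omega> \<equiv> point_count (age (Z \<omega>) u) (mark (Z \<omega>) u) B"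

lemma subordinator_motion: "subordinator M 0 (nu \<alpha>) (\<lambda>r \<omega>. motion (Z \<omega>) u r)"
  using truncated a_pos
  unfolding truncated_branching_subordinator_def Let_def levy_measure_Lambda_mb[OF a_pos] by blast

lemma poisson_points:
  "poisson_point_process M \<mu> (\<lambda>j \<omega>. age (Z \<omega>) u j) (\<lambda>j \<omega>. mark (Z \<omega>) u j)"
  using truncated
  unfolding truncated_branching_subordinator_def Let_def intensity_def birth_measure_def by blast

lemma indep_motion_points:
  "indep_set
     (sets (vimage_algebra (space M) (\<lambda>\<omega>. \<lambda>r\<in>{0..}. motion (Z \<omega>) u r) (PiM {0..} (\<lambda>_. borel))))
     (sets (vimage_algebra (space M) (\<lambda>\<omega>. \<lambda>B\<in>sets \<mu>. npoints u B \<omega>) (PiM (sets \<mu>) (\<lambda>_. borel))))"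
  using truncated
  unfolding truncated_branching_subordinator_def Let_def intensity_def birth_measure_def by blast

lemma indep_particles: "indep_vars (\<lambda>_. noise_space) (\<lambda>u \<omega>. particle_noise (Z \<omega>) u) UNIV"
  using truncated
  unfolding truncated_branching_subordinator_def Let_def noise_space_def particle_noise_def by blast

lemma measurable_particle_noise [measurable]: "(\<lambda>\<omega>. particle_noise (Z \<omega>) u) \<in> M \<rightarrow>\<^sub>M noise_space"
  using indep_particles by (auto simp: indep_vars_def)

lemma measurable_motion [measurable (raw)]:
  assumes "0 \<le> r"
  shows "(\<lambda>\<omega>. motion (Z \<omega>) u r) \<in> borel_measurable M"
  using measurable_compose[OF measurable_particle_noise measurable_noise_motion[OF assms], of u] assms
  by (simp add: particle_noise_def)

lemma measurable_age [measurable]: "(\<lambda>\<omega>. age (Z \<omega>) u j) \<in> borel_measurable M"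
  using measurable_compose[OF measurable_particle_noise measurable_noise_age, of u j]
  by (simp add: particle_noise_def)

lemma measurable_mark [measurable]: "(\<lambda>\<omega>. mark (Z \<omega>) u j) \<in> M \<rightarrow>\<^sub>M Q_borel"
  using measurable_compose[OF measurable_particle_noise measurable_noise_mark, of u j]
  by (simp add: particle_noise_def)

lemma mark_in_Q_space: "\<omega> \<in> space M \<Longrightarrow> mark (Z \<omega>) u j \<in> Q_space"
  using measurable_space[OF measurable_mark] by simp

lemma measurable_npoints:
  assumes [measurable]: "B \<in> sets \<mu>"
  shows "npoints u B \<in> borel_measurable M"
proof -
  have [measurable]: "B \<in> sets (borel \<Otimes>\<^sub>M Q_borel)" using assms by simp
  have [measurable]: "(\<lambda>\<omega>. (enn2real (age (Z \<omega>) u j), mark (Z \<omega>) u j)) \<in> M \<rightarrow>\<^sub>M borel \<Otimes>\<^sub>M Q_borel" for j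
    by measurable
  show ?thesis
    unfolding point_count_eq_suminf indicator_def mem_Collect_eq by measurable
qed

lemma prob_npoints:
  assumes "B \<in> sets \<mu>" "emeasure \<mu> B < \<infinity>"
  shows "prob {\<omega> \<in> space M. npoints u B \<omega> = of_nat k} = exp (- measure \<mu> B) * measure \<mu> B ^ k / fact k"
  using poisson_points[of u] assms unfolding poisson_point_process_def by blast

lemma mean_npoints:
  assumes "B \<in> sets \<mu>" "emeasure \<mu> B < \<infinity>"
  shows "(\<integral>\<^sup>+\<omega>. npoints u B \<omega> \<partial>M) = emeasure \<mu> B"
  using poisson_mean[OF measurable_npoints[OF assms(1)] measure_nonneg prob_npoints[OF assms]] assms(2)
  by (simp add: emeasure_eq_ennreal_measure)

text \<open>Independence is given for the sigma-algebras generated by the whole motion and by the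
  family of all counts. Both factors are measurable with respect to these, hence independent of each
  other.\<close>

lemma mean_motion_npoints:
  assumes r: "0 \<le> r" and B: "B \<in> sets \<mu>" "emeasure \<mu> B < \<infinity>"
  shows "(\<integral>\<^sup>+\<omega>. ennreal (exp (- q * motion (Z \<omega>) u r)) * npoints u B \<omega> \<partial>M)
    = (\<integral>\<^sup>+\<omega>. ennreal (exp (- q * motion (Z \<omega>) u r)) \<partial>M) * emeasure \<mu> B"
proof -
  let ?X = "\<lambda>\<omega>. ennreal (exp (- q * motion (Z \<omega>) u r))"
  let ?V1 = "vimage_algebra (space M) (\<lambda>\<omega>. \<lambda>r\<in>{0..}. motion (Z \<omega>) u r) (PiM {0..} (\<lambda>_. borel))"
  let ?V2 = "vimage_algebra (space M) (\<lambda>\<omega>. \<lambda>B\<in>sets \<mu>. npoints u B \<omega>) (PiM (sets \<mu>) (\<lambda>_. borel))"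
  have "(\<lambda>\<omega>. \<lambda>r\<in>{0..}. motion (Z \<omega>) u r) \<in> ?V1 \<rightarrow>\<^sub>M PiM {0..} (\<lambda>_. borel)"
    by (rule measurable_vimage_algebra1) (simp add: space_PiM)
  from measurable_compose[OF this measurable_component_singleton, of r]
  have [measurable]: "(\<lambda>\<omega>. motion (Z \<omega>) u r) \<in> borel_measurable ?V1" using r by simp
  have X: "?X \<in> borel_measurable ?V1" by measurable
  have "(\<lambda>\<omega>. \<lambda>B\<in>sets \<mu>. npoints u B \<omega>) \<in> ?V2 \<rightarrow>\<^sub>M PiM (sets \<mu>) (\<lambda>_. borel)"
    by (rule measurable_vimage_algebra1) (simp add: space_PiM)
  from measurable_compose[OF this measurable_component_singleton, of B]
  have Y: "npoints u B \<in> borel_measurable ?V2" using B by (simp del: sets_intensity)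
  have "indep_var borel ?X borel (npoints u B)"
    unfolding indep_var_eq
  proof (intro conjI)
    show "?X \<in> borel_measurable M" using r by measurable
    show "npoints u B \<in> borel_measurable M" by (rule measurable_npoints) fact
    have 1: "sigma_sets (space M) {?X -` A \<inter> space M |A. A \<in> sets borel} \<subseteq> sets ?V1"
      using sets.sigma_sets_subset[of "{?X -` A \<inter> space M |A. A \<in> sets borel}" ?V1] measurable_sets[OF X]
      by auto
    have 2: "sigma_sets (space M) {npoints u B -` A \<inter> space M |A. A \<in> sets borel} \<subseteq> sets ?V2"
      using sets.sigma_sets_subset[of "{npoints u B -` A \<inter> space M |A. A \<in> sets borel}" ?V2] measurable_sets[OF Y]
      by auto
    show "indep_set (sigma_sets (space M) {?X -` A \<inter> space M |A. A \<in> sets borel})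
       (sigma_sets (space M) {npoints u B -` A \<inter> space M |A. A \<in> sets borel})"
      unfolding indep_sets2_eq
    proof (intro conjI ballI)
      note i = indep_motion_points[of u, unfolded indep_sets2_eq]
      show "sigma_sets (space M) {?X -` A \<inter> space M |A. A \<in> sets borel} \<subseteq> events"
        by (rule subset_trans[OF 1 conjunct1[OF i]])
      show "sigma_sets (space M) {npoints u B -` A \<inter> space M |A. A \<in> sets borel} \<subseteq> events"
        by (rule subset_trans[OF 2 conjunct1[OF conjunct2[OF i]]])
      fix A B' assume "A \<in> sigma_sets (space M) {?X -` A \<inter> space M |A. A \<in> sets borel}"
        "B' \<in> sigma_sets (space M) {npoints u B -` A \<inter> space M |A. A \<in> sets borel}"
      then show "prob (A \<inter> B') = prob A * prob B'"
        by (intro bspec[OF bspec[OF conjunct2[OF conjunct2[OF i]]]] subsetD[OF 1] subsetD[OF 2])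
    qed
  qed
  from indep_var_nn_integral_mult[OF this] show ?thesis
    by (simp only: mean_npoints[OF B])
qed

text \<open>The transform in \<open>subordinator\<close> is a Bochner integral. As the motion is
  almost surely nonnegative, the integrand is bounded by 1 and the two kinds of integral
  agree.\<close>

lemma laplace_motion:
  assumes "0 \<le> r" "0 \<le> q"
  shows "(\<integral>\<^sup>+\<omega>. ennreal (exp (- q * motion (Z \<omega>) u r)) \<partial>M) = ennreal (exp (- r * \<psi> q))"
proof -
  have ae: "AE \<omega> in M. motion (Z \<omega>) u 0 = 0 \<and> mono_on {0..} (\<lambda>t. motion (Z \<omega>) u t)"
    using subordinator_motion[of u] unfolding subordinator_def by (auto elim: eventually_mono)
  have ae': "AE \<omega> in M. exp (- q * motion (Z \<omega>) u r) \<le> 1"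
    using ae
  proof eventually_elim
    case (elim \<omega>)
    then have "motion (Z \<omega>) u 0 \<le> motion (Z \<omega>) u r"
      using monotone_onD[of "{0..}" "(\<le>)" "(\<le>)" "\<lambda>t. motion (Z \<omega>) u t" 0 r] assms(1) by simp
    then show ?case using elim assms(2) by simp
  qed
  have "integrable M (\<lambda>\<omega>. exp (- q * motion (Z \<omega>) u r))"
    by (rule integrable_const_bound[where B=1]) (use ae' assms in auto)
  then have "(\<integral>\<^sup>+\<omega>. ennreal (exp (- q * motion (Z \<omega>) u r)) \<partial>M)
      = ennreal (\<integral>\<omega>. exp (- q * motion (Z \<omega>) u r) \<partial>M)"
    by (rule nn_integral_eq_integral) simp
  also have "(\<integral>\<omega>. exp (- q * motion (Z \<omega>) u r) \<partial>M) = exp (- r * \<psi> q)"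
    using subordinator_motion[of u] assms unfolding subordinator_def laplace_exponent_def by simp
  finally show ?thesis .
qed

text \<open>Each forbidden kind of point lies in a set of intensity 0, whose Poisson count is almost
  surely 0: \<open>?B1\<close> collects points of age 0, and \<open>?B2\<close> marks that are not
  of the form of a birth mark. The infinite length of the time axis in \<open>?B2\<close> is
  multiplied by 0.\<close>

lemma AE_good_noise: "AE \<omega> in M. good_noise (Z \<omega>)"
proof -
  let ?N = "{x \<in> Q_space. x 0 \<noteq> 0 \<or> x 2 < \<infinity>}"
  let ?B1 = "{0} \<times> Q_space" and ?B2 = "UNIV \<times> ?N"
  have "{x \<in> space Q_borel. x 0 \<noteq> 0 \<or> x 2 < \<infinity>} \<in> sets Q_borel" by measurable
  then have N: "?N \<in> sets Q_borel" by simp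
  have B1: "?B1 \<in> sets \<mu>" "emeasure \<mu> ?B1 = 0"
    using a_pos theta emeasure_intensity_Times[of a \<theta> "{0}" Q_space \<alpha>] by auto
  have e: "{z. z < a \<and> birth_mark z \<in> ?N} = {}" by (auto simp: birth_mark_def)
  have B2: "?B2 \<in> sets \<mu>" using N by simp
  have "emeasure \<mu> ?B2 = emeasure lborel ({0..} \<inter> (UNIV :: real set)) * emeasure (mu \<theta>) {z. z < a \<and> birth_mark z \<in> ?N}"
    by (rule emeasure_intensity_Times[OF a_pos _ _ N]) (use theta in auto)
  then have B2': "emeasure \<mu> ?B2 = 0" unfolding e by simp
  have null: "AE \<omega> in M. npoints u B \<omega> = 0" if "B \<in> sets \<mu>" "emeasure \<mu> B = 0" for u B
  proof -
    have "prob {\<omega> \<in> space M. npoints u B \<omega> = of_nat 0} = 1"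
      using that by (subst prob_npoints) (auto simp: measure_def)
    moreover have [measurable]: "npoints u B \<in> borel_measurable M" using measurable_npoints that by blast
    ultimately have "AE \<omega> in M. npoints u B \<omega> = of_nat 0" by (subst (asm) prob_Collect_eq_1) auto
    then show ?thesis by simp
  qed
  have "AE \<omega> in M. motion (Z \<omega>) u 0 = 0 \<and> mono_on {0..} (motion (Z \<omega>) u) \<and>
     (\<forall>j. age (Z \<omega>) u j < \<infinity> \<longrightarrow> 0 < age (Z \<omega>) u j \<and> mark (Z \<omega>) u j 0 = 0 \<and> (\<forall>i\<ge>2. mark (Z \<omega>) u j i = \<infinity>))" for u
  proof -
    have "AE \<omega> in M. motion (Z \<omega>) u 0 = 0 \<and> mono_on {0..} (\<lambda>t. motion (Z \<omega>) u t)"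
      using subordinator_motion[of u] unfolding subordinator_def by (auto elim: eventually_mono)
    then show ?thesis
      using null[OF B1, of u] null[OF B2 B2', of u] AE_space
    proof eventually_elim
      case (elim \<omega>)
      have "0 < age (Z \<omega>) u j \<and> mark (Z \<omega>) u j 0 = 0 \<and> (\<forall>i\<ge>2. mark (Z \<omega>) u j i = \<infinity>)"
        if j: "age (Z \<omega>) u j < \<infinity>" for j
      proof -
        have Q: "mark (Z \<omega>) u j \<in> Q_space" using elim(4) by (rule mark_in_Q_space)
        have "j \<notin> {j. age (Z \<omega>) u j < \<infinity> \<and> (enn2real (age (Z \<omega>) u j), mark (Z \<omega>) u j) \<in> ?B1}"
          using elim(2) unfolding point_count_def by (auto simp: emeasure_count_space_eq_0)
        then have 1: "age (Z \<omega>) u j \<noteq> 0" using j Q by auto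
        have "j \<notin> {j. age (Z \<omega>) u j < \<infinity> \<and> (enn2real (age (Z \<omega>) u j), mark (Z \<omega>) u j) \<in> ?B2}"
          using elim(3) unfolding point_count_def by (auto simp: emeasure_count_space_eq_0)
        then have 2: "mark (Z \<omega>) u j 0 = 0" "mark (Z \<omega>) u j 2 = \<infinity>" using j Q by (auto simp: not_less top_unique)
        have "mark (Z \<omega>) u j i = \<infinity>" if "2 \<le> i" for i
        proof -
          have "mark (Z \<omega>) u j 2 \<le> mark (Z \<omega>) u j i" using Q that by (auto simp: Q_space_def mono_def)
          then show ?thesis using 2 by (simp add: top_unique)
        qed
        then show ?thesis using 1 2 by (auto simp: zero_less_iff_neq_zero)
      qed
      then show ?case using elim(1) by auto
    qed
  qed
  then show ?thesis unfolding good_noise_def by (simp add: AE_all_countable)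
qed

end

section \<open>Expected exponential weights\<close>

lemma suminf_geometric_ennreal:
  fixes c r :: real
  assumes "0 \<le> c" "0 \<le> r" "r < 1"
  shows "(\<Sum>k. ennreal (c * r ^ k)) = ennreal (c / (1 - r))"
proof -
  have "(\<lambda>k. c * r ^ k) sums (c * (1 / (1 - r)))"
    using assms by (intro sums_mult geometric_sums) simp
  then show ?thesis
    using assms by (subst suminf_ennreal2) (auto simp: sums_iff)
qed

text \<open>The common ratio of two geometric series. Over one age cell the motion contributes
  \<open>exp (- 1)\<close> and the time factor \<open>exp (1 / 2)\<close>; over one distance cell
  the weight contributes \<open>exp (- 1)\<close> and the density of \<open>mu \<theta>\<close> at
  most \<open>exp (1 / 2)\<close>.\<close>

definition cell_ratio :: real where "cell_ratio = exp (- 1 / 2)"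

lemma cell_ratio: "0 < cell_ratio" "cell_ratio < 1"
  by (auto simp: cell_ratio_def)

lemma cell_ratio_power: "cell_ratio ^ k = exp (- real k / 2)"
  by (simp add: cell_ratio_def exp_of_nat_mult[symmetric])

text \<open>The choice of \<open>q\<close>: below level \<open>a\<close> one has \<open>z powr \<theta> \<le> z * a powr (\<theta> - 1) \<le> z * q / 2\<close>, so half of the
  factor \<open>exp (- q * z)\<close> absorbs the density of \<open>mu \<theta>\<close>.\<close>

lemma emeasure_mu_box:
  assumes a: "0 < a" and theta: "1 \<le> \<theta>" and q: "2 * a powr (\<theta> - 1) \<le> q"
  shows "emeasure (mu \<theta>) {z. z < a \<and> ennreal (real l / q) \<le> ennreal z \<and> ennreal z < ennreal ((real l + 1) / q)}
    \<le> ennreal (exp ((real l + 1) / 2) / q)" (is "emeasure _ ?A \<le> _")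
proof -
  have q0: "0 < q" using a q by (smt (verit) powr_gt_zero)
  let ?A' = "{z. 0 \<le> z \<and> z < a \<and> real l / q \<le> z \<and> z < (real l + 1) / q}"
  have "emeasure (mu \<theta>) ?A = emeasure (mu \<theta>) ?A'"
  proof (rule emeasure_eq_AE)
    show "AE z in mu \<theta>. (z \<in> ?A) = (z \<in> ?A')"
      using AE_mu_nonneg by eventually_elim (use q0 in \<open>auto simp: ennreal_less_iff\<close>)
  qed auto
  also have "\<dots> \<le> ennreal (exp ((real l + 1) / 2) * ((real l + 1) / q - real l / q))"
  proof (rule emeasure_mu_le)
    show "?A' \<subseteq> {real l / q..(real l + 1) / q}" by auto
    show "real l / q \<le> (real l + 1) / q" using q0 by (simp add: divide_right_mono)
    fix z assume z: "z \<in> ?A'"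
    show "z powr \<theta> \<le> (real l + 1) / 2"
    proof (cases "z = 0")
      case False
      then have z0: "0 < z" using z by simp
      have "z powr \<theta> = z * z powr (\<theta> - 1)"
        using z0 powr_add[of z 1 "\<theta> - 1"] by simp
      also have "\<dots> \<le> z * a powr (\<theta> - 1)"
        using z theta by (intro mult_left_mono powr_mono2) auto
      also have "\<dots> \<le> z * (q / 2)" using q z0 by (intro mult_left_mono) auto
      also have "\<dots> \<le> (real l + 1) / 2" using z q0 by (auto simp: field_simps)
      finally show ?thesis .
    qed simp
  qed simp
  also have "(real l + 1) / q - real l / q = 1 / q" using q0 by (simp add: field_simps)
  finally show ?thesis by simp
qed

text \<open>The head of the list is the label of the youngest generation, so this sums over parents
  and then over their children.\<close>

lemma nn_integral_count_space_Cons: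
  fixes f :: "'x::countable list \<Rightarrow> ennreal"
  assumes "f [] = 0"
  shows "(\<integral>\<^sup>+u. f u \<partial>count_space UNIV)
    = (\<integral>\<^sup>+u. \<integral>\<^sup>+c. f (c # u) \<partial>count_space UNIV \<partial>count_space UNIV)"
proof -
  let ?g = "\<lambda>(u :: 'x list, c). c # u"
  have inj: "inj_on ?g UNIV" by (auto simp: inj_on_def)
  have "(\<integral>\<^sup>+u. f u \<partial>count_space UNIV) = (\<integral>\<^sup>+u. f u * indicator (range ?g) u \<partial>count_space UNIV)"
  proof (intro nn_integral_cong)
    fix u show "f u = f u * indicator (range ?g) u"
    proof (cases u)
      case (Cons c v)
      then have "u \<in> range ?g" by (intro image_eqI[of _ _ "(v, c)"]) auto
      then show ?thesis by simp
    qed (simp add: assms)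
  qed
  also have "\<dots> = (\<integral>\<^sup>+u. f u \<partial>count_space (range ?g))"
    by (subst nn_integral_count_space_indicator) auto
  also have "\<dots> = (\<integral>\<^sup>+p. f (?g p) \<partial>count_space UNIV)"
    by (rule nn_integral_bij_count_space[symmetric]) (simp add: inj bij_betw_def)
  also have "\<dots> = (\<integral>\<^sup>+u. \<integral>\<^sup>+c. f (c # u) \<partial>count_space UNIV \<partial>count_space UNIV)"
    using nn_integral_fst_count_space[of "\<lambda>p. f (?g p)"] by simp
  finally show ?thesis .
qed

context truncated_noise
begin

lemma \<psi>_scaling: "0 < q \<Longrightarrow> \<psi> q = \<psi> 1 * q powr \<alpha>"
  using laplace_exponent_scaling alpha by blast

lemma \<psi>_pos: "0 < q \<Longrightarrow> 0 < \<psi> q"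
  by (subst \<psi>_scaling) (use laplace_exponent_pos[OF alpha integrable_jumps] in auto)

text \<open>Half of the decay rate \<open>\<psi> q\<close> of the motions becomes the growth rate
  \<open>lam\<close>; the other half pays for the sum over age cells. The mesh
  \<open>1 / \<psi> q\<close> is the time scale of this decay.\<close>

abbreviation "edge q c w \<equiv> edge_weight q (\<psi> q / 2) (1 / \<psi> q) c w"
abbreviation "final q w \<equiv> end_weight q (\<psi> q / 2) (1 / \<psi> q) w"
abbreviation "path_w q z u \<equiv> path_weight q (\<psi> q / 2) (1 / \<psi> q) z u"

text \<open>Summing over all point numbers turns the indicators for single labels into counts of
  points in rectangles, the quantities that are independent of the motion.\<close>

lemma sum_edge_weight_eq:
  assumes q: "0 < q" and \<omega>: "\<omega> \<in> space M"
  defines "\<delta> \<equiv> 1 / \<psi> q"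
  shows "(\<Sum>j. edge q (j, 1) (particle_noise (Z \<omega>) u)) =
    (\<Sum>k. \<Sum>l. ennreal (exp ((real k + 1) / 2 - real l)) *
      (ennreal (exp (- q * motion (Z \<omega>) u (real k * \<delta>))) *
        npoints u ({real k * \<delta><..(real k + 1) * \<delta>} \<times>
          {x \<in> Q_space. ennreal (real l / q) \<le> x 1 \<and> x 1 < ennreal ((real l + 1) / q)}) \<omega>))"
proof -
  have d: "0 < \<delta>" using \<psi>_pos[OF q] by (simp add: \<delta>_def)
  let ?B = "\<lambda>k l. {real k * \<delta><..(real k + 1) * \<delta>} \<times>
          {x \<in> Q_space. ennreal (real l / q) \<le> x 1 \<and> x 1 < ennreal ((real l + 1) / q)}"
  let ?t = "\<lambda>k l. ennreal (exp ((real k + 1) / 2 - real l)) *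
      ennreal (exp (- q * motion (Z \<omega>) u (real k * \<delta>)))"
  let ?i = "\<lambda>k l j. indicator {j. age (Z \<omega>) u j < \<infinity> \<and> (enn2real (age (Z \<omega>) u j), mark (Z \<omega>) u j) \<in> ?B k l} j :: ennreal"
  have "edge q (j, 1) (particle_noise (Z \<omega>) u) = (\<Sum>k. \<Sum>l. ?t k l * ?i k l j)" for j
  proof -
    have Q: "mark (Z \<omega>) u j \<in> Q_space" using \<omega> by (rule mark_in_Q_space)
    have "(if age (Z \<omega>) u j \<in> {ennreal (real k * \<delta>)<..ennreal ((real k + 1) * \<delta>)} \<and>
        mark (Z \<omega>) u j 1 \<in> {ennreal (real l / q)..<ennreal ((real l + 1) / q)}
      then ennreal (exp (\<psi> q / 2 * ((real k + 1) * \<delta>) - real l - q * fst (particle_noise (Z \<omega>) u) (real k * \<delta>))) else 0)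
      = ?t k l * ?i k l j" for k l
    proof -
      have "\<psi> q / 2 * ((real k + 1) * \<delta>) = (real k + 1) / 2"
        using \<psi>_pos[OF q] by (simp add: \<delta>_def)
      then have e: "ennreal (exp (\<psi> q / 2 * ((real k + 1) * \<delta>) - real l - q * fst (particle_noise (Z \<omega>) u) (real k * \<delta>))) = ?t k l"
        using d by (simp add: particle_noise_def ennreal_mult[symmetric] exp_add[symmetric])
      have "age (Z \<omega>) u j \<in> {ennreal (real k * \<delta>)<..ennreal ((real k + 1) * \<delta>)} \<longleftrightarrow>
        age (Z \<omega>) u j < \<infinity> \<and> enn2real (age (Z \<omega>) u j) \<in> {real k * \<delta><..(real k + 1) * \<delta>}"
        using d by (cases "age (Z \<omega>) u j") (auto simp: ennreal_less_iff ennreal_le_iff top_unique)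
      then show ?thesis unfolding e using Q by (auto simp: indicator_def)
    qed
    then show ?thesis unfolding edge_weight_def \<delta>_def[symmetric]
      by (simp add: particle_noise_def)
  qed
  then have "(\<Sum>j. edge q (j, 1) (particle_noise (Z \<omega>) u)) = (\<Sum>j. \<Sum>k. \<Sum>l. ?t k l * ?i k l j)"
    by simp
  also have "\<dots> = (\<Sum>k. \<Sum>l. \<Sum>j. ?t k l * ?i k l j)"
    by (subst suminf_swap_ennreal, subst suminf_swap_ennreal) (rule refl)
  also have "\<dots> = (\<Sum>k. \<Sum>l. ?t k l * npoints u (?B k l) \<omega>)"
    unfolding ennreal_suminf_cmult point_count_eq_suminf ..
  finally show ?thesis by (simp only: mult.assoc)
qed

text \<open>A cell contributes the transform \<open>exp (- k)\<close> of the motion times the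
  intensity of the rectangle, and both sums are geometric with ratio \<open>cell_ratio\<close>. The
  factor \<open>1 / (\<psi> q * q)\<close> is the area of a cell and makes the bound small for large
  \<open>q\<close>.\<close>

lemma mean_edge_weight:
  assumes q: "2 * a powr (\<theta> - 1) \<le> q"
  shows "(\<Sum>j. \<integral>\<^sup>+\<omega>. edge q (j, 1) (particle_noise (Z \<omega>) u) \<partial>M)
    \<le> ennreal (exp 1 / (\<psi> q * q) / (1 - cell_ratio) / (1 - cell_ratio))"
proof -
  have q0: "0 < q" using a_pos q by (smt (verit) powr_gt_zero)
  define \<delta> where "\<delta> = 1 / \<psi> q"
  have d: "0 < \<delta>" using \<psi>_pos[OF q0] by (simp add: \<delta>_def)
  define A where "A l = {x \<in> Q_space. ennreal (real l / q) \<le> x 1 \<and> x 1 < ennreal ((real l + 1) / q)}" for l :: nat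
  define B where "B k l = {real k * \<delta><..(real k + 1) * \<delta>} \<times> A l" for k l :: nat
  have A: "A l \<in> sets Q_borel" for l
  proof -
    have "{x \<in> space Q_borel. ennreal (real l / q) \<le> x 1 \<and> x 1 < ennreal ((real l + 1) / q)} \<in> sets Q_borel"
      by measurable
    then show ?thesis by (simp add: A_def)
  qed
  have B: "B k l \<in> sets \<mu>" for k l unfolding B_def using A by simp
  have eB: "emeasure \<mu> (B k l) \<le> ennreal (\<delta> * (exp ((real l + 1) / 2) / q))" for k l
  proof -
    have I: "{0..} \<inter> {real k * \<delta><..(real k + 1) * \<delta>} = {real k * \<delta><..(real k + 1) * \<delta>}"
      using d by (auto intro: order_trans[of 0 "real k * \<delta>"])
    have "emeasure \<mu> (B k l) = ennreal \<delta> * emeasure (mu \<theta>) {z. z < a \<and> birth_mark z \<in> A l}"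
    proof -
      have "emeasure lborel {real k * \<delta><..(real k + 1) * \<delta>} = ennreal ((real k + 1) * \<delta> - real k * \<delta>)"
        using d by (intro emeasure_lborel_Ioc) simp
      also have "(real k + 1) * \<delta> - real k * \<delta> = \<delta>" by (simp add: algebra_simps)
      finally show ?thesis
        unfolding B_def using a_pos theta A
        by (subst emeasure_intensity_Times) (simp_all only: I, auto)
    qed
    also have "{z. z < a \<and> birth_mark z \<in> A l}
        = {z. z < a \<and> ennreal (real l / q) \<le> ennreal z \<and> ennreal z < ennreal ((real l + 1) / q)}"
      by (auto simp: A_def birth_mark_in_Q_space) (auto simp: birth_mark_def)
    also have "ennreal \<delta> * emeasure (mu \<theta>) \<dots> \<le> ennreal \<delta> * ennreal (exp ((real l + 1) / 2) / q)"
      using a_pos theta q by (intro mult_left_mono emeasure_mu_box) auto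
    finally show ?thesis using d q0 by (simp add: ennreal_mult[symmetric])
  qed
  have fB: "emeasure \<mu> (B k l) < \<infinity>" for k l
    using eB[of k l] by (rule le_less_trans) simp
  have [measurable]: "npoints u (B k l) \<in> borel_measurable M" for k l
    by (rule measurable_npoints[OF B])
  have [measurable]: "(\<lambda>\<omega>. motion (Z \<omega>) u (real k * \<delta>)) \<in> borel_measurable M" for k :: nat
    using d by (intro measurable_motion) simp
  have [measurable]: "(\<lambda>\<omega>. edge q (j, 1) (particle_noise (Z \<omega>) u)) \<in> borel_measurable M" for j
    using d by (intro measurable_compose[OF measurable_particle_noise] measurable_edge_weight) (simp add: \<delta>_def)
  have "(\<Sum>j. \<integral>\<^sup>+\<omega>. edge q (j, 1) (particle_noise (Z \<omega>) u) \<partial>M)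
      = (\<integral>\<^sup>+\<omega>. (\<Sum>j. edge q (j, 1) (particle_noise (Z \<omega>) u)) \<partial>M)"
    by (rule nn_integral_suminf[symmetric]) measurable
  also have "\<dots> = (\<integral>\<^sup>+\<omega>. (\<Sum>k. \<Sum>l. ennreal (exp ((real k + 1) / 2 - real l)) *
      (ennreal (exp (- q * motion (Z \<omega>) u (real k * \<delta>))) * npoints u (B k l) \<omega>)) \<partial>M)"
    unfolding B_def A_def \<delta>_def by (intro nn_integral_cong sum_edge_weight_eq q0)
  also have "\<dots> = (\<Sum>k. \<Sum>l. ennreal (exp ((real k + 1) / 2 - real l)) *
      (\<integral>\<^sup>+\<omega>. ennreal (exp (- q * motion (Z \<omega>) u (real k * \<delta>))) * npoints u (B k l) \<omega> \<partial>M))"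
    by (simp add: nn_integral_suminf nn_integral_cmult)
  also have "\<dots> \<le> (\<Sum>k. \<Sum>l. ennreal ((exp 1 / (\<psi> q * q) * cell_ratio ^ k) * cell_ratio ^ l))"
  proof (intro suminf_le summableI)
    fix k l :: nat
    have "(\<integral>\<^sup>+\<omega>. ennreal (exp (- q * motion (Z \<omega>) u (real k * \<delta>))) * npoints u (B k l) \<omega> \<partial>M)
      = ennreal (exp (- (real k * \<delta>) * \<psi> q)) * emeasure \<mu> (B k l)"
      using d q0 by (subst mean_motion_npoints[OF _ B fB], simp, subst laplace_motion) auto
    also have "\<dots> \<le> ennreal (exp (- real k)) * ennreal (\<delta> * (exp ((real l + 1) / 2) / q))"
      using \<psi>_pos[OF q0] by (intro mult_mono eB) (auto simp: \<delta>_def)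
    finally have "ennreal (exp ((real k + 1) / 2 - real l)) *
      (\<integral>\<^sup>+\<omega>. ennreal (exp (- q * motion (Z \<omega>) u (real k * \<delta>))) * npoints u (B k l) \<omega> \<partial>M)
      \<le> ennreal (exp ((real k + 1) / 2 - real l)) *
        (ennreal (exp (- real k)) * ennreal (\<delta> * (exp ((real l + 1) / 2) / q)))"
      by (intro mult_left_mono) auto
    also have "\<dots> = ennreal (exp ((real k + 1) / 2 - real l) * (exp (- real k) * (\<delta> * (exp ((real l + 1) / 2) / q))))"
      using d q0 by (simp add: ennreal_mult[symmetric])
    also have "exp ((real k + 1) / 2 - real l) * (exp (- real k) * (\<delta> * (exp ((real l + 1) / 2) / q)))
      = (exp 1 / (\<psi> q * q) * cell_ratio ^ k) * cell_ratio ^ l"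
    proof -
      have "exp ((real k + 1) / 2 - real l) * (exp (- real k) * exp ((real l + 1) / 2))
        = exp 1 * (exp (- real k / 2) * exp (- real l / 2))"
        by (simp add: exp_add[symmetric] field_simps)
      then show ?thesis by (simp add: cell_ratio_power \<delta>_def field_simps)
    qed
    finally show "ennreal (exp ((real k + 1) / 2 - real l)) *
      (\<integral>\<^sup>+\<omega>. ennreal (exp (- q * motion (Z \<omega>) u (real k * \<delta>))) * npoints u (B k l) \<omega> \<partial>M)
      \<le> ennreal ((exp 1 / (\<psi> q * q) * cell_ratio ^ k) * cell_ratio ^ l)" .
  qed
  also have "\<dots> = (\<Sum>k. ennreal (exp 1 / (\<psi> q * q) / (1 - cell_ratio) * cell_ratio ^ k))"
    using cell_ratio \<psi>_pos[OF q0] q0 by (subst suminf_geometric_ennreal) (auto simp: field_simps)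
  also have "\<dots> = ennreal (exp 1 / (\<psi> q * q) / (1 - cell_ratio) / (1 - cell_ratio))"
    using cell_ratio \<psi>_pos[OF q0] q0 by (subst suminf_geometric_ennreal) auto
  finally show ?thesis .
qed

lemma mean_end_weight:
  assumes q: "0 < q"
  shows "(\<integral>\<^sup>+\<omega>. final q (particle_noise (Z \<omega>) u) \<partial>M) = ennreal (exp (1 / 2) / (1 - cell_ratio))"
proof -
  define \<delta> where "\<delta> = 1 / \<psi> q"
  have d: "0 < \<delta>" using \<psi>_pos[OF q] by (simp add: \<delta>_def)
  have [measurable]: "(\<lambda>\<omega>. motion (Z \<omega>) u (real k * \<delta>)) \<in> borel_measurable M" for k :: nat
    using d by (intro measurable_motion) simp
  have e: "ennreal (exp (\<psi> q / 2 * ((real k + 1) * \<delta>) - q * fst (particle_noise z u) (real k * \<delta>)))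
    = ennreal (exp ((real k + 1) / 2)) * ennreal (exp (- q * motion z u (real k * \<delta>)))" for k z
  proof -
    have "\<psi> q / 2 * ((real k + 1) * \<delta>) = (real k + 1) / 2"
      using \<psi>_pos[OF q] by (simp add: \<delta>_def)
    then show ?thesis using d by (simp add: particle_noise_def ennreal_mult[symmetric] exp_add[symmetric])
  qed
  have "(\<integral>\<^sup>+\<omega>. final q (particle_noise (Z \<omega>) u) \<partial>M)
    = (\<Sum>k. ennreal (exp ((real k + 1) / 2)) * (\<integral>\<^sup>+\<omega>. ennreal (exp (- q * motion (Z \<omega>) u (real k * \<delta>))) \<partial>M))"
    unfolding end_weight_def \<delta>_def[symmetric] e by (simp add: nn_integral_suminf nn_integral_cmult)
  also have "\<dots> = (\<Sum>k. ennreal (exp (1 / 2) * cell_ratio ^ k))"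
  proof (intro suminf_cong)
    fix k :: nat
    have "real k * \<delta> * \<psi> q = real k" using \<psi>_pos[OF q] by (simp add: \<delta>_def)
    then have "(\<integral>\<^sup>+\<omega>. ennreal (exp (- q * motion (Z \<omega>) u (real k * \<delta>))) \<partial>M) = ennreal (exp (- real k))"
      using d q by (subst laplace_motion) auto
    moreover have "exp ((real k + 1) / 2) * exp (- real k) = exp (1 / 2) * cell_ratio ^ k"
      unfolding cell_ratio_power exp_add[symmetric] by (simp add: field_simps)
    ultimately show "ennreal (exp ((real k + 1) / 2)) * (\<integral>\<^sup>+\<omega>. ennreal (exp (- q * motion (Z \<omega>) u (real k * \<delta>))) \<partial>M)
        = ennreal (exp (1 / 2) * cell_ratio ^ k)"
      by (simp add: ennreal_mult[symmetric])
  qed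
  also have "\<dots> = ennreal (exp (1 / 2) / (1 - cell_ratio))"
    using cell_ratio by (subst suminf_geometric_ennreal) auto
  finally show ?thesis .
qed

text \<open>The factorised form of the expectation of \<open>path_w\<close>: the particles on one
  ancestral line are distinct, so their noises are independent.\<close>

primrec mean_path :: "real \<Rightarrow> particle \<Rightarrow> ennreal" where
  "mean_path q [] = 1"
| "mean_path q (c # u) = mean_path q u * (\<integral>\<^sup>+\<omega>. edge q c (particle_noise (Z \<omega>) u) \<partial>M)"

lemma measurable_edge: "0 < q \<Longrightarrow> edge q c \<in> borel_measurable noise_space"
  using \<psi>_pos[of q] by (intro measurable_edge_weight) auto

lemma measurable_final: "0 < q \<Longrightarrow> final q \<in> borel_measurable noise_space"
  using \<psi>_pos[of q] by (intro measurable_end_weight) auto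

lemma measurable_path_w: "0 < q \<Longrightarrow> (\<lambda>\<omega>. path_w q (Z \<omega>) u) \<in> borel_measurable M"
  by (induction u)
     (auto intro!: borel_measurable_times_ennreal measurable_compose[OF measurable_particle_noise measurable_edge])

text \<open>The induction moves the noise of the last particle of the path into the product over \<open>J\<close>; the length
  condition keeps the index set of that product free of repetitions.\<close>

lemma mean_path_times_prod:
  assumes q: "0 < q" and "finite J" "\<And>v. v \<in> J \<Longrightarrow> length u \<le> length v"
    and "\<And>v. v \<in> J \<Longrightarrow> G v \<in> borel_measurable noise_space"
  shows "(\<integral>\<^sup>+\<omega>. path_w q (Z \<omega>) u * (\<Prod>v\<in>J. G v (particle_noise (Z \<omega>) v)) \<partial>M)
    = mean_path q u * (\<Prod>v\<in>J. \<integral>\<^sup>+\<omega>. G v (particle_noise (Z \<omega>) v) \<partial>M)"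
  using assms(2-)
proof (induction u arbitrary: J G)
  case Nil
  have "indep_vars (\<lambda>_. borel) (\<lambda>v \<omega>. G v (particle_noise (Z \<omega>) v)) J"
    by (rule indep_vars_compose2[OF indep_vars_subset[OF indep_particles subset_UNIV] Nil(3)])
  from indep_vars_nn_integral[OF Nil(1) this] show ?case by simp
next
  case (Cons c u)
  \<comment> \<open>The edge leading to \<open>c # u\<close> is a function of the noise of the
    parent \<open>u\<close>, which is shorter than every index in \<open>J\<close>.\<close>
  define G' where "G' = G(u := edge q c)"
  have u: "u \<notin> J" using Cons.prems(2) by fastforce
  have G': "(\<Prod>v\<in>J. F v (G' v)) = (\<Prod>v\<in>J. F v (G v))" for F :: "particle \<Rightarrow> _ \<Rightarrow> ennreal"
    using u by (intro prod.cong) (auto simp: G'_def)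
  have "(\<integral>\<^sup>+\<omega>. path_w q (Z \<omega>) (c # u) * (\<Prod>v\<in>J. G v (particle_noise (Z \<omega>) v)) \<partial>M)
    = (\<integral>\<^sup>+\<omega>. path_w q (Z \<omega>) u * (\<Prod>v\<in>insert u J. G' v (particle_noise (Z \<omega>) v)) \<partial>M)"
    using u Cons.prems(1) G'[of "\<lambda>v g. g (particle_noise (Z _) v)"]
    by (simp add: mult.assoc) (simp add: G'_def)
  also have "\<dots> = mean_path q u * (\<Prod>v\<in>insert u J. \<integral>\<^sup>+\<omega>. G' v (particle_noise (Z \<omega>) v) \<partial>M)"
    using Cons.prems measurable_edge[OF q]
    by (intro Cons.IH) (auto simp: G'_def dest: Cons.prems(2))
  also have "\<dots> = mean_path q (c # u) * (\<Prod>v\<in>J. \<integral>\<^sup>+\<omega>. G v (particle_noise (Z \<omega>) v) \<partial>M)"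
    using u Cons.prems(1) G'[of "\<lambda>v g. \<integral>\<^sup>+\<omega>. g (particle_noise (Z \<omega>) v) \<partial>M"]
    by (simp add: mult.assoc) (simp add: G'_def)
  finally show ?case .
qed

lemma mean_weight:
  assumes q: "0 < q"
  shows "(\<integral>\<^sup>+\<omega>. path_w q (Z \<omega>) u * final q (particle_noise (Z \<omega>) u) \<partial>M)
    = mean_path q u * ennreal (exp (1 / 2) / (1 - cell_ratio))"
  using mean_path_times_prod[OF q, of "{u}" u "\<lambda>_. final q"] measurable_final[OF q]
    mean_end_weight[OF q, of u] by simp

lemma sum_mean_edge:
  assumes q: "2 * a powr (\<theta> - 1) \<le> q"
  shows "(\<integral>\<^sup>+c. (\<integral>\<^sup>+\<omega>. edge q c (particle_noise (Z \<omega>) u) \<partial>M) \<partial>count_space UNIV)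
    \<le> ennreal (exp 1 / (\<psi> q * q) / (1 - cell_ratio) / (1 - cell_ratio))"
proof -
  let ?f = "\<lambda>c. \<integral>\<^sup>+\<omega>. edge q c (particle_noise (Z \<omega>) u) \<partial>M"
  have "(\<integral>\<^sup>+c. ?f c \<partial>count_space UNIV)
      = (\<integral>\<^sup>+j. \<integral>\<^sup>+i. ?f (j, i) \<partial>count_space UNIV \<partial>count_space UNIV)"
    by (rule nn_integral_fst_count_space[symmetric])
  also have "\<dots> = (\<integral>\<^sup>+j. ?f (j, 1) \<partial>count_space UNIV)"
  proof (intro nn_integral_cong)
    fix j :: nat
    have "(\<integral>\<^sup>+i. ?f (j, i) \<partial>count_space UNIV) = (\<Sum>i\<in>{1}. ?f (j, i))"
      by (rule nn_integral_count_space') (auto simp: edge_weight_def)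
    then show "(\<integral>\<^sup>+i. ?f (j, i) \<partial>count_space UNIV) = ?f (j, 1)" by simp
  qed
  also have "\<dots> = (\<Sum>j. ?f (j, 1))" by (rule nn_integral_count_space_nat)
  also have "\<dots> \<le> ennreal (exp 1 / (\<psi> q * q) / (1 - cell_ratio) / (1 - cell_ratio))"
    by (rule mean_edge_weight[OF q])
  finally show ?thesis .
qed

text \<open>The bound on the edges is the same for every particle, so each generation weighs at most
  half as much as the previous one.\<close>

lemma sum_mean_path:
  assumes q: "2 * a powr (\<theta> - 1) \<le> q"
    and small: "exp 1 / (\<psi> q * q) / (1 - cell_ratio) / (1 - cell_ratio) \<le> 1 / 2"
  shows "(\<integral>\<^sup>+u. mean_path q u \<partial>count_space UNIV) \<le> 2"
proof -
  let ?g = "\<lambda>n u. mean_path q u * indicator {u. length u = n} u"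
  have bound: "(\<integral>\<^sup>+u. ?g n u \<partial>count_space UNIV) \<le> ennreal ((1 / 2) ^ n)" for n
  proof (induction n)
    case 0
    have "(\<integral>\<^sup>+u. ?g 0 u \<partial>count_space UNIV) = (\<Sum>u\<in>{[]}. ?g 0 u)"
      by (rule nn_integral_count_space') auto
    then show ?case by simp
  next
    case (Suc n)
    have "(\<integral>\<^sup>+u. ?g (Suc n) u \<partial>count_space UNIV)
        = (\<integral>\<^sup>+u. \<integral>\<^sup>+c. ?g (Suc n) (c # u) \<partial>count_space UNIV \<partial>count_space UNIV)"
      by (rule nn_integral_count_space_Cons) simp
    also have "\<dots> = (\<integral>\<^sup>+u. \<integral>\<^sup>+c. ?g n u * (\<integral>\<^sup>+\<omega>. edge q c (particle_noise (Z \<omega>) u) \<partial>M)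
        \<partial>count_space UNIV \<partial>count_space UNIV)"
      by (intro nn_integral_cong) (auto simp: indicator_def)
    also have "\<dots> = (\<integral>\<^sup>+u. ?g n u * (\<integral>\<^sup>+c. (\<integral>\<^sup>+\<omega>. edge q c (particle_noise (Z \<omega>) u) \<partial>M)
        \<partial>count_space UNIV) \<partial>count_space UNIV)"
      by (intro nn_integral_cong nn_integral_cmult) auto
    also have "\<dots> \<le> (\<integral>\<^sup>+u. ?g n u * ennreal (1 / 2) \<partial>count_space UNIV)"
      by (intro nn_integral_mono mult_left_mono order_trans[OF sum_mean_edge[OF q]] ennreal_leI small) auto
    also have "\<dots> = (\<integral>\<^sup>+u. ?g n u \<partial>count_space UNIV) * ennreal (1 / 2)"
      by (rule nn_integral_multc) auto
    also have "\<dots> \<le> ennreal ((1 / 2) ^ n) * ennreal (1 / 2)"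
      by (intro mult_right_mono Suc.IH) auto
    also have "\<dots> = ennreal ((1 / 2) ^ Suc n)"
      by (subst ennreal_mult[symmetric]) auto
    finally show ?case .
  qed
  have "(\<integral>\<^sup>+u. mean_path q u \<partial>count_space UNIV) = (\<integral>\<^sup>+u. (\<Sum>n. ?g n u) \<partial>count_space UNIV)"
  proof (intro nn_integral_cong)
    fix u :: particle
    have "(\<Sum>n. indicator {u. length u = n} u :: ennreal) = (\<Sum>n\<in>{length u}. indicator {u. length u = n} u)"
      by (rule suminf_finite) auto
    then show "mean_path q u = (\<Sum>n. ?g n u)" by simp
  qed
  also have "\<dots> = (\<Sum>n. \<integral>\<^sup>+u. ?g n u \<partial>count_space UNIV)"
    by (rule nn_integral_suminf) auto
  also have "\<dots> \<le> (\<Sum>n. ennreal (1 * (1 / 2) ^ n))"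
    using bound by (intro suminf_le summableI) auto
  also have "\<dots> = 2"
    by (subst suminf_geometric_ennreal) auto
  finally show ?thesis .
qed

text \<open>Markov's inequality for the total weight: one particle below \<open>x\<close> at time
  \<open>t\<close> forces \<open>tot\<close> above \<open>exp (\<psi> q / 2 * t - q * x)\<close>.
  Working with an event \<open>A\<close> outside of which the claim holds almost surely makes it
  unnecessary to measure the set described by positions, which are defined through limits.\<close>

lemma early_particles:
  assumes q: "2 * a powr (\<theta> - 1) \<le> q"
    and small: "exp 1 / (\<psi> q * q) / (1 - cell_ratio) / (1 - cell_ratio) \<le> 1 / 2" and t: "0 \<le> t"
  shows "\<exists>A\<in>events. prob A \<le> 2 * exp (1 / 2) / (1 - cell_ratio) * exp (q * x - \<psi> q / 2 * t) \<and>
    (AE \<omega> in M. \<omega> \<notin> A \<longrightarrow> (\<forall>u\<in>particles (Z \<omega>) t. x \<le> position (Z \<omega>) u t))"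
proof -
  have q0: "0 < q" using a_pos q by (smt (verit) powr_gt_zero)
  let ?W = "\<lambda>\<omega> u. path_w q (Z \<omega>) u * final q (particle_noise (Z \<omega>) u)"
  have W[measurable]: "(\<lambda>\<omega>. ?W \<omega> u) \<in> borel_measurable M" for u
    by (intro borel_measurable_times_ennreal measurable_path_w q0
        measurable_compose[OF measurable_particle_noise measurable_final])
  define tot where "tot \<omega> = (\<integral>\<^sup>+u. ?W \<omega> u \<partial>count_space UNIV)" for \<omega>
  define c where "c = ennreal (exp (q * x - \<psi> q / 2 * t))"
  interpret cs: sigma_finite_measure "count_space (UNIV :: particle set)"
    by (rule sigma_finite_measure_count_space)
  have "(\<lambda>p. ?W (snd p) (fst p)) \<in> borel_measurable (count_space UNIV \<Otimes>\<^sub>M M)"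
    by (rule measurable_pair_measure_countable1) auto
  then have "(\<lambda>(\<omega>, u). ?W \<omega> u) \<in> borel_measurable (M \<Otimes>\<^sub>M count_space UNIV)"
    by (subst measurable_pair_swap_iff) (simp add: case_prod_beta')
  then have [measurable]: "tot \<in> borel_measurable M"
    unfolding tot_def by (rule cs.borel_measurable_nn_integral)
  have "(\<integral>\<^sup>+\<omega>. tot \<omega> \<partial>M) = (\<integral>\<^sup>+u. \<integral>\<^sup>+\<omega>. ?W \<omega> u \<partial>M \<partial>count_space UNIV)"
    unfolding tot_def by (rule nn_integral_count_space_nn_integral) auto
  also have "\<dots> = (\<integral>\<^sup>+u. mean_path q u * ennreal (exp (1 / 2) / (1 - cell_ratio)) \<partial>count_space UNIV)"
    by (simp add: mean_weight[OF q0])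
  also have "\<dots> = (\<integral>\<^sup>+u. mean_path q u \<partial>count_space UNIV) * ennreal (exp (1 / 2) / (1 - cell_ratio))"
    by (rule nn_integral_multc) auto
  also have "\<dots> \<le> 2 * ennreal (exp (1 / 2) / (1 - cell_ratio))"
    by (intro mult_right_mono sum_mean_path q small) auto
  also have "\<dots> = ennreal (2 * exp (1 / 2) / (1 - cell_ratio))"
    using cell_ratio by (subst ennreal_numeral[symmetric], subst ennreal_mult[symmetric]) auto
  finally have tot: "(\<integral>\<^sup>+\<omega>. tot \<omega> \<partial>M) \<le> ennreal (2 * exp (1 / 2) / (1 - cell_ratio))" .
  define A where "A = {\<omega> \<in> space M. 1 \<le> c * tot \<omega>}"
  have A: "A \<in> events" unfolding A_def by measurable
  have "emeasure M A \<le> c * (\<integral>\<^sup>+\<omega>. tot \<omega> * indicator (space M) \<omega> \<partial>M)"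
    unfolding A_def by (rule nn_integral_Markov_inequality) auto
  also have "\<dots> = c * (\<integral>\<^sup>+\<omega>. tot \<omega> \<partial>M)"
    by (intro arg_cong2[where f="(*)"] nn_integral_cong) auto
  also have "\<dots> \<le> c * ennreal (2 * exp (1 / 2) / (1 - cell_ratio))"
    by (intro mult_left_mono tot) auto
  also have "\<dots> = ennreal (2 * exp (1 / 2) / (1 - cell_ratio) * exp (q * x - \<psi> q / 2 * t))"
    unfolding c_def using cell_ratio by (subst ennreal_mult[symmetric]) (auto simp: mult_ac)
  finally have "prob A \<le> 2 * exp (1 / 2) / (1 - cell_ratio) * exp (q * x - \<psi> q / 2 * t)"
    using cell_ratio by (simp add: emeasure_eq_measure ennreal_le_iff)
  moreover have "AE \<omega> in M. \<omega> \<notin> A \<longrightarrow> (\<forall>u\<in>particles (Z \<omega>) t. x \<le> position (Z \<omega>) u t)"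
    using AE_good_noise AE_space
  proof eventually_elim
    case (elim \<omega>)
    show ?case
    proof (intro impI ballI, rule ccontr)
      fix u assume nA: "\<omega> \<notin> A" and u: "u \<in> particles (Z \<omega>) t" and "\<not> x \<le> position (Z \<omega>) u t"
      then have pos: "position (Z \<omega>) u t < x" by simp
      have fin: "birth (Z \<omega>) u < \<infinity>" "enn2real (birth (Z \<omega>) u) \<le> t"
        using u t by (auto simp: particles_def intro: enn2real_leI le_less_trans)
      have "ennreal (exp (\<psi> q / 2 * t - q * x)) \<le> ennreal (exp (\<psi> q / 2 * t - q * position (Z \<omega>) u t))"
        using pos q0 by (intro ennreal_leI) simp
      also have "\<dots> \<le> ?W \<omega> u"
        using \<psi>_pos[OF q0] q0 by (intro weight_ge elim fin) auto
      also have "\<dots> \<le> tot \<omega>"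
        unfolding tot_def using nn_integral_ge_point[of u UNIV "?W \<omega>"] by simp
      finally have "c * ennreal (exp (\<psi> q / 2 * t - q * x)) \<le> c * tot \<omega>"
        by (intro mult_left_mono) auto
      moreover have "c * ennreal (exp (\<psi> q / 2 * t - q * x)) = 1"
        by (simp add: c_def ennreal_mult[symmetric] exp_add[symmetric])
      ultimately show False using nA elim(2) by (simp add: A_def)
    qed
  qed
  ultimately show ?thesis using A by blast
qed

section \<open>Motions and children that stay low\<close>

lemma prob_motion_le_ge_half:
  assumes "0 \<le> s" "0 < y" and small: "s * \<psi> (1 / y) \<le> 1 / 4"
  shows "1 / 2 \<le> prob {\<omega> \<in> space M. motion (Z \<omega>) u s \<le> y}"
proof -
  let ?X = "\<lambda>\<omega>. motion (Z \<omega>) u s"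
  let ?A = "{\<omega> \<in> space M. \<not> ?X \<omega> \<le> y}"
  have [measurable]: "?X \<in> borel_measurable M" using assms(1) by (rule measurable_motion)
  have nonneg: "AE \<omega> in M. 0 \<le> ?X \<omega>"
    using AE_good_noise by eventually_elim (use good_noiseD(3) assms(1) in blast)
  have exp1: "exp (- 1) \<le> (1 / 2 :: real)"
    using exp_ge_add_one_self[of 1] by (simp add: exp_minus inverse_eq_divide field_simps)
  have "integrable M (\<lambda>\<omega>. exp (- (1 / y) * ?X \<omega>))"
    by (rule integrable_const_bound[where B=1])
       (use nonneg assms(2) in \<open>auto elim!: eventually_mono\<close>)
  moreover have "integrable M (\<lambda>\<omega>. 1 - 1 / 2 * indicator ?A \<omega> :: real)"
    by (rule integrable_const_bound[where B=1]) (auto simp: indicator_def)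
  \<comment> \<open>Thus \<open>1 - exp (- X / y)\<close> is at least 1/2 when the motion
    \<open>X\<close> exceeds \<open>y\<close>, whereas its mean is at most
    \<open>s * \<psi> (1 / y)\<close>, hence at most 1/4.\<close>
  moreover have "AE \<omega> in M. exp (- (1 / y) * ?X \<omega>) \<le> 1 - 1 / 2 * indicator ?A \<omega>"
    using nonneg AE_space
  proof eventually_elim
    case (elim \<omega>)
    show ?case
    proof (cases "?X \<omega> \<le> y")
      case True
      then show ?thesis using elim assms(2) by (simp add: indicator_def)
    next
      case False
      then have "exp (- (1 / y) * ?X \<omega>) \<le> exp (- 1)"
        using assms(2) by (simp add: field_simps)
      from order_trans[OF this exp1] show ?thesis using False elim by (simp add: indicator_def)
    qed
  qed
  ultimately have "(\<integral>\<omega>. exp (- (1 / y) * ?X \<omega>) \<partial>M) \<le> (\<integral>\<omega>. 1 - 1 / 2 * indicator ?A \<omega> \<partial>M)"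
    by (rule integral_mono_AE)
  also have "\<dots> = 1 - 1 / 2 * prob ?A"
  proof -
    have "integrable M (indicator ?A :: 'w \<Rightarrow> real)"
      by (rule integrable_real_indicator) (auto simp: emeasure_eq_measure)
    then show ?thesis
      by (subst Bochner_Integration.integral_diff) (auto simp: prob_space)
  qed
  also have "(\<integral>\<omega>. exp (- (1 / y) * ?X \<omega>) \<partial>M) = exp (- s * \<psi> (1 / y))"
  proof -
    have "\<forall>t\<ge>0. \<forall>q\<ge>0. (\<integral>\<omega>. exp (- q * motion (Z \<omega>) u t) \<partial>M) = exp (- t * (0 * q + \<psi> q))"
      using subordinator_motion[of u] unfolding subordinator_def laplace_exponent_def by blast
    from this[rule_format, of s "1 / y"] show ?thesis using assms by simp
  qed
  finally have "1 / 2 * prob ?A \<le> 1 - exp (- s * \<psi> (1 / y))" by simp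
  also have "\<dots> \<le> 1 / 4"
    using exp_ge_add_one_self[of "- s * \<psi> (1 / y)"] small by simp
  finally have "prob ?A \<le> 1 / 2" by simp
  moreover have "prob ?A = 1 - prob {\<omega> \<in> space M. ?X \<omega> \<le> y}"
    by (rule prob_neg) simp
  ultimately show ?thesis by simp
qed

text \<open>Require each of the \<open>k\<close> increments to stay below \<open>y / k\<close>. They
  are independent and identically distributed, and each does so with probability at least
  1/2.\<close>

lemma prob_motion_le:
  assumes k: "0 < k" and "0 \<le> T" "0 < y" and small: "T / real k * \<psi> (1 / (y / real k)) \<le> 1 / 4"
  shows "(1 / 2) ^ k \<le> prob {\<omega> \<in> space M. motion (Z \<omega>) u T \<le> y}"
proof -
  define h where "h = T / real k"
  have h: "0 \<le> h" using assms by (simp add: h_def)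
  define \<tau> where "\<tau> i = real i * h" for i
  have \<tau>: "0 \<le> \<tau> i" for i using h by (simp add: \<tau>_def)
  let ?D = "\<lambda>i \<omega>. motion (Z \<omega>) u (\<tau> (Suc i)) - motion (Z \<omega>) u (\<tau> i)"
  have [measurable]: "(\<lambda>\<omega>. motion (Z \<omega>) u (\<tau> i)) \<in> borel_measurable M" for i
    using \<tau> by (rule measurable_motion)
  have [measurable]: "(\<lambda>\<omega>. motion (Z \<omega>) u T) \<in> borel_measurable M" "(\<lambda>\<omega>. motion (Z \<omega>) u h) \<in> borel_measurable M"
    using assms h by (auto intro: measurable_motion)
  have "mono \<tau>" using h by (auto simp: \<tau>_def mono_def intro!: mult_right_mono)
  then have "indep_vars (\<lambda>_. borel) ?D UNIV"
    using subordinator_motion[of u] \<tau>[of 0] unfolding subordinator_def by blast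
  then have "prob (\<Inter>i\<in>{..<k}. ?D i -` {..y / real k} \<inter> space M) = (\<Prod>i<k. prob (?D i -` {..y / real k} \<inter> space M))"
    by (rule indep_varsD) (use k in auto)
  moreover have "1 / 2 \<le> prob (?D i -` {..y / real k} \<inter> space M)" for i
  proof -
    have "\<tau> (Suc i) = \<tau> i + h" by (simp add: \<tau>_def algebra_simps)
    then have "distr M borel (?D i) = distr M borel (\<lambda>\<omega>. motion (Z \<omega>) u h)"
      using subordinator_motion[of u] \<tau>[of i] h unfolding subordinator_def by auto
    then have "measure (distr M borel (?D i)) {..y / real k} = measure (distr M borel (\<lambda>\<omega>. motion (Z \<omega>) u h)) {..y / real k}"
      by simp
    then have "prob (?D i -` {..y / real k} \<inter> space M) = prob ((\<lambda>\<omega>. motion (Z \<omega>) u h) -` {..y / real k} \<inter> space M)"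
      by (simp add: measure_distr)
    also have "(\<lambda>\<omega>. motion (Z \<omega>) u h) -` {..y / real k} \<inter> space M = {\<omega> \<in> space M. motion (Z \<omega>) u h \<le> y / real k}"
      by auto
    finally show ?thesis
      using prob_motion_le_ge_half[of h "y / real k" u] h assms by (simp add: h_def)
  qed
  ultimately have "(\<Prod>i<k. 1 / 2) \<le> prob (\<Inter>i\<in>{..<k}. ?D i -` {..y / real k} \<inter> space M)"
    by (simp only:) (intro prod_mono, auto)
  also have "\<dots> \<le> prob {\<omega> \<in> space M. motion (Z \<omega>) u T \<le> y}"
  proof (rule finite_measure_mono_AE)
    show "AE \<omega> in M. \<omega> \<in> (\<Inter>i\<in>{..<k}. ?D i -` {..y / real k} \<inter> space M)
        \<longrightarrow> \<omega> \<in> {\<omega> \<in> space M. motion (Z \<omega>) u T \<le> y}"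
      using AE_good_noise AE_space
    proof eventually_elim
      case (elim \<omega>)
      show ?case
      proof
        assume \<omega>: "\<omega> \<in> (\<Inter>i\<in>{..<k}. ?D i -` {..y / real k} \<inter> space M)"
        have "motion (Z \<omega>) u T = motion (Z \<omega>) u (\<tau> k) - motion (Z \<omega>) u (\<tau> 0)"
          using k good_noiseD(1)[OF elim(1)] by (simp add: \<tau>_def h_def)
        also have "\<dots> = (\<Sum>i<k. ?D i \<omega>)" by (rule sum_lessThan_telescope[symmetric])
        also have "\<dots> \<le> (\<Sum>i<k. y / real k)"
          by (intro sum_mono) (use INT_D[OF \<omega>] in simp)
        finally show "\<omega> \<in> {\<omega> \<in> space M. motion (Z \<omega>) u T \<le> y}" using k elim by simp
      qed
    qed
  qed simp
  finally show ?thesis by simp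
qed

text \<open>For a deterministic set \<open>F\<close> of labels the initial particle and its children
  form a fixed family of distinct particles, to which independence applies. \<open>E\<close> will be
  the event that \<open>F\<close> is exactly the set of relevant labels.\<close>

lemma prob_all_children_far:
  fixes F :: "nat set" and T y p :: real
  assumes F: "finite F" and E: "E \<in> sets noise_space" and T: "0 \<le> T"
    and p: "\<And>u. p \<le> prob {\<omega> \<in> space M. motion (Z \<omega>) u T \<le> y}"
  shows "prob {\<omega> \<in> space M. particle_noise (Z \<omega>) [] \<in> E \<and> (\<forall>j\<in>F. y < motion (Z \<omega>) [(j, 1)] T)}
    \<le> prob {\<omega> \<in> space M. particle_noise (Z \<omega>) [] \<in> E} * (1 - p) ^ card F"
proof -
  let ?c = "\<lambda>j :: nat. [(j, 1 :: nat)]"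
  let ?I = "insert [] (?c ` F)"
  let ?V = "\<lambda>v. if v = [] then E else {w \<in> space noise_space. y < fst w T}"
  let ?X = "\<lambda>v \<omega>. particle_noise (Z \<omega>) v"
  have [measurable]: "(\<lambda>w. fst w T) \<in> borel_measurable noise_space" using T by (rule measurable_noise_motion)
  have [measurable]: "(\<lambda>\<omega>. motion (Z \<omega>) u T) \<in> borel_measurable M" for u using T by (rule measurable_motion)
  have far: "?X (?c j) -` ?V (?c j) \<inter> space M = {\<omega> \<in> space M. \<not> motion (Z \<omega>) (?c j) T \<le> y}" for j
    using measurable_space[OF measurable_particle_noise] T by (auto simp: particle_noise_def)
  have root: "?X [] -` ?V [] \<inter> space M = {\<omega> \<in> space M. ?X [] \<omega> \<in> E}" by auto
  have "{\<omega> \<in> space M. ?X [] \<omega> \<in> E \<and> (\<forall>j\<in>F. y < motion (Z \<omega>) (?c j) T)}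
    = (\<Inter>v\<in>?I. ?X v -` ?V v \<inter> space M)"
    using far root by (auto simp: not_le)
  also have "prob \<dots> = (\<Prod>v\<in>?I. prob (?X v -` ?V v \<inter> space M))"
    by (rule indep_varsD[OF indep_particles]) (use F E in auto)
  also have "\<dots> = prob {\<omega> \<in> space M. ?X [] \<omega> \<in> E} * (\<Prod>v\<in>?c ` F. prob (?X v -` ?V v \<inter> space M))"
    using F root by (subst prod.insert) auto
  also have "(\<Prod>v\<in>?c ` F. prob (?X v -` ?V v \<inter> space M)) = (\<Prod>j\<in>F. prob (?X (?c j) -` ?V (?c j) \<inter> space M))"
    by (subst prod.reindex) (auto simp: inj_on_def)
  also have "\<dots> \<le> (\<Prod>j\<in>F. 1 - p)"
  proof (intro prod_mono conjI)
    fix j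
    have "prob {\<omega> \<in> space M. \<not> motion (Z \<omega>) (?c j) T \<le> y} = 1 - prob {\<omega> \<in> space M. motion (Z \<omega>) (?c j) T \<le> y}"
      by (rule prob_neg) simp
    then show "prob (?X (?c j) -` ?V (?c j) \<inter> space M) \<le> 1 - p"
      unfolding far using p[of "?c j"] by simp
  qed simp
  finally show ?thesis by (simp add: mult_left_mono)
qed

text \<open>Given the labels of the early children at distance less than \<open>a\<close>, each of
  them moves too far with probability at most \<open>1 - p\<close>, independently. Their number is
  Poisson of mean \<open>m\<close>, and its generating function at \<open>1 - p\<close> is
  \<open>exp (- m * p)\<close>.\<close>

lemma some_child_stays_close:
  assumes T: "0 \<le> T" and p: "\<And>u. p \<le> prob {\<omega> \<in> space M. motion (Z \<omega>) u T \<le> y}"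
  shows "\<exists>A\<in>events. prob A \<le> exp (- measure (mu \<theta>) {z. z < a} * p) \<and>
    (\<forall>\<omega>\<in>space M - A. \<exists>j. age (Z \<omega>) [] j \<le> 1 \<and> mark (Z \<omega>) [] j 1 < ennreal a \<and>
       motion (Z \<omega>) [(j, 1)] T \<le> y)"
proof -
  define B where "B = {0..1::real} \<times> {x \<in> Q_space. x 1 < ennreal a}"
  define m where "m = measure (mu \<theta>) {z. z < a}"
  have "{x \<in> space Q_borel. x 1 < ennreal a} \<in> sets Q_borel" by measurable
  then have S: "{x \<in> Q_space. x 1 < ennreal a} \<in> sets Q_borel" by simp
  have B[measurable]: "B \<in> sets \<mu>" "B \<in> sets (borel \<Otimes>\<^sub>M Q_borel)" using S by (auto simp: B_def)
  have "emeasure \<mu> B = emeasure lborel ({0..} \<inter> {0..1::real}) * emeasure (mu \<theta>) {z. z < a}"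
  proof -
    have "{z. z < a \<and> birth_mark z \<in> {x \<in> Q_space. x 1 < ennreal a}} = {z. z < a}"
      using a_pos birth_mark_in_Q_space by (auto simp: birth_mark_def intro: ennreal_lessI)
    then show ?thesis
      unfolding B_def using emeasure_intensity_Times[OF a_pos _ _ S, of \<theta> "{0..1}" \<alpha>] theta by simp
  qed
  also have "{0..} \<inter> {0..1::real} = {0..1}" by auto
  finally have eB: "emeasure \<mu> B = emeasure (mu \<theta>) {z. z < a}" by simp
  then have fB: "emeasure \<mu> B < \<infinity>" and mB: "measure \<mu> B = m"
    using emeasure_mu_lessThan_finite[of a \<theta>] a_pos theta by (auto simp: m_def measure_def)
  define J where "J w = {j. fst (snd w j) < \<infinity> \<and> (enn2real (fst (snd w j)), snd (snd w j)) \<in> B}"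
    for w :: "(real \<Rightarrow> real) \<times> (nat \<Rightarrow> ennreal \<times> qseq)"
  let ?R = "\<lambda>\<omega>. particle_noise (Z \<omega>) []"
  have count: "npoints [] B \<omega> = emeasure (count_space UNIV) (J (?R \<omega>))" for \<omega>
    by (simp add: point_count_def J_def particle_noise_def)
  have [measurable]: "npoints [] B \<in> borel_measurable M" by (rule measurable_npoints) (rule B)
  have [measurable]: "(\<lambda>w. (enn2real (fst (snd w j)), snd (snd w j))) \<in> noise_space \<rightarrow>\<^sub>M borel \<Otimes>\<^sub>M Q_borel" for j
    by measurable
  have JE: "{w \<in> space noise_space. J w = F} \<in> sets noise_space" for F
  proof -
    have eq: "{w \<in> space noise_space. J w = F} = {w \<in> space noise_space. \<forall>j.
      (fst (snd w j) < \<infinity> \<and> (enn2real (fst (snd w j)), snd (snd w j)) \<in> B) = (j \<in> F)}"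
      by (auto simp: J_def)
    show ?thesis unfolding eq by measurable
  qed
  have [measurable]: "(\<lambda>\<omega>. motion (Z \<omega>) u T) \<in> borel_measurable M" for u
    using T by (rule measurable_motion)
  have [measurable]: "(\<lambda>\<omega>. (enn2real (age (Z \<omega>) u j), mark (Z \<omega>) u j)) \<in> M \<rightarrow>\<^sub>M borel \<Otimes>\<^sub>M Q_borel" for u j
    by measurable
  have JR: "j \<in> J (?R \<omega>) \<longleftrightarrow> age (Z \<omega>) [] j < \<infinity> \<and> (enn2real (age (Z \<omega>) [] j), mark (Z \<omega>) [] j) \<in> B" for j \<omega>
    by (simp add: J_def particle_noise_def)
  define A where "A = {\<omega> \<in> space M. \<forall>j\<in>J (?R \<omega>). y < motion (Z \<omega>) [(j, 1)] T}"
  have A_eq: "A = {\<omega> \<in> space M. \<forall>j. age (Z \<omega>) [] j < \<infinity> \<and> (enn2real (age (Z \<omega>) [] j), mark (Z \<omega>) [] j) \<in> B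
      \<longrightarrow> y < motion (Z \<omega>) [(j, 1)] T}"
    by (auto simp: A_def JR)
  have A[measurable]: "A \<in> events" unfolding A_eq by measurable
  let ?N = "\<lambda>k. {\<omega> \<in> space M. npoints [] B \<omega> = of_nat k}"
  have p1: "p \<le> 1" using p[of "[]"] prob_le_1 order_trans by blast
  have bound: "prob (A \<inter> ?N k) \<le> prob (?N k) * (1 - p) ^ k" for k
  proof -
    \<comment> \<open>There are only countably many finite sets of labels, and \<open>J = F\<close>
      is an event of the noise of the initial particle.\<close>
    let ?I = "{F :: nat set. finite F \<and> card F = k}"
    let ?E = "\<lambda>F. {\<omega> \<in> space M. ?R \<omega> \<in> {w \<in> space noise_space. J w = F}}"
    have E[measurable]: "?E F \<in> events" for F
      using measurable_sets[OF measurable_particle_noise JE, of "[]" F]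
      by (simp add: vimage_def Int_def conj_commute)
    have cI: "countable ?I"
      by (rule countable_subset[OF _ countable_Collect_finite]) auto
    have E_eq: "?E F = {\<omega> \<in> space M. J (?R \<omega>) = F}" for F
      using measurable_space[OF measurable_particle_noise] by auto
    have NE: "?N k = (\<Union>F\<in>?I. ?E F)"
      unfolding E_eq by (auto simp: count emeasure_count_space split: if_splits)
    have disj: "disjoint_family_on ?E ?I" "disjoint_family_on (\<lambda>F. A \<inter> ?E F) ?I"
      unfolding E_eq by (auto simp: disjoint_family_on_def)
    have "emeasure M (A \<inter> ?N k) = emeasure M (\<Union>F\<in>?I. A \<inter> ?E F)" by (simp only: NE Int_UN_distrib)
    also have "\<dots> = (\<integral>\<^sup>+F. emeasure M (A \<inter> ?E F) \<partial>count_space ?I)"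
      by (intro emeasure_UN_countable sets.Int A E cI disj)
    also have "\<dots> \<le> (\<integral>\<^sup>+F. emeasure M (?E F) * ennreal ((1 - p) ^ k) \<partial>count_space ?I)"
    proof (intro nn_integral_mono)
      fix F assume "F \<in> space (count_space ?I)"
      then have F: "finite F" "card F = k" by auto
      have "A \<inter> ?E F = {\<omega> \<in> space M. ?R \<omega> \<in> {w \<in> space noise_space. J w = F} \<and> (\<forall>j\<in>F. y < motion (Z \<omega>) [(j, 1)] T)}"
        by (auto simp: A_def)
      then have "prob (A \<inter> ?E F) \<le> prob (?E F) * (1 - p) ^ k"
        using prob_all_children_far[OF F(1) JE T p, of F] F(2) by simp
      then show "emeasure M (A \<inter> ?E F) \<le> emeasure M (?E F) * ennreal ((1 - p) ^ k)"
        using p1 by (simp add: emeasure_eq_measure ennreal_mult[symmetric] ennreal_leI)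
    qed
    also have "\<dots> = (\<integral>\<^sup>+F. emeasure M (?E F) \<partial>count_space ?I) * ennreal ((1 - p) ^ k)"
      by (rule nn_integral_multc) auto
    also have "(\<integral>\<^sup>+F. emeasure M (?E F) \<partial>count_space ?I) = emeasure M (\<Union>F\<in>?I. ?E F)"
      by (intro emeasure_UN_countable[symmetric] E cI disj)
    also have "\<dots> = emeasure M (?N k)" unfolding NE ..
    finally show ?thesis
      using p1 by (simp add: emeasure_eq_measure ennreal_mult[symmetric] ennreal_le_iff)
  qed
  have PN: "prob (?N k) = exp (- m) * m ^ k / fact k" for k
    using prob_npoints[OF B(1) fB] by (simp add: mB)
  \<comment> \<open>Infinitely many points occur with probability 0, so splitting by the count loses
    nothing.\<close>
  have "prob A = prob (\<Union>k. A \<inter> ?N k)"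
  proof (rule finite_measure_eq_AE)
    show "AE \<omega> in M. (\<omega> \<in> A) = (\<omega> \<in> (\<Union>k. A \<inter> ?N k))"
      using poisson_AE_of_nat[OF measurable_npoints[OF B(1)] PN] AE_space by eventually_elim auto
  qed measurable
  also have "\<dots> \<le> exp (- m * (1 - (1 - p)))"
  proof (rule sums_le)
    show "(\<lambda>k. prob (A \<inter> ?N k)) sums prob (\<Union>k. A \<inter> ?N k)"
      by (rule finite_measure_UNION) (auto simp: disjoint_family_on_def)
    show "(\<lambda>k. (exp (- m) * m ^ k / fact k) * (1 - p) ^ k) sums exp (- m * (1 - (1 - p)))"
      by (rule poisson_gf_sums)
    show "prob (A \<inter> ?N k) \<le> (exp (- m) * m ^ k / fact k) * (1 - p) ^ k" for k
      using bound[of k] by (simp only: PN)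
  qed
  finally have "prob A \<le> exp (- m * p)" by simp
  moreover have "\<exists>j. age (Z \<omega>) [] j \<le> 1 \<and> mark (Z \<omega>) [] j 1 < ennreal a \<and> motion (Z \<omega>) [(j, 1)] T \<le> y"
    if \<omega>: "\<omega> \<in> space M - A" for \<omega>
  proof -
    obtain j where j: "age (Z \<omega>) [] j < \<infinity>" "(enn2real (age (Z \<omega>) [] j), mark (Z \<omega>) [] j) \<in> B"
      "motion (Z \<omega>) [(j, 1)] T \<le> y"
      using \<omega> by (auto simp: A_eq not_less)
    have "age (Z \<omega>) [] j = ennreal (enn2real (age (Z \<omega>) [] j))" using j(1) by simp
    also have "\<dots> \<le> ennreal 1" using j(2) by (intro ennreal_leI) (auto simp: B_def)
    finally have "age (Z \<omega>) [] j \<le> 1" by simp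
    then show ?thesis using j by (auto simp: B_def)
  qed
  ultimately show ?thesis using A unfolding m_def by blast
qed

text \<open>A child born before time 1 starts at most \<open>a\<close> above the initial particle at
  time 1. The position of the latter is not estimated: it is the same at all levels and becomes the
  constant \<open>R\<close> of \<open>ratio_bounds\<close>.\<close>

lemma late_leftmost:
  assumes T: "0 \<le> T" and p: "\<And>u. p \<le> prob {\<omega> \<in> space M. motion (Z \<omega>) u T \<le> y}"
  shows "\<exists>A\<in>events. prob A \<le> exp (- measure (mu \<theta>) {z. z < a} * p) \<and>
    (AE \<omega> in M. \<omega> \<notin> A \<longrightarrow> (\<exists>u. birth (Z \<omega>) u \<le> 1 \<and>
      (\<forall>t. 1 \<le> t \<longrightarrow> t \<le> T \<longrightarrow> position (Z \<omega>) u t \<le> position (Z \<omega>) [] 1 + a + y)))"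
proof -
  obtain A where A: "A \<in> events" "prob A \<le> exp (- measure (mu \<theta>) {z. z < a} * p)"
    "\<And>\<omega>. \<omega> \<in> space M - A \<Longrightarrow> \<exists>j. age (Z \<omega>) [] j \<le> 1 \<and> mark (Z \<omega>) [] j 1 < ennreal a \<and>
       motion (Z \<omega>) [(j, 1)] T \<le> y"
    using some_child_stays_close[OF T p] by metis
  have "AE \<omega> in M. \<omega> \<notin> A \<longrightarrow> (\<exists>u. birth (Z \<omega>) u \<le> 1 \<and>
      (\<forall>t. 1 \<le> t \<longrightarrow> t \<le> T \<longrightarrow> position (Z \<omega>) u t \<le> position (Z \<omega>) [] 1 + a + y))"
    using AE_good_noise AE_space
  proof eventually_elim
    case (elim \<omega>)
    show ?case
    proof
      assume "\<omega> \<notin> A"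
      then obtain j where j: "age (Z \<omega>) [] j \<le> 1" "mark (Z \<omega>) [] j 1 < ennreal a"
        "motion (Z \<omega>) [(j, 1)] T \<le> y"
        using A(3) elim(2) by blast
      let ?u = "[(j, 1 :: nat)]" and ?z = "Z \<omega>"
      have mfin: "mark ?z [] j 1 < \<infinity>" using j(2) by (rule less_trans) simp
      then have b: "birth ?z ?u = age ?z [] j" by simp
      then have bfin: "birth ?z ?u < \<infinity>" using j(1) by (auto intro: le_less_trans)
      note bc = birth_Cons_finite[OF elim(1) bfin]
      let ?b = "enn2real (birth ?z ?u)"
      have b1: "?b \<le> 1" using j(1) b by (intro enn2real_leI) auto
      have b0: "0 < ?b" using bc(5) b by simp
      have mono: "mono_on {0..} (position ?z [])"
        using position_mono_nonneg[OF elim(1), of "[]"] by simp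
      have "start ?z ?u \<le> position ?z [] ?b + enn2real (mark ?z [] j 1)"
        using Lim_at_left_le[OF mono b0] by simp
      also have "position ?z [] ?b \<le> position ?z [] 1"
        using b0 b1 by (intro position_mono[OF elim(1)]) auto
      also have "enn2real (mark ?z [] j 1) \<le> a"
        using j(2) a_pos by (intro enn2real_leI) auto
      finally have s: "start ?z ?u \<le> position ?z [] 1 + a" by simp
      have "position ?z ?u t \<le> position ?z [] 1 + a + y" if "1 \<le> t" "t \<le> T" for t
      proof -
        have "position ?z ?u t = start ?z ?u + motion ?z ?u (t - ?b)"
          using b1 that by (intro position_after_birth[OF elim(1)]) simp
        also have "motion ?z ?u (t - ?b) \<le> motion ?z ?u T"
          using b0 b1 that by (intro good_noiseD(2)[OF elim(1)]) auto
        finally show ?thesis using s j(3) by simp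
      qed
      then show "\<exists>u. birth (Z \<omega>) u \<le> 1 \<and>
        (\<forall>t. 1 \<le> t \<longrightarrow> t \<le> T \<longrightarrow> position (Z \<omega>) u t \<le> position (Z \<omega>) [] 1 + a + y)"
        using j(1) b by (intro exI[of _ ?u]) auto
    qed
  qed
  then show ?thesis using A by blast
qed

end

section \<open>Almost sure bounds\<close>

text \<open>The first identity makes \<open>T * \<psi> q\<close> of order
  \<open>N powr \<theta>\<close> when \<open>q\<close> is of order
  \<open>N powr (\<theta> - 1)\<close>. The second shows that about \<open>N powr \<theta>\<close>
  pieces suffice to keep a motion below \<open>N\<close> up to a time of the same order.\<close>

lemma powr_laplace_exponents:
  fixes \<alpha> \<theta> x :: real
  assumes "0 < x"
  shows "(x powr (\<theta> - 1)) powr \<alpha> * x powr (\<alpha> + (1 - \<alpha>) * \<theta>) = x powr \<theta>"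
    and "x powr (\<alpha> + (1 - \<alpha>) * \<theta>) * x powr (- \<alpha>) = (x powr \<theta>) powr (1 - \<alpha>)"
  using assms by (auto simp: powr_powr powr_add[symmetric] algebra_simps)

lemma (in truncated_noise) lower_event:
  assumes aN: "a = real N" and N: "1 \<le> N"
    and small: "exp 1 / (\<psi> 1 * (2 * real N powr (\<theta> - 1))) / (1 - cell_ratio) / (1 - cell_ratio) \<le> 1 / 2"
  shows "\<exists>A\<in>events. prob A \<le> 2 * exp (1 / 2) / (1 - cell_ratio) * exp (- real N) \<and>
    (AE \<omega> in M. \<omega> \<notin> A \<longrightarrow> (\<forall>u\<in>particles (Z \<omega>) (6 / \<psi> 1 * real N powr (\<alpha> + (1 - \<alpha>) * \<theta>)).
      real N \<le> position (Z \<omega>) u (6 / \<psi> 1 * real N powr (\<alpha> + (1 - \<alpha>) * \<theta>))))"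
proof -
  define n where "n = real N"
  have n: "1 \<le> n" using N by (simp add: n_def)
  have c0: "0 < \<psi> 1" by (rule \<psi>_pos) simp
  define q where "q = 2 * n powr (\<theta> - 1)"
  have "1 \<le> n powr (\<theta> - 1)" using n theta by (intro ge_one_powr_ge_zero) auto
  then have q2: "2 \<le> q" by (simp add: q_def)
  have q1: "1 \<le> q powr \<alpha>" using q2 alpha by (intro ge_one_powr_ge_zero) auto
  have \<psi>q: "\<psi> q = \<psi> 1 * q powr \<alpha>" using q2 by (intro \<psi>_scaling) simp
  define T where "T = 6 / \<psi> 1 * n powr (\<alpha> + (1 - \<alpha>) * \<theta>)"
  have T: "0 \<le> T" using c0 by (simp add: T_def)
  \<comment> \<open>Replacing \<open>\<psi> q\<close> by the smaller \<open>\<psi> 1\<close> turns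
    the smallness condition into the explicit hypothesis on \<open>N\<close>.\<close>
  have "\<psi> 1 * q \<le> \<psi> q * q"
    using q1 q2 c0 by (simp add: \<psi>q)
  then have "exp 1 / (\<psi> q * q) \<le> exp 1 / (\<psi> 1 * q)"
    using c0 q2 by (intro divide_left_mono mult_pos_pos) (auto intro: \<psi>_pos)
  then have "exp 1 / (\<psi> q * q) / (1 - cell_ratio) / (1 - cell_ratio) \<le> exp 1 / (\<psi> 1 * q) / (1 - cell_ratio) / (1 - cell_ratio)"
    using cell_ratio by (intro divide_right_mono) auto
  also have "\<dots> \<le> 1 / 2" using small unfolding q_def n_def .
  finally have small': "exp 1 / (\<psi> q * q) / (1 - cell_ratio) / (1 - cell_ratio) \<le> 1 / 2" .
  have "2 * a powr (\<theta> - 1) \<le> q" by (simp add: q_def n_def aN)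
  from early_particles[OF this small' T, of n] obtain A where A: "A \<in> events"
    "prob A \<le> 2 * exp (1 / 2) / (1 - cell_ratio) * exp (q * n - \<psi> q / 2 * T)"
    "AE \<omega> in M. \<omega> \<notin> A \<longrightarrow> (\<forall>u\<in>particles (Z \<omega>) T. n \<le> position (Z \<omega>) u T)"
    by blast
  have "q * n = 2 * n powr \<theta>"
    using n powr_add[of n "\<theta> - 1" 1] by (simp add: q_def)
  moreover have "3 * n powr \<theta> \<le> \<psi> q / 2 * T"
  proof -
    have "\<psi> q / 2 * T = 3 * 2 powr \<alpha> * ((n powr (\<theta> - 1)) powr \<alpha> * n powr (\<alpha> + (1 - \<alpha>) * \<theta>))"
    proof -
      have "q powr \<alpha> = 2 powr \<alpha> * (n powr (\<theta> - 1)) powr \<alpha>" by (simp add: q_def powr_mult)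
      then show ?thesis unfolding \<psi>q T_def using c0 by (simp add: field_simps)
    qed
    also have "\<dots> = 3 * 2 powr \<alpha> * n powr \<theta>"
      using n by (subst powr_laplace_exponents(1)) auto
    finally show ?thesis
      using mult_left_mono[OF ge_one_powr_ge_zero[of 2 \<alpha>], of "3 * n powr \<theta>"] alpha by simp
  qed
  \<comment> \<open>The time decay exceeds the level cost \<open>q * n\<close> by at least
    \<open>n powr \<theta>\<close>; its linear lower bound is enough for summability.\<close>
  moreover have "n \<le> n powr \<theta>"
    using n theta powr_mono[of 1 \<theta> n] by simp
  ultimately have "q * n - \<psi> q / 2 * T \<le> - n" by linarith
  then have "2 * exp (1 / 2) / (1 - cell_ratio) * exp (q * n - \<psi> q / 2 * T) \<le> 2 * exp (1 / 2) / (1 - cell_ratio) * exp (- n)"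
    using cell_ratio by (intro mult_left_mono) auto
  with A(2) have "prob A \<le> 2 * exp (1 / 2) / (1 - cell_ratio) * exp (- n)" by (rule order_trans)
  then show ?thesis using A(1,3) unfolding T_def n_def by (intro bexI[of _ A] conjI)
qed

text \<open>The constant \<open>\<kappa>\<close> is chosen such that, after replacing
  \<open>k\<close> by its lower bound
  \<open>v / 2 = n powr \<theta> / 2 powr (\<theta> + 1)\<close>, the condition of
  \<open>prob_motion_le\<close> holds with equality.\<close>

lemma (in truncated_noise) upper_event:
  assumes aN: "a = real N" and N: "2 \<le> N"
  defines "\<kappa> \<equiv> 1 / (4 * \<psi> 1 * (2 powr (\<theta> + 1)) powr (1 - \<alpha>))"
  shows "\<exists>A\<in>events. prob A \<le> exp (- real N / 4) \<and>
    (AE \<omega> in M. \<omega> \<notin> A \<longrightarrow> (\<exists>u. birth (Z \<omega>) u \<le> 1 \<and>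
      (\<forall>t. 1 \<le> t \<longrightarrow> t \<le> \<kappa> * real N powr (\<alpha> + (1 - \<alpha>) * \<theta>) \<longrightarrow>
        position (Z \<omega>) u t \<le> position (Z \<omega>) [] 1 + 2 * real N)))"
proof -
  define n where "n = real N"
  have n: "2 \<le> n" using N by (simp add: n_def)
  have c0: "0 < \<psi> 1" by (rule \<psi>_pos) simp
  have \<kappa>: "0 < \<kappa>" using c0 by (simp add: \<kappa>_def)
  define T where "T = \<kappa> * n powr (\<alpha> + (1 - \<alpha>) * \<theta>)"
  have T: "0 \<le> T" using \<kappa> by (simp add: T_def)
  \<comment> \<open>For \<open>n \<ge> 2\<close> one has \<open>n / 2 \<le> n - 1\<close>, so
    \<open>exp v\<close> is a lower bound for the mean number of children. With \<open>k\<close>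
    near \<open>v / 2\<close>, the price \<open>(1 / 2) ^ k \<ge> exp (- k)\<close> uses up only
    half of this exponent.\<close>
  define v where "v = (n / 2) powr \<theta>"
  have v: "n / 2 \<le> v"
    using n theta powr_mono[of 1 \<theta> "n / 2"] by (simp add: v_def)
  define k where "k = nat \<lceil>v / 2\<rceil>"
  have k: "v / 2 \<le> real k" "real k \<le> v / 2 + 1" "0 < k"
    using v n by (auto simp: k_def)
  have small: "T / real k * \<psi> (1 / (n / real k)) \<le> 1 / 4"
  proof -
    have "\<psi> (1 / (n / real k)) = \<psi> 1 * (real k powr \<alpha> * n powr (- \<alpha>))"
      using n k by (subst \<psi>_scaling) (auto simp: powr_divide powr_minus_divide)
    then have "T / real k * \<psi> (1 / (n / real k))
        = \<kappa> * \<psi> 1 * (n powr (\<alpha> + (1 - \<alpha>) * \<theta>) * n powr (- \<alpha>)) * (real k powr \<alpha> / real k)"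
      by (simp add: T_def)
    also have "real k powr \<alpha> / real k = 1 / real k powr (1 - \<alpha>)"
      using k by (simp add: powr_diff)
    also have "n powr (\<alpha> + (1 - \<alpha>) * \<theta>) * n powr (- \<alpha>) = (n powr \<theta>) powr (1 - \<alpha>)"
      using n by (intro powr_laplace_exponents(2)) simp
    also have "\<kappa> * \<psi> 1 * (n powr \<theta>) powr (1 - \<alpha>) * (1 / real k powr (1 - \<alpha>))
        \<le> \<kappa> * \<psi> 1 * (n powr \<theta>) powr (1 - \<alpha>) * (1 / (v / 2) powr (1 - \<alpha>))"
      using \<kappa> c0 k v n alpha
      by (intro mult_left_mono divide_left_mono powr_mono2) auto
    also have "v / 2 = n powr \<theta> / 2 powr (\<theta> + 1)"
      using n by (simp add: v_def powr_divide powr_add)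
    also have "(n powr \<theta> / 2 powr (\<theta> + 1)) powr (1 - \<alpha>) = (n powr \<theta>) powr (1 - \<alpha>) / (2 powr (\<theta> + 1)) powr (1 - \<alpha>)"
      by (rule powr_divide)
    also have "\<kappa> * \<psi> 1 * (n powr \<theta>) powr (1 - \<alpha>) * (1 / ((n powr \<theta>) powr (1 - \<alpha>) / (2 powr (\<theta> + 1)) powr (1 - \<alpha>)))
        = 1 / 4"
      using n c0 by (simp add: \<kappa>_def)
    finally show ?thesis .
  qed
  have n0: "0 < n" using n by simp
  obtain A where A: "A \<in> events" "prob A \<le> exp (- measure (mu \<theta>) {z. z < a} * (1 / 2) ^ k)"
    "AE \<omega> in M. \<omega> \<notin> A \<longrightarrow> (\<exists>u. birth (Z \<omega>) u \<le> 1 \<and>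
      (\<forall>t. 1 \<le> t \<longrightarrow> t \<le> T \<longrightarrow> position (Z \<omega>) u t \<le> position (Z \<omega>) [] 1 + a + n))"
    using late_leftmost[OF T prob_motion_le[OF k(3) T n0 small]] by blast
  have "exp v \<le> measure (mu \<theta>) {z. z < a}"
  proof -
    have "ennreal (exp v) \<le> ennreal (exp ((a - 1) powr \<theta>))"
      using n theta by (auto simp: v_def aN n_def intro!: ennreal_leI powr_mono2)
    also have "\<dots> \<le> emeasure (mu \<theta>) {z. z < a}"
      using n theta by (intro emeasure_mu_lessThan_ge) (auto simp: aN n_def)
    also have "\<dots> = ennreal (measure (mu \<theta>) {z. z < a})"
      using emeasure_mu_lessThan_finite[of a \<theta>] a_pos theta by (intro emeasure_eq_ennreal_measure) auto
    finally show ?thesis by (simp add: ennreal_le_iff)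
  qed
  moreover have "exp (- (v / 2 + 1)) \<le> (1 / 2) ^ k"
  proof -
    have "exp (- (v / 2 + 1)) \<le> exp (- real k)" using k by simp
    also have "\<dots> = exp (- 1) ^ k" by (simp add: exp_of_nat_mult[symmetric])
    also have "\<dots> \<le> (1 / 2) ^ k"
      using exp_ge_add_one_self[of 1] by (intro power_mono) (auto simp: exp_minus inverse_eq_divide field_simps)
    finally show ?thesis .
  qed
  ultimately have "exp v * exp (- (v / 2 + 1)) \<le> measure (mu \<theta>) {z. z < a} * (1 / 2) ^ k"
    by (intro mult_mono) auto
  moreover have "n / 4 \<le> exp v * exp (- (v / 2 + 1))"
  proof -
    have "n / 4 \<le> 1 + (v / 2 - 1)" using v by simp
    also have "\<dots> \<le> exp (v / 2 - 1)" by (rule exp_ge_add_one_self)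
    also have "\<dots> = exp v * exp (- (v / 2 + 1))" by (simp add: exp_add[symmetric])
    finally show ?thesis .
  qed
  ultimately have "n / 4 \<le> measure (mu \<theta>) {z. z < a} * (1 / 2) ^ k" by linarith
  then have "exp (- measure (mu \<theta>) {z. z < a} * (1 / 2) ^ k) \<le> exp (- n / 4)" by simp
  with A(2) have "prob A \<le> exp (- n / 4)" by (rule order_trans)
  moreover have e: "x + a + n = x + 2 * real N" for x by (simp add: aN n_def)
  ultimately show ?thesis using A(1) A(3)[unfolded e T_def] unfolding n_def by (intro bexI[of _ A] conjI)
qed

section \<open>From single levels to all large times\<close>

lemma (in prob_space) borel_cantelli_exists:
  assumes ev: "\<forall>\<^sub>F n in sequentially. \<exists>A\<in>events. prob A \<le> f n \<and> (AE \<omega> in M. \<omega> \<notin> A \<longrightarrow> P n \<omega>)"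
    and f: "summable f"
  shows "AE \<omega> in M. \<forall>\<^sub>F n in sequentially. P n \<omega>"
proof -
  obtain n0 where n0: "\<And>n. n0 \<le> n \<Longrightarrow> \<exists>A\<in>events. prob A \<le> f n \<and> (AE \<omega> in M. \<omega> \<notin> A \<longrightarrow> P n \<omega>)"
    using ev by (auto simp: eventually_sequentially)
  then obtain A where A: "\<And>n. n0 \<le> n \<Longrightarrow> A n \<in> events \<and> prob (A n) \<le> f n \<and> (AE \<omega> in M. \<omega> \<notin> A n \<longrightarrow> P n \<omega>)"
    by metis
  \<comment> \<open>The events are available from \<open>n0\<close> on only; shifting the index
    gives a full sequence for the Borel-Cantelli lemma.\<close>
  define B where "B n = A (n + n0)" for n
  have "summable (\<lambda>n. f (n + n0))" using f by (rule summable_ignore_initial_segment)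
  then have "summable (\<lambda>n. prob (B n))"
    by (rule summable_comparison_test') (use A in \<open>auto simp: B_def\<close>)
  then have "AE \<omega> in M. \<forall>\<^sub>F n in sequentially. \<omega> \<in> space M - B n"
    by (intro borel_cantelli_AE1) (use A in \<open>auto simp: B_def emeasure_eq_measure\<close>)
  moreover have "AE \<omega> in M. \<forall>n. \<omega> \<notin> B n \<longrightarrow> P (n + n0) \<omega>"
    unfolding AE_all_countable B_def using A by simp
  ultimately show ?thesis
  proof eventually_elim
    case (elim \<omega>)
    have "\<forall>\<^sub>F n in sequentially. P (n + n0) \<omega>"
      using elim(1) by eventually_elim (use elim(2) in auto)
    then show ?case by (rule eventually_sequentially_seg[THEN iffD1])
  qed
qed

lemma summable_exp_neg:
  fixes c :: real
  assumes "0 < c"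
  shows "summable (\<lambda>n. exp (- real n * c))"
proof -
  have "summable (\<lambda>n. exp (- c) ^ n)"
    using assms by (intro summable_geometric) simp
  then show ?thesis by (simp add: exp_of_nat_mult[symmetric] mult.commute)
qed

text \<open>Deterministic transfer between level \<open>N\<close> and the whole system. A particle
  of some higher level below \<open>x \<le> N\<close> at time \<open>t\<close> has an ancestor below
  \<open>x\<close> at time \<open>s\<close>, and that ancestor is kept at level \<open>N\<close>.
  Conversely, every particle of level \<open>N\<close> takes part in the infimum.\<close>

lemma leftmost_bounds:
  fixes z :: "real \<Rightarrow> noise"
  assumes removal: "\<And>a a'. a\<^sub>0 < a \<Longrightarrow> a \<le> a' \<Longrightarrow> obtained_by_removal a (z a) (z a')"
    and good: "\<And>N. a\<^sub>0 < real N \<Longrightarrow> good_noise (z (real N))"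
    and N: "a\<^sub>0 < real N"
  shows leftmost_ge: "\<And>s t x. 0 \<le> s \<Longrightarrow> s \<le> t \<Longrightarrow> x \<le> real N \<Longrightarrow>
      (\<forall>u\<in>particles (z (real N)) s. x \<le> position (z (real N)) u s) \<Longrightarrow> x \<le> leftmost a\<^sub>0 z t"
    and leftmost_le: "\<And>t u. 0 \<le> t \<Longrightarrow> u \<in> particles (z (real N)) t \<Longrightarrow>
      leftmost a\<^sub>0 z t \<le> position (z (real N)) u t"
    and root_position: "\<And>t. 0 \<le> t \<Longrightarrow> position (z (real N)) [] t = limit_position z [] t"
proof -
  have limit: "limit_position z u t = position (z a) u t"
    if "a\<^sub>0 < a" "0 \<le> t" "u \<in> particles (z a) t" for a u t
  proof -
    have "\<forall>\<^sub>F a' in at_top. position (z a') u t = position (z a) u t"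
      using eventually_ge_at_top[of a]
    proof eventually_elim
      case (elim a')
      then show ?case using removal[OF that(1) elim] that(2,3) by (auto simp: obtained_by_removal_def)
    qed
    then show ?thesis
      unfolding limit_position_def by (intro tendsto_Lim tendsto_eventually) auto
  qed
  have root: "[] \<in> particles w t" for w t by (simp add: particles_def)
  have fin: "birth w u < \<infinity>" if "u \<in> particles w t" for w u t
    using that unfolding particles_def by (auto intro: le_less_trans)
  have move: "u \<in> particles (z a') t" "position (z a') u t = position (z a) u t"
    if "a\<^sub>0 < a" "a \<le> a'" "0 \<le> t" "u \<in> particles (z a) t" for a a' u t
    using removal[OF that(1,2)] that(3,4) by (auto simp: obtained_by_removal_def)
  have large: "\<exists>N'\<ge>N. u \<in> particles (z (real N')) t \<and> limit_position z u t = position (z (real N')) u t"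
    if "0 \<le> t" and u: "u \<in> all_particles a\<^sub>0 z t" for u t
  proof -
    obtain a where a: "a\<^sub>0 < a" "u \<in> particles (z a) t"
      using u by (auto simp: all_particles_def)
    \<comment> \<open>Good noise is assumed at integer levels, so a real level is raised to an
      integer one, at least \<open>N\<close>.\<close>
    define N' where "N' = max N (nat \<lceil>a\<rceil>)"
    have "a \<le> real N'" unfolding N'_def by linarith
    then have "u \<in> particles (z (real N')) t" using move(1)[OF a(1) _ that(1) a(2)] by blast
    moreover have "a\<^sub>0 < real N'" using a(1) \<open>a \<le> real N'\<close> by linarith
    ultimately have "limit_position z u t = position (z (real N')) u t"
      using that(1) by (intro limit)
    then show ?thesis using \<open>u \<in> particles (z (real N')) t\<close> by (intro exI[of _ N']) (auto simp: N'_def)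
  qed
  have nonempty: "all_particles a\<^sub>0 z t \<noteq> {}" for t
    using root N by (auto simp: all_particles_def)
  show "x \<le> leftmost a\<^sub>0 z t"
    if s: "0 \<le> s" "s \<le> t" and x: "x \<le> real N"
      and far: "\<forall>u\<in>particles (z (real N)) s. x \<le> position (z (real N)) u s" for s t x
    unfolding leftmost_def
  proof (rule cINF_greatest[OF nonempty], rule ccontr)
    fix u assume u: "u \<in> all_particles a\<^sub>0 z t" and less: "\<not> x \<le> limit_position z u t"
    obtain N' where N': "N \<le> N'" "u \<in> particles (z (real N')) t"
      "limit_position z u t = position (z (real N')) u t"
      using large[OF _ u] s by auto
    have g: "good_noise (z (real N'))" using good[of N'] N N'(1) by simp
    obtain v where v: "v \<in> particles (z (real N')) s" "birth (z (real N')) v < \<infinity>"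
      "position (z (real N')) v s = position (z (real N')) u s"
      using ancestor_at_time[OF fin[OF N'(2)] s(1)] by blast
    have "position (z (real N')) u s \<le> position (z (real N')) u t"
      by (rule position_mono[OF g fin[OF N'(2)] s])
    then have vx: "position (z (real N')) v s < x" using v N'(3) less by simp
    have "enn2real (birth (z (real N')) v) \<le> s"
      using v(1) s(1) by (auto simp: particles_def intro: enn2real_leI)
    from kept_if_position_less[OF g v(2) this, of "real N"] have "kept (real N) (z (real N')) v"
      using vx x by simp
    then have "v \<in> particles (z (real N)) s"
      using removal[OF N, of "real N'"] N'(1) v(1) s(1) by (auto simp: obtained_by_removal_def)
    with move(2)[OF N _ s(1) this, of "real N'"] N'(1) far vx show False by fastforce
  qed
  show "leftmost a\<^sub>0 z t \<le> position (z (real N)) u t"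
    if t: "0 \<le> t" and u: "u \<in> particles (z (real N)) t" for t u
  proof -
    \<comment> \<open>An infimum of reals is a lower bound only for a set bounded below; here 0
      bounds the positions.\<close>
    have "bdd_below ((\<lambda>u. limit_position z u t) ` all_particles a\<^sub>0 z t)"
    proof (rule bdd_belowI2)
      fix u assume "u \<in> all_particles a\<^sub>0 z t"
      then obtain N' where N': "N \<le> N'" "u \<in> particles (z (real N')) t"
        "limit_position z u t = position (z (real N')) u t"
        using large[OF t] by auto
      have "good_noise (z (real N'))" using good[of N'] N N'(1) by simp
      then show "0 \<le> limit_position z u t"
        unfolding N'(3) by (rule position_nonneg[OF _ fin[OF N'(2)] t])
    qed
    moreover have "u \<in> all_particles a\<^sub>0 z t" using u N by (auto simp: all_particles_def)
    ultimately have "leftmost a\<^sub>0 z t \<le> limit_position z u t"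
      unfolding leftmost_def by (rule cINF_lower)
    then show ?thesis using limit[OF N t u] by simp
  qed
  show "position (z (real N)) [] t = limit_position z [] t" if "0 \<le> t" for t
    using limit[OF N that root] by simp
qed

text \<open>Inverts the relation between levels and times: a time \<open>t\<close> is compared with
  the integer next to \<open>(t / K) powr \<gamma>\<close> or
  \<open>(t / \<kappa>) powr \<gamma>\<close>. Rounding and the constant \<open>R\<close> affect
  only the constants.\<close>

lemma ratio_bounds:
  fixes f :: "real \<Rightarrow> real" and \<gamma> \<kappa> K R :: real
  assumes "0 < \<gamma>" "0 < \<kappa>" "0 < K"
    and lower: "\<forall>\<^sub>F N in sequentially. \<forall>t. K * real N powr (1 / \<gamma>) \<le> t \<longrightarrow> real N \<le> f t"
    and upper: "\<forall>\<^sub>F N in sequentially. \<forall>t. 1 \<le> t \<longrightarrow> t \<le> \<kappa> * real N powr (1 / \<gamma>) \<longrightarrow> f t \<le> R + 2 * real N"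
  shows "0 < Liminf at_top (\<lambda>t. ereal (f t / t powr \<gamma>)) \<and>
    Limsup at_top (\<lambda>t. ereal (f t / t powr \<gamma>)) < \<infinity>"
proof
  obtain N1 where N1: "\<And>N t. N1 \<le> N \<Longrightarrow> K * real N powr (1 / \<gamma>) \<le> t \<Longrightarrow> real N \<le> f t"
    using lower by (auto simp: eventually_sequentially)
  obtain N2 where N2: "\<And>N t. N2 \<le> N \<Longrightarrow> 1 \<le> t \<Longrightarrow> t \<le> \<kappa> * real N powr (1 / \<gamma>) \<Longrightarrow> f t \<le> R + 2 * real N"
    using upper by (auto simp: eventually_sequentially)
  have big: "\<forall>\<^sub>F t in at_top. C \<le> (t / k) powr \<gamma>" if "0 < k" for k C :: real
  proof -
    have "filterlim (\<lambda>t. (t / k) powr \<gamma>) at_top at_top"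
      using that assms(1) by real_asymp
    then show ?thesis by (simp add: filterlim_at_top)
  qed
  have "\<forall>\<^sub>F t in at_top. ereal (1 / (2 * K powr \<gamma>)) \<le> ereal (f t / t powr \<gamma>)"
    using big[OF \<open>0 < K\<close>, of "real N1 + 2"] eventually_ge_at_top[of 1]
  proof eventually_elim
    case (elim t)
    define y where "y = (t / K) powr \<gamma>"
    \<comment> \<open>Rounding down keeps \<open>K * N powr (1 / \<gamma>) \<le> t\<close>. The 2 in
      \<open>real N1 + 2\<close> ensures that \<open>y - 1\<close> is still at least
      \<open>y / 2\<close>.\<close>
    define N where "N = nat \<lfloor>y\<rfloor>"
    have y: "real N1 + 2 \<le> y" using elim by (simp add: y_def)
    have N: "real N \<le> y" "y - 1 \<le> real N" "N1 \<le> N" using y by (auto simp: N_def le_nat_iff le_floor_iff)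
    have "real N powr (1 / \<gamma>) \<le> y powr (1 / \<gamma>)"
      using N assms by (intro powr_mono2) auto
    also have "\<dots> = t / K" using elim assms by (simp add: y_def powr_powr)
    finally have "K * real N powr (1 / \<gamma>) \<le> t" using assms by (simp add: field_simps)
    from N1[OF N(3) this] have "y / 2 \<le> f t" using N y by linarith
    moreover have "y = t powr \<gamma> / K powr \<gamma>" using elim assms by (simp add: y_def powr_divide)
    ultimately show ?case using elim assms by (simp add: field_simps)
  qed
  then have "ereal (1 / (2 * K powr \<gamma>)) \<le> Liminf at_top (\<lambda>t. ereal (f t / t powr \<gamma>))"
    by (rule Liminf_bounded)
  moreover have "0 < ereal (1 / (2 * K powr \<gamma>))" using assms by simp
  ultimately show "0 < Liminf at_top (\<lambda>t. ereal (f t / t powr \<gamma>))" by (rule less_le_trans[rotated])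
  have "\<forall>\<^sub>F t in at_top. ereal (f t / t powr \<gamma>) \<le> ereal (\<bar>R\<bar> + 2 + 2 / \<kappa> powr \<gamma>)"
    using big[OF \<open>0 < \<kappa>\<close>, of "real N2"] eventually_ge_at_top[of 1]
  proof eventually_elim
    case (elim t)
    define y where "y = (t / \<kappa>) powr \<gamma>"
    \<comment> \<open>Rounding up keeps
      \<open>t \<le> \<kappa> * N powr (1 / \<gamma>)\<close>.\<close>
    define N where "N = nat \<lceil>y\<rceil>"
    have y: "real N2 \<le> y" using elim by (simp add: y_def)
    have N: "y \<le> real N" "real N \<le> y + 1" "N2 \<le> N" using y by (auto simp: N_def le_nat_iff) linarith+
    have "t / \<kappa> = y powr (1 / \<gamma>)" using elim assms by (simp add: y_def powr_powr)
    also have "\<dots> \<le> real N powr (1 / \<gamma>)"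
      using N assms y by (intro powr_mono2) auto
    finally have "t \<le> \<kappa> * real N powr (1 / \<gamma>)" using assms by (simp add: field_simps)
    from N2[OF N(3) elim(2) this] have "f t \<le> \<bar>R\<bar> + 2 + 2 * y" using N by linarith
    also have "y = t powr \<gamma> / \<kappa> powr \<gamma>" using elim assms by (simp add: y_def powr_divide)
    also have "\<bar>R\<bar> + 2 \<le> (\<bar>R\<bar> + 2) * t powr \<gamma>"
      using ge_one_powr_ge_zero[of t \<gamma>] elim assms mult_left_mono[of 1 "t powr \<gamma>" "\<bar>R\<bar> + 2"] by simp
    finally have "f t \<le> (\<bar>R\<bar> + 2 + 2 / \<kappa> powr \<gamma>) * t powr \<gamma>" by (simp add: algebra_simps)
    then show ?case using elim by (simp add: divide_le_eq)
  qed
  then have "Limsup at_top (\<lambda>t. ereal (f t / t powr \<gamma>)) \<le> ereal (\<bar>R\<bar> + 2 + 2 / \<kappa> powr \<gamma>)"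
    by (rule Limsup_bounded)
  then show "Limsup at_top (\<lambda>t. ereal (f t / t powr \<gamma>)) < \<infinity>"
    by (rule le_less_trans) simp
qed

theorem corollary1p7:
  fixes \<alpha> \<theta> \<gamma> a\<^sub>0 :: real
    and M :: "'w measure"
    and Z :: "real \<Rightarrow> 'w \<Rightarrow> noise"
  assumes "0 < \<alpha>" and "\<alpha> < 1" and "1 < \<theta>"
    and "\<gamma> = 1 / (\<alpha> + (1 - \<alpha>) * \<theta>)"
    and "branching_subordinator M 0 (Lambda_mb \<alpha> \<theta>) a\<^sub>0 Z"
  shows "AE \<omega> in M.
    let ratio = (\<lambda>t. ereal (leftmost a\<^sub>0 (\<lambda>a. Z a \<omega>) t / t powr \<gamma>)) in
      0 < Liminf at_top ratio \<and> Liminf at_top ratio \<le> Limsup at_top ratio \<and>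
      Limsup at_top ratio < \<infinity>"
proof -
  interpret prob_space M using assms(5) by (simp add: branching_subordinator_def)
  have a0: "0 \<le> a\<^sub>0"
    and couple: "characteristic_couple 0 (Lambda_mb \<alpha> \<theta>)"
    and level: "\<And>a. a\<^sub>0 < a \<Longrightarrow> truncated_branching_subordinator M 0 (Lambda_mb \<alpha> \<theta>) a (Z a)"
    and removal: "AE \<omega> in M. \<forall>a a'. a\<^sub>0 < a \<and> a \<le> a' \<longrightarrow> obtained_by_removal a (Z a \<omega>) (Z a' \<omega>)"
    using assms(5) by (auto simp: branching_subordinator_def)
  have noise: "truncated_noise M \<alpha> \<theta> (real N) (Z (real N))" if "a\<^sub>0 < real N" for N
    using assms(1-3) a0 that level[OF that] couple
    by unfold_locales (auto simp: characteristic_couple_def)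
  define \<beta> where "\<beta> = \<alpha> + (1 - \<alpha>) * \<theta>"
  have \<beta>: "0 < \<beta>" "1 / \<gamma> = \<beta>" "0 < \<gamma>"
  proof -
    show "0 < \<beta>" unfolding \<beta>_def using assms(1-3) by (intro add_pos_pos mult_pos_pos) auto
    then show "1 / \<gamma> = \<beta>" "0 < \<gamma>" by (auto simp: assms(4) \<beta>_def)
  qed
  define c0 where "c0 = laplace_exponent \<alpha> 1"
  have c0: "0 < c0"
    unfolding c0_def using assms(1,2) couple
    by (intro laplace_exponent_pos) (auto simp: characteristic_couple_def)
  define K where "K = 6 / c0"
  define \<kappa> where "\<kappa> = 1 / (4 * c0 * (2 powr (\<theta> + 1)) powr (1 - \<alpha>))"
  have K: "0 < K" "0 < \<kappa>" using c0 by (auto simp: K_def \<kappa>_def)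
  have above: "\<forall>\<^sub>F N in sequentially. a\<^sub>0 < real N"
    using filterlim_real_sequentially by (simp add: filterlim_at_top_dense)
  have lower: "AE \<omega> in M. \<forall>\<^sub>F N in sequentially. \<forall>u\<in>particles (Z (real N) \<omega>) (K * real N powr \<beta>).
      real N \<le> position (Z (real N) \<omega>) u (K * real N powr \<beta>)"
  proof (rule borel_cantelli_exists)
    \<comment> \<open>Since \<open>\<theta> > 1\<close>, the smallness condition holds for all large
      \<open>N\<close>; the constant \<open>1 - cell_ratio\<close> is replaced by an arbitrary
      positive \<open>e\<close> while taking the limit.\<close>
    have "(\<lambda>N. exp 1 / (c0 * (2 * real N powr (\<theta> - 1))) / e / e) \<longlonglongrightarrow> 0" if "0 < e" for e :: real
      using assms(3) c0 that by real_asymp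
    from this[of "1 - cell_ratio"] have "(\<lambda>N. exp 1 / (c0 * (2 * real N powr (\<theta> - 1))) / (1 - cell_ratio) / (1 - cell_ratio)) \<longlonglongrightarrow> 0"
      using cell_ratio by simp
    then have "\<forall>\<^sub>F N in sequentially. exp 1 / (c0 * (2 * real N powr (\<theta> - 1))) / (1 - cell_ratio) / (1 - cell_ratio) < 1 / 2"
      by (rule order_tendstoD) simp
    then show "\<forall>\<^sub>F N in sequentially. \<exists>A\<in>events. prob A \<le> 2 * exp (1 / 2) / (1 - cell_ratio) * exp (- real N * 1) \<and>
      (AE \<omega> in M. \<omega> \<notin> A \<longrightarrow> (\<forall>u\<in>particles (Z (real N) \<omega>) (K * real N powr \<beta>).
        real N \<le> position (Z (real N) \<omega>) u (K * real N powr \<beta>)))"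
      using above eventually_ge_at_top[of 1]
    proof eventually_elim
      case (elim N)
      interpret truncated_noise M \<alpha> \<theta> "real N" "Z (real N)" by (rule noise) fact
      show ?case
        using lower_event[OF refl] elim by (simp add: c0_def K_def \<beta>_def)
    qed
    show "summable (\<lambda>N. 2 * exp (1 / 2) / (1 - cell_ratio) * exp (- real N * 1))"
      by (intro summable_mult summable_exp_neg) simp
  qed
  have upper: "AE \<omega> in M. \<forall>\<^sub>F N in sequentially. \<exists>u. birth (Z (real N) \<omega>) u \<le> 1 \<and>
      (\<forall>t. 1 \<le> t \<longrightarrow> t \<le> \<kappa> * real N powr \<beta> \<longrightarrow>
        position (Z (real N) \<omega>) u t \<le> position (Z (real N) \<omega>) [] 1 + 2 * real N)"
  proof (rule borel_cantelli_exists)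
    show "\<forall>\<^sub>F N in sequentially. \<exists>A\<in>events. prob A \<le> exp (- real N * (1 / 4)) \<and>
      (AE \<omega> in M. \<omega> \<notin> A \<longrightarrow> (\<exists>u. birth (Z (real N) \<omega>) u \<le> 1 \<and>
      (\<forall>t. 1 \<le> t \<longrightarrow> t \<le> \<kappa> * real N powr \<beta> \<longrightarrow>
        position (Z (real N) \<omega>) u t \<le> position (Z (real N) \<omega>) [] 1 + 2 * real N)))"
      using above eventually_ge_at_top[of 2]
    proof eventually_elim
      case (elim N)
      interpret truncated_noise M \<alpha> \<theta> "real N" "Z (real N)" by (rule noise) fact
      show ?case
        using upper_event[OF refl] elim by (simp add: c0_def \<kappa>_def \<beta>_def)
    qed
    show "summable (\<lambda>N. exp (- real N * (1 / 4)))"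
      by (intro summable_exp_neg) simp
  qed
  \<comment> \<open>Restricting to integer levels leaves countably many null sets.\<close>
  have good: "AE \<omega> in M. \<forall>N. a\<^sub>0 < real N \<longrightarrow> good_noise (Z (real N) \<omega>)"
    unfolding AE_all_countable
  proof
    fix N
    show "AE \<omega> in M. a\<^sub>0 < real N \<longrightarrow> good_noise (Z (real N) \<omega>)"
    proof (cases "a\<^sub>0 < real N")
      case True
      then interpret truncated_noise M \<alpha> \<theta> "real N" "Z (real N)" by (rule noise)
      show ?thesis using AE_good_noise by eventually_elim simp
    qed simp
  qed
  show ?thesis
    using removal good lower upper
  proof eventually_elim
    case (elim \<omega>)
    let ?z = "\<lambda>a. Z a \<omega>"
    have r: "\<And>a a'. a\<^sub>0 < a \<Longrightarrow> a \<le> a' \<Longrightarrow> obtained_by_removal a (?z a) (?z a')"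
      and g: "\<And>N. a\<^sub>0 < real N \<Longrightarrow> good_noise (?z (real N))"
      using elim(1,2) by auto
    have "\<forall>\<^sub>F N in sequentially. \<forall>t. K * real N powr (1 / \<gamma>) \<le> t \<longrightarrow> real N \<le> leftmost a\<^sub>0 ?z t"
      using elim(3) above
    proof eventually_elim
      case (elim N)
      have "0 \<le> K * real N powr \<beta>" using K by simp
      \<comment> \<open>Used with \<open>s = K * N powr \<beta>\<close>, so that a single event per
        level controls all later times.\<close>
      from leftmost_ge[where z="?z", OF r g elim(2) this _ order_refl] elim(1)
      show ?case by (simp add: \<beta>(2))
    qed
    moreover have "\<forall>\<^sub>F N in sequentially. \<forall>t. 1 \<le> t \<longrightarrow> t \<le> \<kappa> * real N powr (1 / \<gamma>) \<longrightarrow>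
        leftmost a\<^sub>0 ?z t \<le> limit_position ?z [] 1 + 2 * real N"
      using elim(4) above
    proof eventually_elim
      case (elim N)
      obtain u where u: "birth (?z (real N)) u \<le> 1"
        "\<And>t. 1 \<le> t \<Longrightarrow> t \<le> \<kappa> * real N powr \<beta> \<Longrightarrow>
          position (?z (real N)) u t \<le> position (?z (real N)) [] 1 + 2 * real N"
        using elim(1) by blast
      show ?case
      proof (intro allI impI)
        fix t assume t: "1 \<le> t" "t \<le> \<kappa> * real N powr (1 / \<gamma>)"
        have "u \<in> particles (?z (real N)) t"
          using u(1) t(1) by (auto simp: particles_def intro: order_trans)
        then have "leftmost a\<^sub>0 ?z t \<le> position (?z (real N)) u t"
          using t(1) by (intro leftmost_le[where z="?z", OF r g elim(2)]) auto
        also have "\<dots> \<le> position (?z (real N)) [] 1 + 2 * real N"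
          using t u(2) \<beta>(2) by simp
        \<comment> \<open>The limit position does not involve \<open>N\<close>, so the same constant
          serves for all levels.\<close>
        also have "position (?z (real N)) [] 1 = limit_position ?z [] 1"
          by (rule root_position[where z="?z", OF r g elim(2)]) simp_all
        finally show "leftmost a\<^sub>0 ?z t \<le> limit_position ?z [] 1 + 2 * real N" .
      qed
    qed
    ultimately have "0 < Liminf at_top (\<lambda>t. ereal (leftmost a\<^sub>0 ?z t / t powr \<gamma>)) \<and>
        Limsup at_top (\<lambda>t. ereal (leftmost a\<^sub>0 ?z t / t powr \<gamma>)) < \<infinity>"
      by (rule ratio_bounds[OF \<beta>(3) K(2) K(1)])
    then show ?case
      unfolding Let_def by (auto intro: Liminf_le_Limsup)
  qed
qed

end
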